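(* Let $\omega\in\mathbb{R}^n$ and $\sigma\ge 1$. Let $\mathbf{a},\mathbf{b}$ be positive, decreasing, integrable functions on $J_0=[0,+\infty)$ and write $\bar{\mathbf a}(t)=\int_t^{+\infty}\mathbf a(\tau)\,d\tau$, $\bar{\mathbf b}(t)=\int_t^{+\infty}\mathbf b(\tau)\,d\tau$. Assume that there exist $\upsilon\ge 0$ and a constant $\Lambda$ such that, for all $t\ge\upsilon$, $$\bar{\mathbf a}(t)\le\Lambda\,\mathbf b(t),\qquad \bar{\mathbf a}(t)\,\mathbf b(t)\le\Lambda\,\mathbf a(t)\,\bar{\mathbf b}(t).$$ Let $H:\mathbb{T}^n\times B\times J_0\to\mathbb{R}$ be a time-dependent Hamiltonian of the form $H(q,p,t)=h(q,p,t)+f(q,p,t)$ such that $h\in\mathcal{K}_\omega$; $f_0,\ (\partial_pf)_0,\ \partial_p^2H\in\bar{\mathcal S}^0_{\sigma,2}$; $\sup_{t\in J_0}|f_0^t|_{C^{\sigma+2}}<\infty$; $\sup_{t\in J_0}|\partial_p^2H^t|_{C^{\sigma+2}}<\infty$; and, for all $t\in J_0$, $$|(\partial_qf)_0^t|_{C^{\sigma+1}}\le\mathbf a(t),\qquad |(\partial_pf)_0^t|_{C^{\sigma+2}}\le\mathbf b(t).$$ Then there exist $\tilde h\in\mathcal{K}_\omega$ and a Lagrangian $C^\sigma$-asymptotic KAM torus $\varphi^t$ associated to $(X_H,X_{\tilde h},\varphi_0)$, where $\varphi_0:\mathbb{T}^n\to\mathbb{T}^n\times B$, $\varphi_0(q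)=(q,0)$.
   Context: $\mathbb{T}^n=\mathbb{R}^n/\mathbb{Z}^n$; $B\subset\mathbb{R}^n$ is a ball centred at the origin; $J_\upsilon=[\upsilon,+\infty)$. $X_H=(\partial_pH,-\partial_qH)$ is the Hamiltonian vector field of $H$, and likewise for $X_{\tilde h}$. Notation: for a function $f$ of $(q,p,t)$, $f^t(q,p)=f(q,p,t)$, $f_0(q,t)=f(q,0,t)$, $f_0^t(q)=f(q,0,t)$; similarly for $(\partial_qf)_0$, $(\partial_pf)_0$. Hölder norms: for integer $k\ge0$, $|f|_{C^k}=\sup_{|\alpha|\le k}\sup|\partial^\alpha f|$; for $\sigma=k+\mu$ with $0<\mu<1$, $|f|_{C^\sigma}=\sup_{|\alpha|\le k}\sup|\partial^\alpha f|+\sup_{|\alpha|=k}\sup_{x\ne y}|\partial^\alpha f(x)-\partial^\alpha f(y)|/|x-y|^\mu$; $C^\sigma$ is the space of $C^k$ functions with finite norm. For vector- and matrix-valued functions take the maximum over the components. $\mathcal{S}^\upsilon_\sigma$ is the space of continuous functions $f$ on $\mathbb{T}^n\times B\times J_\upsilon$ (or on $\mathbb{T}^n\times J_\upsilon$) such that $f^t\in C^\sigma$ for all $t\in J_\upsilon$. For an integer $k\ge0$, $\bar{\mathcal S}^\upsilon_{\sigma,k}$ is the space of $f\in\mathcal{S}^\upsilon_{\sigma+k}$ such that all partial derivatives $\partial^i_{(q,p)}f$ of order $i$ in $(q,p)$ (in $q$ only if $f$ is defined on $\mathbb{T}^n\times J_\upsilon$) belong to $\mathcal{S}^\upsilon_{\sigma+k-i}$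 for $0\le i\le k$. $\mathcal{K}_\omega$ is the set of Hamiltonians $h:\mathbb{T}^n\times B\times J_0\to\mathbb{R}$ in $\omega$-Kolmogorov normal form: there is $c\in\mathbb{R}$ with $h(q,0,t)=c$ and $\partial_ph(q,0,t)=\omega$ for all $(q,t)\in\mathbb{T}^n\times J_0$. $C^\sigma$-asymptotic KAM torus: let $X^t,X_0^t$ be time-dependent vector fields on $\mathcal{P}=\mathbb{T}^n\times B$ of class $C^{\sigma+k}$ for all $t\in J_\upsilon$ (some $\upsilon\ge 0$ and some integer $k\ge0$) and $\varphi_0:\mathbb{T}^n\to\mathcal{P}$ a $C^\sigma$ embedding with (i) $\lim_{t\to+\infty}|X^t-X_0^t|_{C^{\sigma+k}}=0$ and (ii) $X_0(\varphi_0(q),t)=\partial_q\varphi_0(q)\omega$ for all $(q,t)\in\mathbb{T}^n\times J_\upsilon$. A family of $C^\sigma$ embeddings $\varphi^t:\mathbb{T}^n\to\mathcal{P}$ is a $C^\sigma$-asymptotic KAM torus associated to $(X,X_0,\varphi_0)$ if there is $\upsilon'\ge\upsilon$ such that $\lim_{t\to+\infty}|\varphi^t-\varphi_0|_{C^\sigma}=0$ and $X(\varphi(q,t),t)=\partial_q\varphi(q,t)\omega+\partial_t\varphi(q,t)$ for all $(q,t)\in\mathbb{T}^n\times J_{\upsilon'}$, where $\varphi(q,t)=\varphi^t(q)$. It is Lagrangian if $\varphi^t(\mathbb{T}^n)$ is Lagrangian in $\mathbb{T}^n\times B$ (with the standard symplectic form $dp\wedge dq$) for all $t\in J_{\upsilon'}$.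 Being associated to $(X,X_0,\varphi_0)$ includes the requirement that (i) and (ii) hold. *)

theory Defs
  imports "HOL-Analysis.Analysis"
begin

text \<open>
  Objects on \<open>\<real>\<^sup>n / \<int>\<^sup>n\<close> are represented on the covering space: a function on the torus is a
  \<open>\<int>\<^sup>n\<close>-periodic function on \<^typ>\<open>real ^ 'n\<close>, and a map into the torus is a lift to \<^typ>\<open>real ^ 'n\<close>.
  Time is always the first argument, so that \<open>f t\<close> is the function \<open>f\<^sup>t\<close>.
\<close>

definition int_lattice :: "(real ^ 'n) set" where
  "int_lattice = {k. \<forall>i. k $ i \<in> \<int>}"

definition phase_lattice :: "((real ^ 'n) \<times> (real ^ 'n)) set" where
  "phase_lattice = int_lattice \<times> {0}"

definition phase_space :: "real \<Rightarrow> ((real ^ 'n) \<times> (real ^ 'n)) set" where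
  "phase_space r = UNIV \<times> ball 0 r"

definition periodic_on :: "'a::real_vector set \<Rightarrow> 'a set \<Rightarrow> ('a \<Rightarrow> 'b) \<Rightarrow> bool" where
  "periodic_on L U f \<longleftrightarrow> (\<forall>x\<in>U. \<forall>k\<in>L. f (x + k) = f x)"


section \<open>Partial derivatives and Hoelder spaces\<close>

definition has_partial :: "'a \<Rightarrow> ('a::real_normed_vector \<Rightarrow> 'b::real_normed_vector) \<Rightarrow> 'a \<Rightarrow> bool" where
  "has_partial b f x \<longleftrightarrow> (\<lambda>s::real. f (x + s *\<^sub>R b)) differentiable (at 0)"

definition partial :: "'a \<Rightarrow> ('a::real_normed_vector \<Rightarrow> 'b::real_normed_vector) \<Rightarrow> 'a \<Rightarrow> 'b" where
  "partial b f x = vector_derivative (\<lambda>s::real. f (x + s *\<^sub>R b)) (at 0)"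

text \<open>
  A partial derivative of order \<open>i\<close> is given by a list of \<open>i\<close> basis vectors rather than by a
  multi-index; for \<open>C\<^sup>k\<close> functions the order of the list is irrelevant.
\<close>

definition partials :: "'a list \<Rightarrow> ('a::real_normed_vector \<Rightarrow> 'b::real_normed_vector) \<Rightarrow> 'a \<Rightarrow> 'b" where
  "partials bs f = foldr partial bs f"

definition dirs_le :: "nat \<Rightarrow> 'a::euclidean_space list set" where
  "dirs_le k = {bs. set bs \<subseteq> Basis \<and> length bs \<le> k}"

definition dirs_eq :: "nat \<Rightarrow> 'a::euclidean_space list set" where
  "dirs_eq k = {bs. set bs \<subseteq> Basis \<and> length bs = k}"

text \<open>The sets \<open>U\<close> below are always open.\<close>

definition Ck_on :: "nat \<Rightarrow> 'a::euclidean_space set \<Rightarrow> ('a \<Rightarrow> 'b::euclidean_space) \<Rightarrow> bool" where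
  "Ck_on k U f \<longleftrightarrow> (\<forall>bs\<in>dirs_le k. continuous_on U (partials bs f) \<and>
     (length bs < k \<longrightarrow> (\<forall>b\<in>Basis. \<forall>x\<in>U. has_partial b (partials bs f) x)))"

text \<open>
  The norm takes the value \<open>\<infinity>\<close> if one of the suprema is infinite. For periodic functions the
  Hoelder quotient is maximal at nearest lifts, so the Euclidean distance on the covering space
  gives the same seminorm as the distance on the torus.
\<close>

definition holder_norm ::
    "real \<Rightarrow> 'a::euclidean_space set \<Rightarrow> ('a \<Rightarrow> 'b::euclidean_space) \<Rightarrow> ennreal" where
  "holder_norm \<sigma> U f = (SUP j\<in>Basis.
     (SUP bs\<in>dirs_le (nat \<lfloor>\<sigma>\<rfloor>). SUP x\<in>U. ennreal \<bar>partials bs f x \<bullet> j\<bar>) +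
     (if \<sigma> \<in> \<int> then 0
      else (SUP bs\<in>dirs_eq (nat \<lfloor>\<sigma>\<rfloor>). SUP (x, y)\<in>{(x, y). x \<in> U \<and> y \<in> U \<and> x \<noteq> y}.
        ennreal (\<bar>partials bs f x \<bullet> j - partials bs f y \<bullet> j\<bar> / norm (x - y) powr frac \<sigma>))))"

definition holder_on ::
    "real \<Rightarrow> 'a::euclidean_space set \<Rightarrow> ('a \<Rightarrow> 'b::euclidean_space) \<Rightarrow> bool" where
  "holder_on \<sigma> U f \<longleftrightarrow> Ck_on (nat \<lfloor>\<sigma>\<rfloor>) U f \<and> holder_norm \<sigma> U f < \<infinity>"


section \<open>Time-dependent function spaces\<close>

text \<open>
  The domain is \<open>U\<close> modulo the lattice \<open>L\<close>, times \<open>{\<upsilon>..}\<close>: \<open>\<T>\<^sup>n\<close> is given by \<open>UNIV\<close> and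
  \<^const>\<open>int_lattice\<close>, and \<open>\<T>\<^sup>n \<times> B\<close> by \<open>phase_space r\<close> and \<^const>\<open>phase_lattice\<close>.
\<close>

definition S_space :: "real \<Rightarrow> real \<Rightarrow> 'a::euclidean_space set \<Rightarrow> 'a set
    \<Rightarrow> (real \<Rightarrow> 'a \<Rightarrow> 'b::euclidean_space) set" where
  "S_space \<upsilon> \<sigma> L U = {f. continuous_on (U \<times> {\<upsilon>..}) (\<lambda>(x, t). f t x) \<and>
     (\<forall>t\<ge>\<upsilon>. periodic_on L U (f t) \<and> holder_on \<sigma> U (f t))}"

definition Sbar_space :: "real \<Rightarrow> real \<Rightarrow> nat \<Rightarrow> 'a::euclidean_space set \<Rightarrow> 'a set
    \<Rightarrow> (real \<Rightarrow> 'a \<Rightarrow> 'b::euclidean_space) set" where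
  "Sbar_space \<upsilon> \<sigma> k L U = {f. f \<in> S_space \<upsilon> (\<sigma> + real k) L U \<and>
     (\<forall>i\<le>k. \<forall>bs\<in>dirs_eq i. (\<lambda>t. partials bs (f t)) \<in> S_space \<upsilon> (\<sigma> + real (k - i)) L U)}"


section \<open>Hamiltonians\<close>

definition grad_q :: "((real ^ 'n) \<times> (real ^ 'n) \<Rightarrow> real) \<Rightarrow> (real ^ 'n) \<times> (real ^ 'n) \<Rightarrow> real ^ 'n" where
  "grad_q f x = (\<chi> i. partial (axis i 1, 0) f x)"

definition grad_p :: "((real ^ 'n) \<times> (real ^ 'n) \<Rightarrow> real) \<Rightarrow> (real ^ 'n) \<times> (real ^ 'n) \<Rightarrow> real ^ 'n" where
  "grad_p f x = (\<chi> i. partial (0, axis i 1) f x)"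

definition hess_p :: "((real ^ 'n) \<times> (real ^ 'n) \<Rightarrow> real) \<Rightarrow> (real ^ 'n) \<times> (real ^ 'n) \<Rightarrow> real ^ 'n ^ 'n" where
  "hess_p f x = (\<chi> i j. partial (0, axis j 1) (partial (0, axis i 1) f) x)"

definition has_hess_p :: "((real ^ 'n) \<times> (real ^ 'n) \<Rightarrow> real) \<Rightarrow> (real ^ 'n) \<times> (real ^ 'n) \<Rightarrow> bool" where
  "has_hess_p f x \<longleftrightarrow> (\<forall>i j. has_partial (0, axis j 1) (partial (0, axis i 1) f) x)"

text \<open>Existence of the first partial derivatives is what is needed for the vector field to make sense.\<close>

definition hamiltonian :: "real \<Rightarrow> (real \<Rightarrow> (real ^ 'n) \<times> (real ^ 'n) \<Rightarrow> real) \<Rightarrow> bool" where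
  "hamiltonian r H \<longleftrightarrow> (\<forall>t\<ge>0. periodic_on phase_lattice (phase_space r) (H t) \<and>
     (\<forall>x\<in>phase_space r. \<forall>b\<in>Basis. has_partial b (H t) x))"

definition ham_vf :: "(real \<Rightarrow> (real ^ 'n) \<times> (real ^ 'n) \<Rightarrow> real)
    \<Rightarrow> real \<Rightarrow> (real ^ 'n) \<times> (real ^ 'n) \<Rightarrow> (real ^ 'n) \<times> (real ^ 'n)" where
  "ham_vf H t x = (grad_p (H t) x, - grad_q (H t) x)"

definition kolmogorov_nf ::
    "real \<Rightarrow> real ^ 'n \<Rightarrow> (real \<Rightarrow> (real ^ 'n) \<times> (real ^ 'n) \<Rightarrow> real) set" where
  "kolmogorov_nf r \<omega> = {h. hamiltonian r h \<and>
     (\<exists>c. \<forall>t\<ge>0. \<forall>q. h t (q, 0) = c \<and> grad_p (h t) (q, 0) = \<omega>)}"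


section \<open>Asymptotic KAM tori\<close>

text \<open>
  A lift of a \<open>C\<^sup>\<sigma>\<close> map of the torus need not be bounded, so its regularity is required on each
  ball. Since the torus is compact, an injective immersion is an embedding.
\<close>

definition torus_embedding ::
    "real \<Rightarrow> real \<Rightarrow> (real ^ 'n \<Rightarrow> (real ^ 'n) \<times> (real ^ 'n)) \<Rightarrow> bool" where
  "torus_embedding r \<sigma> \<psi> \<longleftrightarrow>
     range \<psi> \<subseteq> phase_space r \<and>
     (\<forall>q. \<forall>k\<in>int_lattice. \<psi> (q + k) - \<psi> q \<in> phase_lattice) \<and>
     (\<forall>R. holder_on \<sigma> (ball 0 R) \<psi>) \<and>
     (\<forall>q q'. \<psi> q - \<psi> q' \<in> phase_lattice \<longrightarrow> q - q' \<in> int_lattice) \<and>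
     (\<forall>q. \<exists>D. (\<psi> has_derivative D) (at q) \<and> inj D)"

definition symp :: "(real ^ 'n) \<times> (real ^ 'n) \<Rightarrow> (real ^ 'n) \<times> (real ^ 'n) \<Rightarrow> real" where
  "symp v w = snd v \<bullet> fst w - snd w \<bullet> fst v"

definition lagrangian_subspace :: "((real ^ 'n) \<times> (real ^ 'n)) set \<Rightarrow> bool" where
  "lagrangian_subspace V \<longleftrightarrow>
     subspace V \<and> dim V = CARD('n) \<and> (\<forall>v\<in>V. \<forall>w\<in>V. symp v w = 0)"

text \<open>The tangent space of the embedded torus at \<open>\<psi> q\<close> is the range of the derivative of \<open>\<psi>\<close> at \<open>q\<close>.\<close>

definition lagrangian_torus :: "(real ^ 'n \<Rightarrow> (real ^ 'n) \<times> (real ^ 'n)) \<Rightarrow> bool" where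
  "lagrangian_torus \<psi> \<longleftrightarrow> (\<forall>q. lagrangian_subspace (range (frechet_derivative \<psi> (at q))))"

definition asymptotic_kam_torus_from ::
    "real \<Rightarrow> real \<Rightarrow> real ^ 'n \<Rightarrow> real
     \<Rightarrow> (real \<Rightarrow> (real ^ 'n) \<times> (real ^ 'n) \<Rightarrow> (real ^ 'n) \<times> (real ^ 'n))
     \<Rightarrow> (real \<Rightarrow> (real ^ 'n) \<times> (real ^ 'n) \<Rightarrow> (real ^ 'n) \<times> (real ^ 'n))
     \<Rightarrow> (real ^ 'n \<Rightarrow> (real ^ 'n) \<times> (real ^ 'n))
     \<Rightarrow> (real \<Rightarrow> real ^ 'n \<Rightarrow> (real ^ 'n) \<times> (real ^ 'n)) \<Rightarrow> bool" where
  "asymptotic_kam_torus_from \<upsilon>' r \<omega> \<sigma> X X0 \<phi>0 \<phi> \<longleftrightarrow> (\<exists>\<upsilon> (k::nat). 0 \<le> \<upsilon> \<and> \<upsilon> \<le> \<upsilon>' \<and>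
     (\<forall>t\<ge>\<upsilon>. periodic_on phase_lattice (phase_space r) (X t) \<and>
             holder_on (\<sigma> + real k) (phase_space r) (X t) \<and>
             periodic_on phase_lattice (phase_space r) (X0 t) \<and>
             holder_on (\<sigma> + real k) (phase_space r) (X0 t)) \<and>
     torus_embedding r \<sigma> \<phi>0 \<and>
     ((\<lambda>t. holder_norm (\<sigma> + real k) (phase_space r) (\<lambda>x. X t x - X0 t x)) \<longlongrightarrow> 0) at_top \<and>
     (\<forall>t\<ge>\<upsilon>. \<forall>q. X0 t (\<phi>0 q) = frechet_derivative \<phi>0 (at q) \<omega>) \<and>
     (\<forall>t\<ge>\<upsilon>'. torus_embedding r \<sigma> (\<phi> t)) \<and>
     ((\<lambda>t. holder_norm \<sigma> UNIV (\<lambda>q. \<phi> t q - \<phi>0 q)) \<longlongrightarrow> 0) at_top \<and>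
     (\<forall>t\<ge>\<upsilon>'. \<forall>q. \<exists>d. ((\<lambda>s. \<phi> s q) has_vector_derivative d) (at t within {\<upsilon>'..}) \<and>
        X t (\<phi> t q) = frechet_derivative (\<phi> t) (at q) \<omega> + d))"

definition lagrangian_asymptotic_kam_torus ::
    "real \<Rightarrow> real ^ 'n \<Rightarrow> real
     \<Rightarrow> (real \<Rightarrow> (real ^ 'n) \<times> (real ^ 'n) \<Rightarrow> (real ^ 'n) \<times> (real ^ 'n))
     \<Rightarrow> (real \<Rightarrow> (real ^ 'n) \<times> (real ^ 'n) \<Rightarrow> (real ^ 'n) \<times> (real ^ 'n))
     \<Rightarrow> (real ^ 'n \<Rightarrow> (real ^ 'n) \<times> (real ^ 'n))
     \<Rightarrow> (real \<Rightarrow> real ^ 'n \<Rightarrow> (real ^ 'n) \<times> (real ^ 'n)) \<Rightarrow> bool" where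
  "lagrangian_asymptotic_kam_torus r \<omega> \<sigma> X X0 \<phi>0 \<phi> \<longleftrightarrow>
     (\<exists>\<upsilon>'. asymptotic_kam_torus_from \<upsilon>' r \<omega> \<sigma> X X0 \<phi>0 \<phi> \<and> (\<forall>t\<ge>\<upsilon>'. lagrangian_torus (\<phi> t)))"

end

theory Submission
  imports Defs
begin

text \<open>
  For the Hamiltonian field write \<open>X\<^sub>H = (\<omega> + GU, GV)\<close>. A torus that follows the linear flow consists
  of trajectories \<open>\<psi>\<^sub>t(q) = (q + t \<omega> + u\<^sub>t(q), v\<^sub>t(q))\<close>, and those with \<open>u\<^sub>t, v\<^sub>t \<rightarrow> 0\<close> are exactly the
  decaying solutions of
  \<open>u\<^sub>t = - \<integral>\<^sub>t\<^sup>\<infinity> GU\<^sub>s(\<psi>\<^sub>s) ds\<close>, \<open>v\<^sub>t = - \<integral>\<^sub>t\<^sup>\<infinity> GV\<^sub>s(\<psi>\<^sub>s) ds\<close>.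
  The asymptotic torus is then \<open>\<phi>\<^sub>t(q) = \<psi>\<^sub>t(q - t \<omega>)\<close>. In these variables no small divisors occur,
  so \<open>\<omega>\<close> is arbitrary, and the invariance equation is a fixed point problem in time.

  Taylor expansion of \<open>H\<close> at \<open>p = 0\<close> gives \<open>GU = \<beta> + A p\<close> and \<open>GV = \<alpha> + B p + C(p, p)\<close>, where \<open>\<alpha>\<close> is of
  size \<open>a\<close>, where \<open>\<beta>\<close> and \<open>B\<close> are of size \<open>b\<close>, and where \<open>A\<close>, \<open>C\<close> are averages of \<open>\<partial>\<^sub>p\<^sup>2 H\<close> or of its
  derivatives along the fibre and hence only bounded (\<open>taylor_ball\<close>, \<open>hfam_fibre_average\<close>,
  \<open>H_gradients\<close>, \<open>field_exists\<close>). Let \<open>aa\<close>, \<open>bb\<close> be the tail integrals of \<open>a\<close>, \<open>b\<close>. One looks for \<open>u\<close> of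
  size \<open>bb\<close> and \<open>v\<close> of size \<open>aa\<close>: the integrand of \<open>u\<close> is then \<open>O(b + aa) = O(b)\<close> by the first hypothesis
  on \<open>a\<close>, \<open>b\<close>, and that of \<open>v\<close> is \<open>O(a + b aa + aa\<^sup>2) = O(a)\<close> by both. The same bounds for differences
  make the Picard iteration a contraction for large times (\<open>field_estimates\<close>, \<open>asymptotic_solution\<close>).
  The one term without a small factor, the influence of \<open>v\<close> on \<open>u\<close> through \<open>A p\<close>, is absorbed by
  weighting the two components differently.

  The iteration is carried out in \<open>C\<^sup>\<sigma>\<close> norms in \<open>q\<close>, for which compositions are controlled
  by \<open>hfam_compose\<close> and differences of compositions by \<open>hfam_compose_diff\<close>. The latter costs one
  derivative of the coefficients, and another one is spent in forming \<open>B\<close> and \<open>C\<close>; this is the reason for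
  the regularity \<open>\<sigma> + 2\<close> in the hypotheses. Integration in time is \<open>hfam_tail_integral\<close>.

  As normal form serves \<open>h' = H - f(q, 0, t) - \<partial>\<^sub>p f(q, 0, t) \<bullet> p\<close>, whose field differs from \<open>X\<^sub>H\<close> by terms
  of size \<open>a\<close> and \<open>b\<close> (\<open>h'_kolmogorov\<close>, \<open>perturbation_hfam\<close>). The tori are Lagrangian because the
  linearised flow preserves the symplectic form, so its value on two tangent vectors is constant along
  each trajectory, and it tends to 0 since \<open>\<phi>\<^sub>t\<close> tends to the zero section (\<open>phi_lagrangian\<close>).
\<close>

section \<open>Partial derivatives\<close>

lemma has_partial_of_derivative:
  assumes "(f has_derivative D) (at x)"
  shows "has_partial b f x" and "partial b f x = D b"
proof -
  interpret bounded_linear D by (rule has_derivative_bounded_linear[OF assms])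
  have line: "((\<lambda>s::real. x + s *\<^sub>R b) has_derivative (\<lambda>s. s *\<^sub>R b)) (at 0)"
    by (auto intro!: derivative_eq_intros)
  have "((\<lambda>s::real. f (x + s *\<^sub>R b)) has_derivative (\<lambda>s. D (s *\<^sub>R b))) (at 0)"
    using diff_chain_at[OF line, of f D] assms by (simp add: o_def)
  then have *: "((\<lambda>s::real. f (x + s *\<^sub>R b)) has_vector_derivative D b) (at 0)"
    by (simp add: has_vector_derivative_def scaleR)
  then show "has_partial b f x"
    unfolding has_partial_def has_vector_derivative_def differentiable_def by blast
  from * show "partial b f x = D b"
    unfolding partial_def by (rule vector_derivative_at)
qed

lemma differentiable_has_partial:
  assumes "f differentiable (at x)"
  shows "has_partial b f x"
proof -
  obtain D where "(f has_derivative D) (at x)" using assms by (auto simp: differentiable_def)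
  then show ?thesis by (rule has_partial_of_derivative(1))
qed

lemma has_vector_derivative_partial:
  assumes "has_partial b f (x + s *\<^sub>R b)"
  shows "((\<lambda>s::real. f (x + s *\<^sub>R b)) has_vector_derivative partial b f (x + s *\<^sub>R b)) (at s)"
proof -
  have "((\<lambda>u::real. f (x + s *\<^sub>R b + u *\<^sub>R b)) has_vector_derivative partial b f (x + s *\<^sub>R b)) (at (-s + s))"
    using assms unfolding has_partial_def partial_def by (simp add: vector_derivative_works)
  moreover have "((\<lambda>u. -s + u) has_real_derivative 1) (at s)"
    by (auto intro!: derivative_eq_intros)
  ultimately have "(((\<lambda>u::real. f (x + s *\<^sub>R b + u *\<^sub>R b)) \<circ> (\<lambda>u. -s + u)) has_vector_derivative
      1 *\<^sub>R partial b f (x + s *\<^sub>R b)) (at s)"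
    using vector_diff_chain_at[of "\<lambda>u. -s + u" 1 s] by (simp add: has_real_derivative_iff_has_vector_derivative)
  moreover have "(\<lambda>u::real. f (x + s *\<^sub>R b + u *\<^sub>R b)) \<circ> (\<lambda>u. -s + u) = (\<lambda>s. f (x + s *\<^sub>R b))"
    by (auto simp: fun_eq_iff algebra_simps)
  ultimately show ?thesis by simp
qed

lemma partial_cong:
  assumes "open U" "x \<in> U" and eq: "\<And>y. y \<in> U \<Longrightarrow> f y = g y"
  shows "partial b f x = partial b g x" and "has_partial b f x \<longleftrightarrow> has_partial b g x"
proof -
  have "((\<lambda>s::real. x + s *\<^sub>R b) \<longlongrightarrow> x + 0 *\<^sub>R b) (nhds 0)"
    by (intro tendsto_intros filterlim_ident)
  then have ev: "\<forall>\<^sub>F s in nhds 0. x + s *\<^sub>R b \<in> U"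
    using assms(1,2) topological_tendstoD by fastforce
  then have ev': "\<forall>\<^sub>F s in nhds 0. f (x + s *\<^sub>R b) = g (x + s *\<^sub>R b)"
    by eventually_elim (rule eq)
  have 1: "((\<lambda>s. f (x + s *\<^sub>R b)) has_vector_derivative d) (at 0) \<longleftrightarrow>
      ((\<lambda>s. g (x + s *\<^sub>R b)) has_vector_derivative d) (at 0)" for d
    by (rule has_vector_derivative_cong_ev) (use ev' assms(2) eq in auto)
  then show "partial b f x = partial b g x"
    by (simp add: partial_def vector_derivative_def)
  show "has_partial b f x \<longleftrightarrow> has_partial b g x"
    using 1 by (metis has_partial_def differentiableI_vector vector_derivative_works)
qed

lemma partial_translate:
  "partial b f (x + k) = partial b (\<lambda>y. f (y + k)) x"
  "has_partial b f (x + k) \<longleftrightarrow> has_partial b (\<lambda>y. f (y + k)) x"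
  by (simp_all add: partial_def has_partial_def algebra_simps)

lemma has_derivative_partials:
  assumes "f differentiable (at x)"
  shows "(f has_derivative (\<lambda>h. \<Sum>b\<in>Basis. (h \<bullet> b) *\<^sub>R partial b f x)) (at x)"
proof -
  obtain D where D: "(f has_derivative D) (at x)" using assms by (auto simp: differentiable_def)
  interpret bounded_linear D by (rule has_derivative_bounded_linear[OF D])
  have "D h = (\<Sum>b\<in>Basis. (h \<bullet> b) *\<^sub>R partial b f x)" for h
  proof -
    have "D h = D (\<Sum>b\<in>Basis. (h \<bullet> b) *\<^sub>R b)" by (simp add: euclidean_representation)
    also have "\<dots> = (\<Sum>b\<in>Basis. (h \<bullet> b) *\<^sub>R partial b f x)"
      by (simp add: sum scaleR has_partial_of_derivative(2)[OF D])
    finally show ?thesis .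
  qed
  then have "D = (\<lambda>h. \<Sum>b\<in>Basis. (h \<bullet> b) *\<^sub>R partial b f x)" by auto
  with D show ?thesis by simp
qed

text \<open>
  The classical telescoping argument: moving along one coordinate direction at a time, each
  increment is controlled by the mean value theorem and the continuity of one partial derivative.
\<close>

lemma differentiable_if_continuous_partials:
  fixes f :: "'a::euclidean_space \<Rightarrow> 'b::real_normed_vector"
  assumes U: "open U" "x \<in> U"
    and part: "\<And>b y. b \<in> Basis \<Longrightarrow> y \<in> U \<Longrightarrow> has_partial b f y"
    and cont: "\<And>b. b \<in> Basis \<Longrightarrow> continuous_on U (partial b f)"
  shows "f differentiable (at x)"
proof -
  let ?P = "\<lambda>S (h::'a). \<Sum>b\<in>S. (h \<bullet> b) *\<^sub>R b"
  let ?D = "\<lambda>S (h::'a). \<Sum>b\<in>S. (h \<bullet> b) *\<^sub>R partial b f x"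
  have claim: "\<forall>e>0. \<exists>d>0. \<forall>h. norm h < d \<longrightarrow> norm (f (x + ?P S h) - f x - ?D S h) \<le> e * norm h"
    if "finite S" "S \<subseteq> Basis" for S
    using that
  proof (induction S rule: finite_induct)
    case empty
    show ?case by (auto intro!: exI[of _ 1])
  next
    case (insert c S)
    then have c: "c \<in> Basis" "S \<subseteq> Basis" by auto
    show ?case
    proof (intro allI impI)
      fix e :: real assume e: "e > 0"
      obtain d1 where d1: "d1 > 0"
        "\<And>h. norm h < d1 \<Longrightarrow> norm (f (x + ?P S h) - f x - ?D S h) \<le> (e/2) * norm h"
        using insert.IH[OF c(2)] e half_gt_zero by blast
      obtain d0 where d0: "d0 > 0" "ball x d0 \<subseteq> U" using U openE by blast
      have "\<exists>d2>0. \<forall>y\<in>U. dist y x < d2 \<longrightarrow> dist (partial c f y) (partial c f x) < e/2"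
        using cont[OF c(1)] U(2) half_gt_zero[OF e] unfolding continuous_on_iff by blast
      then obtain d2 where d2: "d2 > 0"
        "\<And>y. y \<in> U \<Longrightarrow> dist y x < d2 \<Longrightarrow> dist (partial c f y) (partial c f x) < e/2" by blast
      define m where "m = real (card S) + 1"
      have m: "m > 0" by (simp add: m_def)
      define d where "d = min d1 (min d0 d2 / m)"
      have "d > 0" using d1 d0 d2 m by (simp add: d_def)
      moreover have "norm (f (x + ?P (insert c S) h) - f x - ?D (insert c S) h) \<le> e * norm h"
        if h: "norm h < d" for h
      proof -
        have small: "norm (?P S h + s *\<^sub>R c) < min d0 d2" if "\<bar>s\<bar> \<le> \<bar>h \<bullet> c\<bar>" for s
        proof -
          have "norm (?P S h + s *\<^sub>R c) \<le> (\<Sum>b\<in>S. \<bar>h \<bullet> b\<bar>) + \<bar>s\<bar>"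
            by (rule norm_triangle_le) (use c in \<open>auto intro!: add_mono sum_norm_le simp: norm_Basis subset_iff\<close>)
          also have "\<dots> \<le> (\<Sum>b\<in>S. norm h) + norm h"
            using that c by (intro add_mono sum_mono) (auto simp: Basis_le_norm subset_iff intro: order_trans[OF _ Basis_le_norm])
          also have "\<dots> = m * norm h" by (simp add: m_def algebra_simps)
          also have "\<dots> < min d0 d2" using h m by (simp add: d_def field_simps)
          finally show ?thesis .
        qed
        define z where "z = x + ?P S h"
        have zU: "z + s *\<^sub>R c \<in> U" "dist (z + s *\<^sub>R c) x < d2" if "\<bar>s\<bar> \<le> \<bar>h \<bullet> c\<bar>" for s
        proof -
          have "z + s *\<^sub>R c - x = ?P S h + s *\<^sub>R c" by (simp add: z_def)
          then have "dist (z + s *\<^sub>R c) x < min d0 d2" using small[OF that] by (simp only: dist_norm)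
          then show "z + s *\<^sub>R c \<in> U" "dist (z + s *\<^sub>R c) x < d2"
            using d0(2) by (auto simp: dist_commute subset_iff)
        qed
        have seg: "\<bar>s\<bar> \<le> \<bar>h \<bullet> c\<bar>" if "s \<in> closed_segment 0 (h \<bullet> c)" for s
          using that by (auto simp: closed_segment_eq_real_ivl split: if_splits)
        have "norm (f (z + (h \<bullet> c) *\<^sub>R c) - f z - (h \<bullet> c) *\<^sub>R partial c f x)
            \<le> norm (h \<bullet> c) * (e/2)"
        proof -
          have "norm ((\<lambda>s. f (z + s *\<^sub>R c) - s *\<^sub>R partial c f x) (h \<bullet> c) - (\<lambda>s. f (z + s *\<^sub>R c) - s *\<^sub>R partial c f x) 0)
             \<le> (e/2) * norm (h \<bullet> c - 0)"
          proof (rule differentiable_bound[where S="closed_segment 0 (h \<bullet> c)" and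
                f'="\<lambda>s u. u *\<^sub>R (partial c f (z + s *\<^sub>R c) - partial c f x)"])
            fix s assume s: "s \<in> closed_segment 0 (h \<bullet> c)"
            have "((\<lambda>s. f (z + s *\<^sub>R c)) has_derivative (\<lambda>u. u *\<^sub>R partial c f (z + s *\<^sub>R c))) (at s within closed_segment 0 (h \<bullet> c))"
              using has_vector_derivative_partial[OF part[OF c(1) zU(1)[OF seg[OF s]]]]
              by (simp add: has_vector_derivative_def has_derivative_at_withinI)
            then show "((\<lambda>s. f (z + s *\<^sub>R c) - s *\<^sub>R partial c f x) has_derivative (\<lambda>u. u *\<^sub>R (partial c f (z + s *\<^sub>R c) - partial c f x))) (at s within closed_segment 0 (h \<bullet> c))"
              by (auto intro!: derivative_eq_intros simp: algebra_simps)
            have "norm (partial c f (z + s *\<^sub>R c) - partial c f x) \<le> e/2"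
              using d2(2)[OF zU[OF seg[OF s]]] by (simp add: dist_norm)
            then show "onorm (\<lambda>u. u *\<^sub>R (partial c f (z + s *\<^sub>R c) - partial c f x)) \<le> e / 2"
              by (intro onorm_le) (metis mult.commute mult_right_mono norm_ge_zero norm_scaleR real_norm_def)
          qed auto
          then show ?thesis by (simp add: algebra_simps)
        qed
        also have "\<dots> \<le> norm h * (e/2)"
          using Basis_le_norm[OF c(1), of h] e by (intro mult_right_mono) auto
        finally have A: "norm (f (z + (h \<bullet> c) *\<^sub>R c) - f z - (h \<bullet> c) *\<^sub>R partial c f x) \<le> norm h * (e/2)" .
        have B: "norm (f z - f x - ?D S h) \<le> (e/2) * norm h"
          unfolding z_def by (rule d1(2)) (use h in \<open>simp add: d_def\<close>)
        have eq: "f (x + ?P (insert c S) h) - f x - ?D (insert c S) h =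
          (f (z + (h \<bullet> c) *\<^sub>R c) - f z - (h \<bullet> c) *\<^sub>R partial c f x) + (f z - f x - ?D S h)"
          using insert.hyps by (simp add: z_def algebra_simps)
        show ?thesis unfolding eq by (rule norm_triangle_le) (use A B in \<open>simp add: field_simps\<close>)
      qed
      ultimately show "\<exists>d>0. \<forall>h. norm h < d \<longrightarrow> norm (f (x + ?P (insert c S) h) - f x - ?D (insert c S) h) \<le> e * norm h"
        by blast
    qed
  qed
  have "(f has_derivative ?D Basis) (at x)"
    unfolding has_derivative_at_alt
  proof (intro conjI allI impI)
    show "bounded_linear (?D Basis)"
      by (intro bounded_linear_sum bounded_linear_compose[OF bounded_linear_scaleR_left] bounded_linear_inner_left)
    fix e :: real assume "e > 0"
    then obtain d where d: "d > 0" "\<And>h. norm h < d \<Longrightarrow> norm (f (x + ?P Basis h) - f x - ?D Basis h) \<le> e * norm h"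
      using claim[of Basis] by auto
    show "\<exists>d>0. \<forall>y. norm (y - x) < d \<longrightarrow> norm (f y - f x - ?D Basis (y - x)) \<le> e * norm (y - x)"
      using d(1) d(2)[of "y - x" for y] by (auto simp: euclidean_representation intro!: exI[of _ d])
  qed
  then show ?thesis by (auto simp: differentiable_def)
qed

lemma lipschitz_if_bounded_partials:
  fixes f :: "'a::euclidean_space \<Rightarrow> 'b::real_normed_vector"
  assumes "convex U" "open U" and diff: "\<And>x. x \<in> U \<Longrightarrow> f differentiable (at x)"
    and bound: "\<And>x b. x \<in> U \<Longrightarrow> b \<in> Basis \<Longrightarrow> norm (partial b f x) \<le> M"
    and xy: "x \<in> U" "y \<in> U"
  shows "norm (f x - f y) \<le> real DIM('a) * M * norm (x - y)"
proof (rule differentiable_bound[OF assms(1) _ _ xy])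
  fix z assume z: "z \<in> U"
  show "(f has_derivative (\<lambda>h. \<Sum>b\<in>Basis. (h \<bullet> b) *\<^sub>R partial b f z)) (at z within U)"
    by (rule has_derivative_at_withinI[OF has_derivative_partials[OF diff[OF z]]])
  show "onorm (\<lambda>h. \<Sum>b\<in>Basis. (h \<bullet> b) *\<^sub>R partial b f z) \<le> real DIM('a) * M"
  proof (rule onorm_le)
    fix h :: 'a
    have "norm (\<Sum>b\<in>Basis. (h \<bullet> b) *\<^sub>R partial b f z) \<le> (\<Sum>b\<in>(Basis::'a set). norm h * M)"
      by (rule sum_norm_le) (auto intro!: mult_mono bound z Basis_le_norm)
    then show "norm (\<Sum>b\<in>Basis. (h \<bullet> b) *\<^sub>R partial b f z) \<le> real DIM('a) * M * norm h"
      by (simp add: algebra_simps)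
  qed
qed


section \<open>Rules for partial derivatives\<close>

lemma sum_Basis_inner:
  fixes b :: "'a::euclidean_space" and v :: "'a \<Rightarrow> 'b::real_vector"
  assumes "b \<in> Basis"
  shows "(\<Sum>c\<in>Basis. (b \<bullet> c) *\<^sub>R v c) = v b"
proof -
  have "(\<Sum>c\<in>Basis. (b \<bullet> c) *\<^sub>R v c) = (\<Sum>c\<in>Basis. if c = b then v c else 0)"
    by (rule sum.cong) (use assms in \<open>auto simp: inner_Basis\<close>)
  then show ?thesis using assms by simp
qed

lemma partial_add:
  assumes "f differentiable (at x)" "g differentiable (at x)"
  shows "partial b (\<lambda>x. f x + g x) x = partial b f x + partial b g x"
proof -
  obtain D E where D: "(f has_derivative D) (at x)" and E: "(g has_derivative E) (at x)"
    using assms by (auto simp: differentiable_def)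
  show ?thesis
    using has_partial_of_derivative(2)[OF has_derivative_add[OF D E], of b]
      has_partial_of_derivative(2)[OF D, of b] has_partial_of_derivative(2)[OF E, of b] by simp
qed

lemma partial_linear:
  assumes "bounded_linear T" "f differentiable (at x)"
  shows "partial b (\<lambda>x. T (f x)) x = T (partial b f x)"
proof -
  obtain D where D: "(f has_derivative D) (at x)" using assms by (auto simp: differentiable_def)
  show ?thesis
    using has_partial_of_derivative(2)[OF bounded_linear.has_derivative[OF assms(1) D], of b]
      has_partial_of_derivative(2)[OF D, of b] by simp
qed

lemma partial_scaleR:
  assumes "f differentiable (at x)" "g differentiable (at x)"
  shows "partial b (\<lambda>x. f x *\<^sub>R g x) x = f x *\<^sub>R partial b g x + partial b f x *\<^sub>R g x"
proof -
  obtain D E where D: "(f has_derivative D) (at x)" and E: "(g has_derivative E) (at x)"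
    using assms by (auto simp: differentiable_def)
  show ?thesis
    using has_partial_of_derivative(2)[OF has_derivative_scaleR[OF D E], of b]
      has_partial_of_derivative(2)[OF D, of b] has_partial_of_derivative(2)[OF E, of b] by simp
qed

lemma partial_compose:
  assumes "g differentiable (at x)" "F differentiable (at (g x))"
  shows "partial b (\<lambda>x. F (g x)) x = (\<Sum>c\<in>Basis. (partial b g x \<bullet> c) *\<^sub>R partial c F (g x))"
proof -
  obtain D where D: "(g has_derivative D) (at x)" using assms by (auto simp: differentiable_def)
  show ?thesis
    using has_partial_of_derivative(2)[OF has_derivative_compose[OF D has_derivative_partials[OF assms(2)]], of b]
      has_partial_of_derivative(2)[OF D, of b] by simp
qed

lemma differentiable_cong:
  assumes "open U" "x \<in> U" "\<And>y. y \<in> U \<Longrightarrow> f y = g y" "f differentiable (at x)"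
  shows "g differentiable (at x)"
  using assms has_derivative_transform_within_open[of f _ x UNIV U g]
  unfolding differentiable_def by blast


section \<open>Families of Hoelder functions\<close>

text \<open>
  The predicate \<open>hfam k \<mu> I U M f\<close> says that the functions \<open>f t\<close>, \<open>t \<in> I\<close>, are of class
  \<open>C\<^sup>k\<^sup>+\<^sup>\<mu>\<close> on \<open>U\<close> with norm at most \<open>M t\<close> up to a constant factor, and that the derivatives up to
  order \<open>k\<close> are jointly continuous in \<open>(t, x)\<close>. Three choices make all later inductions on \<open>k\<close>
  uniform. The Hoelder quotient is bounded at every order and not only at the top, so that
  lowering \<open>k\<close> costs nothing. For \<open>\<mu> = 0\<close> this condition bounds the oscillation, so integer and
  non-integer orders need no distinction. For \<open>I = {t}\<close> joint continuity is plain continuity, so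
  the predicate also describes a single function.
\<close>

definition hfam0 :: "real \<Rightarrow> real set \<Rightarrow> 'a::euclidean_space set \<Rightarrow> (real \<Rightarrow> real)
    \<Rightarrow> (real \<Rightarrow> 'a \<Rightarrow> 'b::real_normed_vector) \<Rightarrow> bool" where
  "hfam0 \<mu> I U M f \<longleftrightarrow> continuous_on (I \<times> U) (\<lambda>(t, x). f t x) \<and>
     (\<forall>t\<in>I. \<forall>x\<in>U. norm (f t x) \<le> M t \<and>
       (\<forall>y\<in>U. norm (f t x - f t y) \<le> M t * norm (x - y) powr \<mu>))"

primrec hfam :: "nat \<Rightarrow> real \<Rightarrow> real set \<Rightarrow> 'a::euclidean_space set \<Rightarrow> (real \<Rightarrow> real)
    \<Rightarrow> (real \<Rightarrow> 'a \<Rightarrow> 'b::real_normed_vector) \<Rightarrow> bool" where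
  "hfam 0 \<mu> I U M f \<longleftrightarrow> hfam0 \<mu> I U M f"
| "hfam (Suc k) \<mu> I U M f \<longleftrightarrow> hfam0 \<mu> I U M f \<and>
     (\<forall>t\<in>I. \<forall>x\<in>U. f t differentiable (at x)) \<and>
     (\<forall>b\<in>Basis. hfam k \<mu> I U M (\<lambda>t. partial b (f t)))"

lemma hfam_hfam0: "hfam k \<mu> I U M f \<Longrightarrow> hfam0 \<mu> I U M f"
  by (cases k) auto

lemma hfam_continuous: "hfam k \<mu> I U M f \<Longrightarrow> continuous_on (I \<times> U) (\<lambda>(t, x). f t x)"
  using hfam_hfam0 unfolding hfam0_def by blast

lemma hfam_bound: "hfam k \<mu> I U M f \<Longrightarrow> t \<in> I \<Longrightarrow> x \<in> U \<Longrightarrow> norm (f t x) \<le> M t"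
  using hfam_hfam0 unfolding hfam0_def by blast

lemma hfam_nonneg: "hfam k \<mu> I U M f \<Longrightarrow> t \<in> I \<Longrightarrow> x \<in> U \<Longrightarrow> 0 \<le> M t"
  using hfam_bound norm_ge_zero order_trans by metis

lemma hfam_holder: "hfam k \<mu> I U M f \<Longrightarrow> t \<in> I \<Longrightarrow> x \<in> U \<Longrightarrow> y \<in> U \<Longrightarrow>
    norm (f t x - f t y) \<le> M t * norm (x - y) powr \<mu>"
  using hfam_hfam0 unfolding hfam0_def by blast

lemma hfam_partial: "hfam (Suc k) \<mu> I U M f \<Longrightarrow> b \<in> Basis \<Longrightarrow> hfam k \<mu> I U M (\<lambda>t. partial b (f t))"
  by simp

lemma hfam_differentiable:
  "hfam (Suc k) \<mu> I U M f \<Longrightarrow> t \<in> I \<Longrightarrow> x \<in> U \<Longrightarrow> f t differentiable (at x)"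
  by simp

lemma hfam_Suc_lower: "hfam (Suc k) \<mu> I U M f \<Longrightarrow> hfam k \<mu> I U M f"
  by (induction k arbitrary: f) auto

lemma hfam_cong:
  assumes "open U" "hfam k \<mu> I U M f" "\<And>t x. t \<in> I \<Longrightarrow> x \<in> U \<Longrightarrow> f t x = g t x"
  shows "hfam k \<mu> I U M g"
  using assms(2,3)
proof (induction k arbitrary: f g)
  case 0
  have "continuous_on (I \<times> U) (\<lambda>(t, x). g t x) \<longleftrightarrow> continuous_on (I \<times> U) (\<lambda>(t, x). f t x)"
    by (rule continuous_on_cong) (use 0 in auto)
  with 0 show ?case by (auto simp: hfam0_def)
next
  case (Suc k)
  have "continuous_on (I \<times> U) (\<lambda>(t, x). g t x) \<longleftrightarrow> continuous_on (I \<times> U) (\<lambda>(t, x). f t x)"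
    by (rule continuous_on_cong) (use Suc in auto)
  with Suc.prems have "hfam0 \<mu> I U M g" by (auto simp: hfam0_def)
  moreover have "g t differentiable (at x)" if "t \<in> I" "x \<in> U" for t x
    using differentiable_cong[OF assms(1) that(2), of "f t" "g t"] Suc.prems that by auto
  moreover have "hfam k \<mu> I U M (\<lambda>t. partial b (g t))" if "b \<in> Basis" for b
  proof (rule Suc.IH[OF hfam_partial[OF Suc.prems(1) that]])
    fix t x assume "t \<in> I" "x \<in> U"
    then show "partial b (f t) x = partial b (g t) x"
      using Suc.prems(2) by (intro partial_cong(1)[OF assms(1)]) auto
  qed
  ultimately show ?case by simp
qed

lemma hfam_subset_mono:
  assumes "hfam k \<mu> I U M f" "J \<subseteq> I" "V \<subseteq> U" "\<And>t x. t \<in> J \<Longrightarrow> x \<in> V \<Longrightarrow> M t \<le> N t"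
  shows "hfam k \<mu> J V N f"
  using assms(1)
proof (induction k arbitrary: f)
  case 0
  then have "continuous_on (J \<times> V) (\<lambda>(t, x). f t x)"
    using assms(2,3) by (auto simp: hfam0_def elim!: continuous_on_subset)
  with 0 show ?case using assms(2-) unfolding hfam.simps hfam0_def
    by (meson mult_right_mono order_trans powr_ge_zero subsetD)
next
  case (Suc k)
  then have "continuous_on (J \<times> V) (\<lambda>(t, x). f t x)"
    using assms(2,3) by (auto simp: hfam0_def elim!: continuous_on_subset)
  with hfam_hfam0[OF Suc.prems] have "hfam0 \<mu> J V N f" using assms(2-) unfolding hfam0_def
    by (meson mult_right_mono order_trans powr_ge_zero subsetD)
  moreover have "f t differentiable (at x)" if "t \<in> J" "x \<in> V" for t x
    using hfam_differentiable[OF Suc.prems, of t x] that assms(2,3) by (simp add: subsetD)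
  ultimately show ?case using Suc.IH[OF hfam_partial[OF Suc.prems]] by simp
qed

lemma hfam_mono:
  "hfam k \<mu> I U M f \<Longrightarrow> (\<And>t x. t \<in> I \<Longrightarrow> x \<in> U \<Longrightarrow> M t \<le> N t) \<Longrightarrow> hfam k \<mu> I U N f"
  by (rule hfam_subset_mono) auto

lemma hfam_at: "hfam k \<mu> I U M f \<Longrightarrow> t \<in> I \<Longrightarrow> hfam k \<mu> {t} U M f"
  by (rule hfam_subset_mono) auto

lemma hfam_const:
  fixes c :: "'b::real_normed_vector"
  assumes "norm c \<le> K"
  shows "hfam k \<mu> I U (\<lambda>_. K) (\<lambda>t x. c)"
  using assms
proof (induction k arbitrary: c K)
  case 0
  have "0 \<le> K" using 0 norm_ge_zero order_trans by blast
  then show ?case using 0 by (auto simp: hfam0_def)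
next
  case (Suc k)
  have K: "0 \<le> K" using Suc.prems norm_ge_zero order_trans by blast
  have "partial b (\<lambda>x. c) = (\<lambda>x. 0)" for b :: 'a
    using has_partial_of_derivative(2)[OF has_derivative_const] by auto
  moreover have "hfam k \<mu> I U (\<lambda>_. K) (\<lambda>t x. 0 :: 'b)" by (rule Suc.IH) (simp add: K)
  ultimately show ?case using Suc.prems K by (auto simp: hfam0_def)
qed

lemma hfam_add:
  fixes f g :: "real \<Rightarrow> 'a::euclidean_space \<Rightarrow> 'b::real_normed_vector"
  assumes "open U" "hfam k \<mu> I U M f" "hfam k \<mu> I U N g"
  shows "hfam k \<mu> I U (\<lambda>t. M t + N t) (\<lambda>t x. f t x + g t x)"
proof -
  have base: "hfam0 \<mu> I U (\<lambda>t. M t + N t) (\<lambda>t x. f t x + g t x)"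
    if f: "hfam0 \<mu> I U M f" and g: "hfam0 \<mu> I U N g" for f g :: "real \<Rightarrow> 'a \<Rightarrow> 'b"
  proof -
    have "continuous_on (I \<times> U) (\<lambda>z. f (fst z) (snd z) + g (fst z) (snd z))"
      using f g by (intro continuous_on_add) (auto simp: hfam0_def split_beta)
    moreover have "norm (f t x + g t x) \<le> M t + N t" if "t \<in> I" "x \<in> U" for t x
      using f g that by (intro norm_triangle_mono) (auto simp: hfam0_def)
    moreover have "norm (f t x + g t x - (f t y + g t y)) \<le> (M t + N t) * norm (x - y) powr \<mu>"
      if "t \<in> I" "x \<in> U" "y \<in> U" for t x y
    proof -
      have "norm ((f t x - f t y) + (g t x - g t y)) \<le> M t * norm (x - y) powr \<mu> + N t * norm (x - y) powr \<mu>"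
        using f g that by (intro norm_triangle_mono) (auto simp: hfam0_def)
      then show ?thesis by (simp add: algebra_simps)
    qed
    ultimately show ?thesis by (auto simp: hfam0_def split_beta)
  qed
  show ?thesis using assms(2,3)
  proof (induction k arbitrary: f g)
    case 0
    then show ?case by (simp add: base)
  next
    case (Suc k)
    have "hfam k \<mu> I U (\<lambda>t. M t + N t) (\<lambda>t. partial b (\<lambda>x. f t x + g t x))" if b: "b \<in> Basis" for b
      by (rule hfam_cong[OF assms(1) Suc.IH[OF Suc.prems[THEN hfam_partial, OF b]]])
        (use Suc.prems in \<open>simp add: partial_add\<close>)
    with Suc.prems show ?case by (auto intro: differentiable_add base)
  qed
qed

lemma hfam_linear:
  assumes "open U" and T: "bounded_linear T" "\<And>y. norm (T y) \<le> B * norm y" "0 \<le> B" and "hfam k \<mu> I U M f"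
  shows "hfam k \<mu> I U (\<lambda>t. B * M t) (\<lambda>t x. T (f t x))"
proof -
  interpret bounded_linear T by fact
  have base: "hfam0 \<mu> I U (\<lambda>t. B * M t) (\<lambda>t x. T (f t x))" if "hfam0 \<mu> I U M f" for f
  proof -
    have "continuous_on (I \<times> U) (\<lambda>z. T (f (fst z) (snd z)))"
      using that by (intro continuous_on) (auto simp: hfam0_def split_beta)
    moreover have "norm (T (f t x)) \<le> B * M t" if "t \<in> I" "x \<in> U" for t x
      using T(2)[of "f t x"] \<open>0 \<le> B\<close> \<open>hfam0 \<mu> I U M f\<close> that
      by (meson hfam0_def mult_left_mono order_trans)
    moreover have "norm (T (f t x) - T (f t y)) \<le> B * M t * norm (x - y) powr \<mu>"
      if "t \<in> I" "x \<in> U" "y \<in> U" for t x y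
    proof -
      have "norm (T (f t x) - T (f t y)) \<le> B * norm (f t x - f t y)"
        using T(2)[of "f t x - f t y"] by (simp add: diff)
      also have "\<dots> \<le> B * (M t * norm (x - y) powr \<mu>)"
        using \<open>0 \<le> B\<close> \<open>hfam0 \<mu> I U M f\<close> that by (auto simp: hfam0_def intro!: mult_left_mono)
      finally show ?thesis by (simp add: algebra_simps)
    qed
    ultimately show ?thesis by (auto simp: hfam0_def split_beta)
  qed
  show ?thesis using assms(5)
  proof (induction k arbitrary: f)
    case 0
    then show ?case by (simp add: base)
  next
    case (Suc k)
    have "hfam k \<mu> I U (\<lambda>t. B * M t) (\<lambda>t. partial b (\<lambda>x. T (f t x)))" if b: "b \<in> Basis" for b
      by (rule hfam_cong[OF assms(1) Suc.IH[OF Suc.prems[THEN hfam_partial, OF b]]])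
        (use Suc.prems in \<open>simp add: partial_linear[OF T(1)]\<close>)
    moreover have "(\<lambda>x. T (f t x)) differentiable (at x)" if tx: "t \<in> I" "x \<in> U" for t x
    proof -
      obtain D where "(f t has_derivative D) (at x)"
        using hfam_differentiable[OF Suc.prems tx] by (auto simp: differentiable_def)
      from has_derivative[OF this] show ?thesis unfolding differentiable_def by (intro exI)
    qed
    ultimately show ?case using Suc.prems by (auto simp: base)
  qed
qed

lemma hfam_minus: "open U \<Longrightarrow> hfam k \<mu> I U M f \<Longrightarrow> hfam k \<mu> I U M (\<lambda>t x. - f t x)"
  using hfam_linear[of U uminus 1 k \<mu> I M f] by (simp add: bounded_linear_minus bounded_linear_ident)

lemma hfam_diff:
  assumes "open U" "hfam k \<mu> I U M f" "hfam k \<mu> I U N g"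
  shows "hfam k \<mu> I U (\<lambda>t. M t + N t) (\<lambda>t x. f t x - g t x)"
  using hfam_add[OF assms(1,2) hfam_minus[OF assms(1,3)]] by simp

lemma hfam_inner:
  assumes "open U" "hfam k \<mu> I U M f" "b \<in> Basis"
  shows "hfam k \<mu> I U M (\<lambda>t x. f t x \<bullet> b)"
  using hfam_linear[OF assms(1), of "\<lambda>y. y \<bullet> b" 1 k \<mu> I M f] assms(2,3)
  by (simp add: bounded_linear_inner_left Basis_le_norm)

lemma hfam_sum:
  assumes "open U" "finite S" "\<And>i. i \<in> S \<Longrightarrow> hfam k \<mu> I U (M i) (f i)"
  shows "hfam k \<mu> I U (\<lambda>t. \<Sum>i\<in>S. M i t) (\<lambda>t x. \<Sum>i\<in>S. f i t x)"
  using assms(2,3)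
proof (induction S rule: finite_induct)
  case empty
  then show ?case by (simp add: hfam_const)
next
  case (insert i S)
  have "hfam k \<mu> I U (\<lambda>t. M i t + (\<Sum>i\<in>S. M i t)) (\<lambda>t x. f i t x + (\<Sum>i\<in>S. f i t x))"
    using insert by (intro hfam_add[OF assms(1)]) auto
  with insert.hyps show ?case by simp
qed

lemma norm_scaleR_diff_le:
  assumes "\<bar>p\<bar> \<le> M" "norm v \<le> N" "\<bar>p - p'\<bar> \<le> M * e" "norm (v - v') \<le> N * e" "norm v' \<le> N" "\<bar>p'\<bar> \<le> M"
  shows "norm (p *\<^sub>R v - p' *\<^sub>R v') \<le> 2 * (M * N) * e"
proof -
  have "p *\<^sub>R v - p' *\<^sub>R v' = p *\<^sub>R (v - v') + (p - p') *\<^sub>R v'" by (simp add: algebra_simps)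
  also have "norm \<dots> \<le> \<bar>p\<bar> * norm (v - v') + \<bar>p - p'\<bar> * norm v'" by (metis norm_scaleR norm_triangle_ineq real_norm_def)
  also have "\<dots> \<le> M * (N * e) + (M * e) * N"
    by (rule add_mono; rule mult_mono) (use assms in \<open>auto intro: order_trans[OF norm_ge_zero] order_trans[OF abs_ge_zero]\<close>)
  finally show ?thesis by (simp add: algebra_simps)
qed

text \<open>
  The Hoelder quotient of a product contributes one factor 2, and each application of the product
  rule another one.
\<close>

lemma hfam_scaleR:
  fixes f :: "real \<Rightarrow> 'a::euclidean_space \<Rightarrow> real"
  assumes "open U" "hfam k \<mu> I U M f" "hfam k \<mu> I U N g"
  shows "hfam k \<mu> I U (\<lambda>t. 2 ^ Suc k * (M t * N t)) (\<lambda>t x. f t x *\<^sub>R g t x)"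
proof -
  have base: "hfam0 \<mu> I U (\<lambda>t. C * (M t * N t)) (\<lambda>t x. f t x *\<^sub>R g t x)"
    if f: "hfam0 \<mu> I U M f" and g: "hfam0 \<mu> I U N g" and C: "2 \<le> C"
    for f :: "real \<Rightarrow> 'a \<Rightarrow> real" and g and C :: real
  proof -
    have "continuous_on (I \<times> U) (\<lambda>z. f (fst z) (snd z) *\<^sub>R g (fst z) (snd z))"
      using f g by (intro continuous_on_scaleR) (auto simp: hfam0_def split_beta)
    moreover have "norm (f t x *\<^sub>R g t x) \<le> C * (M t * N t) \<and> norm (f t x *\<^sub>R g t x - f t y *\<^sub>R g t y) \<le> C * (M t * N t) * norm (x - y) powr \<mu>"
      if t: "t \<in> I" "x \<in> U" "y \<in> U" for t x y
    proof -
      have b: "\<bar>f t x\<bar> \<le> M t" "norm (g t x) \<le> N t" "\<bar>f t y\<bar> \<le> M t" "norm (g t y) \<le> N t"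
        "\<bar>f t x - f t y\<bar> \<le> M t * norm (x - y) powr \<mu>" "norm (g t x - g t y) \<le> N t * norm (x - y) powr \<mu>"
        using f g t by (auto simp: hfam0_def)
      have MN: "0 \<le> M t * N t" using b by (meson abs_ge_zero mult_nonneg_nonneg norm_ge_zero order_trans)
      have "norm (f t x *\<^sub>R g t x) \<le> M t * N t" using b by (auto intro!: mult_mono intro: order_trans[OF abs_ge_zero])
      also have "\<dots> \<le> C * (M t * N t)" using MN C by (simp add: mult_le_cancel_right1)
      finally have 1: "norm (f t x *\<^sub>R g t x) \<le> C * (M t * N t)" .
      have "norm (f t x *\<^sub>R g t x - f t y *\<^sub>R g t y) \<le> 2 * (M t * N t) * norm (x - y) powr \<mu>"
        by (rule norm_scaleR_diff_le) (use b in auto)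
      also have "\<dots> \<le> C * (M t * N t) * norm (x - y) powr \<mu>"
        using MN C by (intro mult_right_mono) auto
      finally show ?thesis using 1 by simp
    qed
    ultimately show ?thesis by (auto simp: hfam0_def split_beta)
  qed
  show ?thesis using assms(2,3)
  proof (induction k arbitrary: f g)
    case 0
    then show ?case using base[of f g 2] by simp
  next
    case (Suc k)
    note low = Suc.prems[THEN hfam_Suc_lower]
    have "hfam k \<mu> I U (\<lambda>t. 2 ^ Suc (Suc k) * (M t * N t)) (\<lambda>t. partial b (\<lambda>x. f t x *\<^sub>R g t x))" if b: "b \<in> Basis" for b
    proof -
      have "hfam k \<mu> I U (\<lambda>t. 2 ^ Suc (Suc k) * (M t * N t)) (\<lambda>t x. f t x *\<^sub>R partial b (g t) x + partial b (f t) x *\<^sub>R g t x)"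
        using hfam_add[OF assms(1) Suc.IH[OF low(1) hfam_partial[OF Suc.prems(2) b]] Suc.IH[OF hfam_partial[OF Suc.prems(1) b] low(2)]]
        by (simp add: algebra_simps)
      then show ?thesis
        by (rule hfam_cong[OF assms(1)]) (use Suc.prems in \<open>simp add: partial_scaleR\<close>)
    qed
    moreover have "hfam0 \<mu> I U (\<lambda>t. 2 ^ Suc (Suc k) * (M t * N t)) (\<lambda>t x. f t x *\<^sub>R g t x)"
      by (rule base) (use Suc.prems self_le_power[of "2::real" "Suc (Suc k)"] in auto)
    ultimately show ?case using Suc.prems by (auto intro: differentiable_scaleR)
  qed
qed

lemma hfam_Pair0:
  assumes "open U" "hfam k \<mu> I U M f"
  shows "hfam k \<mu> I U M (\<lambda>t x. (f t x, 0))" "hfam k \<mu> I U M (\<lambda>t x. (0, f t x))"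
proof -
  have *: "bounded_linear (\<lambda>y. (y, 0))" "bounded_linear (\<lambda>y. (0, y))"
    by (auto intro: bounded_linear_Pair bounded_linear_ident bounded_linear_zero)
  show "hfam k \<mu> I U M (\<lambda>t x. (f t x, 0))"
    using hfam_linear[OF assms(1) *(1), of 1 k \<mu> I M f] assms(2) by simp
  show "hfam k \<mu> I U M (\<lambda>t x. (0, f t x))"
    using hfam_linear[OF assms(1) *(2), of 1 k \<mu> I M f] assms(2) by simp
qed

lemma hfam_Pair:
  assumes "open U" "hfam k \<mu> I U M f" "hfam k \<mu> I U N g"
  shows "hfam k \<mu> I U (\<lambda>t. M t + N t) (\<lambda>t x. (f t x, g t x))"
  using hfam_add[OF assms(1) hfam_Pair0(1)[OF assms(1,2)] hfam_Pair0(2)[OF assms(1,3)]] by simp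


section \<open>Composition\<close>

text \<open>
  The inner maps of the compositions below are perturbations of translations. They are unbounded,
  but their derivatives are not, so only these are controlled.
\<close>

definition lipfam :: "nat \<Rightarrow> real \<Rightarrow> real set \<Rightarrow> 'a::euclidean_space set \<Rightarrow> real
    \<Rightarrow> (real \<Rightarrow> 'a \<Rightarrow> 'b::real_normed_vector) \<Rightarrow> bool" where
  "lipfam k \<mu> I U L g \<longleftrightarrow> continuous_on (I \<times> U) (\<lambda>(t, x). g t x) \<and>
     (\<forall>t\<in>I. \<forall>x\<in>U. \<forall>y\<in>U. norm (g t x - g t y) \<le> L * norm (x - y)) \<and>
     (\<forall>j. k = Suc j \<longrightarrow> (\<forall>t\<in>I. \<forall>x\<in>U. g t differentiable (at x)) \<and>
        (\<forall>b\<in>Basis. hfam j \<mu> I U (\<lambda>_. L) (\<lambda>t. partial b (g t))))"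

lemma lipfam_Suc_lower: "lipfam (Suc k) \<mu> I U L g \<Longrightarrow> lipfam k \<mu> I U L g"
  by (cases k) (auto simp: lipfam_def intro: hfam_Suc_lower simp del: hfam.simps)

lemma lipfam_partial: "lipfam (Suc k) \<mu> I U L g \<Longrightarrow> b \<in> Basis \<Longrightarrow> hfam k \<mu> I U (\<lambda>_. L) (\<lambda>t. partial b (g t))"
  by (simp add: lipfam_def)

lemma lipfam_differentiable:
  "lipfam (Suc k) \<mu> I U L g \<Longrightarrow> t \<in> I \<Longrightarrow> x \<in> U \<Longrightarrow> g t differentiable (at x)"
  by (simp add: lipfam_def)

lemma powr_mult_le:
  fixes L x \<mu> :: real
  assumes "1 \<le> L" "0 \<le> x" "0 \<le> \<mu>" "\<mu> \<le> 1"
  shows "(L * x) powr \<mu> \<le> L * x powr \<mu>"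
proof -
  have "L powr \<mu> \<le> L powr 1" using assms by (intro powr_mono) auto
  then show ?thesis using assms by (auto simp: powr_mult intro!: mult_right_mono)
qed

lemma compose_continuous_family:
  assumes "continuous_on (I \<times> V) (\<lambda>(t, x). F t x)" "continuous_on (I \<times> U) (\<lambda>(t, x). g t x)"
    "\<And>t x. t \<in> I \<Longrightarrow> x \<in> U \<Longrightarrow> g t x \<in> V"
  shows "continuous_on (I \<times> U) (\<lambda>(t, x). F t (g t x))"
proof -
  have "continuous_on (I \<times> U) (\<lambda>z. (\<lambda>(t, x). F t x) (fst z, g (fst z) (snd z)))"
    by (rule continuous_on_compose2[OF assms(1)])
      (use assms(2,3) in \<open>auto intro!: continuous_intros simp: split_beta\<close>)
  then show ?thesis by (simp add: split_beta)
qed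

text \<open>
  By the chain rule each partial derivative of \<open>F \<circ> g\<close> is a sum of products of a partial
  derivative of \<open>F\<close> composed with \<open>g\<close> and a partial derivative of \<open>g\<close>: induct on \<open>k\<close>.
\<close>

lemma hfam_compose:
  fixes L \<mu> :: real
  assumes L: "1 \<le> L" and \<mu>: "0 \<le> \<mu>" "\<mu> \<le> 1"
  shows "\<exists>C\<ge>1. \<forall>I (U::'a::euclidean_space set) (V::'c::euclidean_space set) M
      (F :: real \<Rightarrow> 'c \<Rightarrow> 'b::real_normed_vector) g.
    open U \<longrightarrow> hfam k \<mu> I V M F \<longrightarrow> lipfam k \<mu> I U L g \<longrightarrow> (\<forall>t\<in>I. \<forall>x\<in>U. g t x \<in> V) \<longrightarrow>
    hfam k \<mu> I U (\<lambda>t. C * M t) (\<lambda>t x. F t (g t x))"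
proof -
  have base: "hfam0 \<mu> I U (\<lambda>t. C * M t) (\<lambda>t x. F t (g t x))"
    if "L \<le> C" and F: "hfam k \<mu> I V M F" and g: "lipfam k \<mu> I U L g" and V: "\<forall>t\<in>I. \<forall>x\<in>U. g t x \<in> V"
    for k I M C and U :: "'a set" and V :: "'c set" and F :: "real \<Rightarrow> 'c \<Rightarrow> 'b" and g
  proof -
    have "continuous_on (I \<times> U) (\<lambda>(t, x). F t (g t x))"
      by (rule compose_continuous_family[OF hfam_continuous[OF F]]) (use g V in \<open>auto simp: lipfam_def\<close>)
    moreover have "norm (F t (g t x)) \<le> C * M t \<and>
        norm (F t (g t x) - F t (g t y)) \<le> C * M t * norm (x - y) powr \<mu>"
      if t: "t \<in> I" "x \<in> U" "y \<in> U" for t x y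
    proof -
      have M: "0 \<le> M t" and le: "norm (F t (g t x)) \<le> M t"
        using hfam_nonneg[OF F t(1)] hfam_bound[OF F t(1)] V t by blast+
      have "norm (F t (g t x)) \<le> 1 * M t" using le by simp
      also have "\<dots> \<le> C * M t" using M L \<open>L \<le> C\<close> by (intro mult_right_mono) auto
      finally have 1: "norm (F t (g t x)) \<le> C * M t" .
      have "norm (F t (g t x) - F t (g t y)) \<le> M t * norm (g t x - g t y) powr \<mu>"
        using hfam_holder[OF F t(1)] V t by blast
      also have "\<dots> \<le> M t * (L * norm (x - y)) powr \<mu>"
        using g t M \<mu> by (auto simp: lipfam_def intro!: mult_left_mono powr_mono2)
      also have "\<dots> \<le> M t * (L * norm (x - y) powr \<mu>)"
        using M by (intro mult_left_mono powr_mult_le) (use L \<mu> in auto)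
      also have "\<dots> \<le> M t * (C * norm (x - y) powr \<mu>)"
        using M \<open>L \<le> C\<close> by (intro mult_left_mono mult_right_mono) auto
      finally show ?thesis using 1 by (simp add: algebra_simps)
    qed
    ultimately show ?thesis by (auto simp: hfam0_def)
  qed
  show ?thesis
  proof (induction k)
    case 0
    show ?case by (rule exI[of _ L]) (use L base[of L 0] in auto)
  next
    case (Suc k)
    then obtain C where C: "1 \<le> C" and IH:
      "\<And>I (U::'a set) (V::'c set) M (F::real \<Rightarrow> 'c \<Rightarrow> 'b) g. open U \<Longrightarrow> hfam k \<mu> I V M F \<Longrightarrow> lipfam k \<mu> I U L g \<Longrightarrow>
        (\<forall>t\<in>I. \<forall>x\<in>U. g t x \<in> V) \<Longrightarrow> hfam k \<mu> I U (\<lambda>t. C * M t) (\<lambda>t x. F t (g t x))"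
      by blast
    define P where "P = real DIM('c) * (2 ^ Suc k * (L * C))"
    have P: "0 \<le> P" using L C by (simp add: P_def)
    show ?case
    proof (intro exI[of _ "L + P"] conjI allI impI)
      show "1 \<le> L + P" using L P by simp
    next
      fix I and U :: "'a set" and V :: "'c set" and M and F :: "real \<Rightarrow> 'c \<Rightarrow> 'b" and g
      assume U: "open U" and F: "hfam (Suc k) \<mu> I V M F" and g: "lipfam (Suc k) \<mu> I U L g"
        and V: "\<forall>t\<in>I. \<forall>x\<in>U. g t x \<in> V"
      have "hfam0 \<mu> I U (\<lambda>t. (L + P) * M t) (\<lambda>t x. F t (g t x))"
        by (rule base[OF _ F g V]) (use P in simp)
      moreover have "(\<lambda>x. F t (g t x)) differentiable (at x)" if "t \<in> I" "x \<in> U" for t x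
        using differentiable_chain_at[OF lipfam_differentiable[OF g that] hfam_differentiable[OF F that(1)]] V that
        by (simp add: o_def)
      moreover have "hfam k \<mu> I U (\<lambda>t. (L + P) * M t) (\<lambda>t. partial b (\<lambda>x. F t (g t x)))" if b: "b \<in> Basis" for b
      proof -
        have "hfam k \<mu> I U (\<lambda>t. \<Sum>c\<in>(Basis::'c set). 2 ^ Suc k * (L * (C * M t)))
            (\<lambda>t x. \<Sum>c\<in>Basis. (partial b (g t) x \<bullet> c) *\<^sub>R partial c (F t) (g t x))"
        proof (rule hfam_sum[OF U finite_Basis])
          fix c :: 'c assume c: "c \<in> Basis"
          show "hfam k \<mu> I U (\<lambda>t. 2 ^ Suc k * (L * (C * M t)))
              (\<lambda>t x. (partial b (g t) x \<bullet> c) *\<^sub>R partial c (F t) (g t x))"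
            by (rule hfam_scaleR[OF U hfam_inner[OF U lipfam_partial[OF g b] c]
                  IH[OF U hfam_partial[OF F c] lipfam_Suc_lower[OF g] V]])
        qed
        then have "hfam k \<mu> I U (\<lambda>t. P * M t)
            (\<lambda>t x. \<Sum>c\<in>Basis. (partial b (g t) x \<bullet> c) *\<^sub>R partial c (F t) (g t x))"
          by (simp add: P_def algebra_simps)
        then have "hfam k \<mu> I U (\<lambda>t. P * M t) (\<lambda>t. partial b (\<lambda>x. F t (g t x)))"
        proof (rule hfam_cong[OF U])
          fix t x assume tx: "t \<in> I" "x \<in> U"
          show "(\<Sum>c\<in>Basis. (partial b (g t) x \<bullet> c) *\<^sub>R partial c (F t) (g t x)) = partial b (\<lambda>x. F t (g t x)) x"
            using tx V by (intro partial_compose[symmetric] lipfam_differentiable[OF g] hfam_differentiable[OF F]) auto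
        qed
        then show ?thesis
          by (rule hfam_mono) (use L V hfam_nonneg[OF F] in \<open>fastforce intro!: mult_right_mono\<close>)
      qed
      ultimately show "hfam (Suc k) \<mu> I U (\<lambda>t. (L + P) * M t) (\<lambda>t x. F t (g t x))" by simp
    qed
  qed
qed

lemma sum_scaleR_inner_diff_le:
  fixes d e :: "'c::euclidean_space" and v w :: "'c \<Rightarrow> 'b::real_normed_vector"
  assumes "\<And>c. c \<in> Basis \<Longrightarrow> norm (v c) \<le> M" "\<And>c. c \<in> Basis \<Longrightarrow> norm (v c - w c) \<le> N"
  shows "norm ((\<Sum>c\<in>Basis. (d \<bullet> c) *\<^sub>R v c) - (\<Sum>c\<in>Basis. (e \<bullet> c) *\<^sub>R w c)) \<le> real DIM('c) * (norm (d - e) * M + norm e * N)"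
proof -
  have "(\<Sum>c\<in>Basis. (d \<bullet> c) *\<^sub>R v c) - (\<Sum>c\<in>Basis. (e \<bullet> c) *\<^sub>R w c)
      = (\<Sum>c\<in>Basis. ((d - e) \<bullet> c) *\<^sub>R v c + (e \<bullet> c) *\<^sub>R (v c - w c))"
    by (simp add: sum_subtractf[symmetric] sum.distrib[symmetric] algebra_simps inner_diff_left)
  also have "norm \<dots> \<le> (\<Sum>c\<in>(Basis::'c set). norm (d - e) * M + norm e * N)"
  proof (rule sum_norm_le)
    fix c :: 'c assume c: "c \<in> Basis"
    show "norm (((d - e) \<bullet> c) *\<^sub>R v c + (e \<bullet> c) *\<^sub>R (v c - w c)) \<le> norm (d - e) * M + norm e * N"
      by (rule norm_triangle_mono; simp only: norm_scaleR real_norm_def; rule mult_mono)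
        (use assms[OF c] c in \<open>auto simp: Basis_le_norm\<close>)
  qed
  finally show ?thesis by (simp add: algebra_simps)
qed

text \<open>
  The increment of \<open>F \<circ> g\<^sub>1 - F \<circ> g\<^sub>2\<close> between two points is estimated by applying the mean value
  theorem to \<open>F\<close> along the two segments from \<open>g\<^sub>2\<close> to \<open>g\<^sub>1\<close> simultaneously; this uses one more
  derivative of \<open>F\<close> than the estimate provides.
\<close>

lemma compose_diff_holder:
  fixes F :: "'c::euclidean_space \<Rightarrow> 'b::real_normed_vector"
  assumes V: "convex V" and diff: "\<And>z. z \<in> V \<Longrightarrow> F differentiable (at z)"
    and bound: "\<And>c z. c \<in> Basis \<Longrightarrow> z \<in> V \<Longrightarrow> norm (partial c F z) \<le> M"
    and hold: "\<And>c z w. c \<in> Basis \<Longrightarrow> z \<in> V \<Longrightarrow> w \<in> V \<Longrightarrow> norm (partial c F z - partial c F w) \<le> M * norm (z - w) powr \<mu>"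
    and in_V: "x1 \<in> V" "x2 \<in> V" "y1 \<in> V" "y2 \<in> V"
    and L: "1 \<le> L" and \<mu>: "0 \<le> \<mu>" "\<mu> \<le> 1" and \<rho>: "0 \<le> \<rho>"
    and lip: "norm (x1 - y1) \<le> L * \<rho>" "norm (x2 - y2) \<le> L * \<rho>"
    and D: "norm (y1 - y2) \<le> D" "norm ((x1 - x2) - (y1 - y2)) \<le> D * \<rho> powr \<mu>"
  shows "norm ((F x1 - F x2) - (F y1 - F y2)) \<le> real DIM('c) * (1 + L) * M * D * \<rho> powr \<mu>"
proof -
  define z where "z = (\<lambda>s. x2 + s *\<^sub>R (x1 - x2))"
  define w where "w = (\<lambda>s. y2 + s *\<^sub>R (y1 - y2))"
  have z: "z s \<in> V" and w: "w s \<in> V" if "s \<in> {0..1}" for s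
  proof -
    have "z s = (1 - s) *\<^sub>R x2 + s *\<^sub>R x1" "w s = (1 - s) *\<^sub>R y2 + s *\<^sub>R y1"
      by (auto simp: z_def w_def algebra_simps)
    then show "z s \<in> V" "w s \<in> V" using V in_V that by (auto simp: convex_def)
  qed
  have D0: "0 \<le> D" using D(1) norm_ge_zero order_trans by blast
  have M0: "0 \<le> M" using bound[OF SOME_Basis in_V(1)] norm_ge_zero order_trans by blast
  let ?d = "\<lambda>s. (\<Sum>c\<in>Basis. ((x1 - x2) \<bullet> c) *\<^sub>R partial c F (z s)) - (\<Sum>c\<in>Basis. ((y1 - y2) \<bullet> c) *\<^sub>R partial c F (w s))"
  have deriv: "((\<lambda>s. F (z s) - F (w s)) has_derivative (\<lambda>u. u *\<^sub>R ?d s)) (at s within {0..1})" if s: "s \<in> {0..1}" for s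
  proof -
    have zd: "(z has_derivative (\<lambda>u. u *\<^sub>R (x1 - x2))) (at s)" and wd: "(w has_derivative (\<lambda>u. u *\<^sub>R (y1 - y2))) (at s)"
      by (auto simp: z_def w_def intro!: derivative_eq_intros)
    have 1: "((\<lambda>s. F (z s)) has_derivative (\<lambda>u. u *\<^sub>R (\<Sum>c\<in>Basis. ((x1 - x2) \<bullet> c) *\<^sub>R partial c F (z s)))) (at s)"
      using has_derivative_compose[OF zd has_derivative_partials[OF diff[OF z[OF s]]]]
      by (simp add: scaleR_sum_right)
    have 2: "((\<lambda>s. F (w s)) has_derivative (\<lambda>u. u *\<^sub>R (\<Sum>c\<in>Basis. ((y1 - y2) \<bullet> c) *\<^sub>R partial c F (w s)))) (at s)"
      using has_derivative_compose[OF wd has_derivative_partials[OF diff[OF w[OF s]]]]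
      by (simp add: scaleR_sum_right)
    from has_derivative_diff[OF 1 2] show ?thesis
      by (simp add: scaleR_diff_right has_derivative_at_withinI)
  qed
  have bd: "norm (?d s) \<le> real DIM('c) * (1 + L) * M * D * \<rho> powr \<mu>" if s: "s \<in> {0..1}" for s
  proof -
    have "z s - w s = (1 - s) *\<^sub>R (x2 - y2) + s *\<^sub>R (x1 - y1)" by (simp add: z_def w_def algebra_simps)
    also have "norm \<dots> \<le> (1 - s) * (L * \<rho>) + s * (L * \<rho>)"
      by (rule norm_triangle_mono) (use s lip in \<open>auto intro!: mult_left_mono\<close>)
    finally have zw: "norm (z s - w s) \<le> L * \<rho>" by (simp add: algebra_simps)
    have "norm (z s - w s) powr \<mu> \<le> (L * \<rho>) powr \<mu>" using zw \<mu> by (intro powr_mono2) auto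
    also have "\<dots> \<le> L * \<rho> powr \<mu>" by (rule powr_mult_le) (use L \<rho> \<mu> in auto)
    finally have zw': "norm (z s - w s) powr \<mu> \<le> L * \<rho> powr \<mu>" .
    have "norm (?d s) \<le> real DIM('c) * (norm ((x1 - x2) - (y1 - y2)) * M + norm (y1 - y2) * (M * (L * \<rho> powr \<mu>)))"
    proof (rule sum_scaleR_inner_diff_le)
      fix c :: 'c assume c: "c \<in> Basis"
      show "norm (partial c F (z s)) \<le> M" by (rule bound[OF c z[OF s]])
      have "norm (partial c F (z s) - partial c F (w s)) \<le> M * norm (z s - w s) powr \<mu>"
        by (rule hold[OF c z[OF s] w[OF s]])
      also have "\<dots> \<le> M * (L * \<rho> powr \<mu>)" using zw' M0 by (rule mult_left_mono)
      finally show "norm (partial c F (z s) - partial c F (w s)) \<le> M * (L * \<rho> powr \<mu>)" .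
    qed
    also have "\<dots> \<le> real DIM('c) * ((D * \<rho> powr \<mu>) * M + D * (M * (L * \<rho> powr \<mu>)))"
      using D M0 L by (intro mult_left_mono add_mono mult_right_mono) auto
    finally show ?thesis by (simp add: algebra_simps)
  qed
  have "norm ((F (z 1) - F (w 1)) - (F (z 0) - F (w 0))) \<le> (real DIM('c) * (1 + L) * M * D * \<rho> powr \<mu>) * norm (1 - (0::real))"
  proof (rule differentiable_bound[where S="{0..1::real}" and f'="\<lambda>s u. u *\<^sub>R ?d s"])
    fix s :: real assume s: "s \<in> {0..1}"
    show "onorm (\<lambda>u. u *\<^sub>R ?d s) \<le> real DIM('c) * (1 + L) * M * D * \<rho> powr \<mu>"
    proof (rule onorm_le)
      fix u :: real
      show "norm (u *\<^sub>R ?d s) \<le> real DIM('c) * (1 + L) * M * D * \<rho> powr \<mu> * norm u"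
        using mult_left_mono[OF bd[OF s], of "\<bar>u\<bar>"] by (simp add: mult.commute)
    qed
  qed (use deriv in auto)
  then show ?thesis by (simp add: z_def w_def algebra_simps)
qed

text \<open>
  By the chain rule each partial derivative of the difference splits into two kinds of products: a
  difference of compositions of \<open>\<partial>\<^sub>c F\<close> times a derivative of \<open>g\<^sub>1\<close> or \<open>g\<^sub>2\<close>, to which the induction
  hypothesis applies, and \<open>\<partial>\<^sub>c F\<close> composed with one of the maps times a derivative of \<open>g\<^sub>1 - g\<^sub>2\<close>. The
  additional derivative of \<open>F\<close> comes from \<open>compose_diff_holder\<close>; it enters only through bounds at a fixed time.
\<close>

lemma hfam_compose_diff:
  fixes L \<mu> :: real
  assumes L: "1 \<le> L" and \<mu>: "0 \<le> \<mu>" "\<mu> \<le> 1"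
  shows "\<exists>C\<ge>1. \<forall>I (U::'a::euclidean_space set) (V::'c::euclidean_space set) M D
      (F :: real \<Rightarrow> 'c \<Rightarrow> 'b::real_normed_vector) g1 g2.
    open U \<longrightarrow> open V \<longrightarrow> convex V \<longrightarrow> hfam k \<mu> I V M F \<longrightarrow> (\<forall>t\<in>I. hfam (Suc k) \<mu> {t} V M F) \<longrightarrow>
    lipfam k \<mu> I U L g1 \<longrightarrow> lipfam k \<mu> I U L g2 \<longrightarrow> hfam k \<mu> I U D (\<lambda>t x. g1 t x - g2 t x) \<longrightarrow>
    (\<forall>t\<in>I. \<forall>x\<in>U. g1 t x \<in> V) \<longrightarrow> (\<forall>t\<in>I. \<forall>x\<in>U. g2 t x \<in> V) \<longrightarrow>
    hfam k \<mu> I U (\<lambda>t. C * (M t * D t)) (\<lambda>t x. F t (g1 t x) - F t (g2 t x))"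
proof -
  define C0 where "C0 = real DIM('c) * (1 + L)"
  have "1 * 1 \<le> C0" unfolding C0_def using L DIM_positive[where 'a='c] by (intro mult_mono) auto
  then have C0: "1 \<le> C0" by simp
  have base: "hfam0 \<mu> I U (\<lambda>t. C * (M t * D t)) (\<lambda>t x. F t (g1 t x) - F t (g2 t x))"
    if C: "C0 \<le> C" and V: "open V" "convex V" and F: "hfam k \<mu> I V M F" and F': "\<forall>t\<in>I. hfam (Suc k) \<mu> {t} V M F"
      and g1: "lipfam k \<mu> I U L g1" and g2: "lipfam k \<mu> I U L g2" and D: "hfam k \<mu> I U D (\<lambda>t x. g1 t x - g2 t x)"
      and V1: "\<forall>t\<in>I. \<forall>x\<in>U. g1 t x \<in> V" and V2: "\<forall>t\<in>I. \<forall>x\<in>U. g2 t x \<in> V"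
    for k I M C D and U :: "'a set" and V :: "'c set" and F :: "real \<Rightarrow> 'c \<Rightarrow> 'b" and g1 g2
  proof -
    have "continuous_on (I \<times> U) (\<lambda>(t, x). F t (g1 t x))" "continuous_on (I \<times> U) (\<lambda>(t, x). F t (g2 t x))"
      by (rule compose_continuous_family[OF hfam_continuous[OF F]]; use g1 g2 V1 V2 in \<open>auto simp: lipfam_def\<close>)+
    then have "continuous_on (I \<times> U) (\<lambda>(t, x). F t (g1 t x) - F t (g2 t x))"
      unfolding split_beta by (rule continuous_on_diff)
    moreover have "norm (F t (g1 t x) - F t (g2 t x)) \<le> C * (M t * D t) \<and>
        norm ((F t (g1 t x) - F t (g2 t x)) - (F t (g1 t y) - F t (g2 t y))) \<le> C * (M t * D t) * norm (x - y) powr \<mu>"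
      if t: "t \<in> I" "x \<in> U" "y \<in> U" for t x y
    proof -
      have Ft: "hfam (Suc k) \<mu> {t} V M F" using F' t by blast
      have M: "0 \<le> M t" using hfam_nonneg[OF F t(1)] V1 t by blast
      have D0: "0 \<le> D t" using hfam_nonneg[OF D t(1,2)] .
      have le: "C0 * (M t * D t) \<le> C * (M t * D t)" using C M D0 by (intro mult_right_mono) auto
      have dF: "F t differentiable (at z)" if "z \<in> V" for z
        using hfam_differentiable[OF Ft _ that] by simp
      have bF: "norm (partial c (F t) z) \<le> M t" if "c \<in> Basis" "z \<in> V" for c z
        using hfam_bound[OF hfam_partial[OF Ft that(1)] _ that(2)] by simp
      have hF: "norm (partial c (F t) z - partial c (F t) w) \<le> M t * norm (z - w) powr \<mu>"
        if "c \<in> Basis" "z \<in> V" "w \<in> V" for c z w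
        using hfam_holder[OF hfam_partial[OF Ft that(1)] _ that(2,3)] by simp
      have "norm (F t (g1 t x) - F t (g2 t x)) \<le> real DIM('c) * M t * norm (g1 t x - g2 t x)"
        by (rule lipschitz_if_bounded_partials[OF V(2,1) dF bF]) (use V1 V2 t in auto)
      also have "\<dots> \<le> real DIM('c) * M t * D t"
        using hfam_bound[OF D t(1,2)] M by (intro mult_left_mono) auto
      also have "\<dots> = 1 * (real DIM('c) * M t * D t)" by simp
      also have "\<dots> \<le> (1 + L) * (real DIM('c) * M t * D t)" using L M D0 by (intro mult_right_mono) auto
      also have "\<dots> = C0 * (M t * D t)" by (simp add: C0_def)
      finally have 1: "norm (F t (g1 t x) - F t (g2 t x)) \<le> C * (M t * D t)" using le by linarith
      have "norm ((F t (g1 t x) - F t (g2 t x)) - (F t (g1 t y) - F t (g2 t y)))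
          \<le> real DIM('c) * (1 + L) * M t * D t * norm (x - y) powr \<mu>"
      proof (rule compose_diff_holder[OF V(2) dF bF hF _ _ _ _ L \<mu> norm_ge_zero])
        show "norm (g1 t x - g1 t y) \<le> L * norm (x - y)" "norm (g2 t x - g2 t y) \<le> L * norm (x - y)"
          using g1 g2 t by (auto simp: lipfam_def)
        show "norm (g1 t y - g2 t y) \<le> D t" using hfam_bound[OF D t(1,3)] .
        show "norm (g1 t x - g2 t x - (g1 t y - g2 t y)) \<le> D t * norm (x - y) powr \<mu>"
          using hfam_holder[OF D t] .
      qed (use V1 V2 t in auto)
      also have "\<dots> = C0 * (M t * D t) * norm (x - y) powr \<mu>" by (simp add: C0_def algebra_simps)
      also have "\<dots> \<le> C * (M t * D t) * norm (x - y) powr \<mu>" using le by (rule mult_right_mono) simp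
      finally show ?thesis using 1 by simp
    qed
    ultimately show ?thesis by (auto simp: hfam0_def)
  qed
  show ?thesis
  proof (induction k)
    case 0
    show ?case
    proof (intro exI[of _ C0] conjI allI impI)
      show "1 \<le> C0" by (rule C0)
    qed (unfold hfam.simps(1), rule base[of C0 _ 0], auto)
  next
    case (Suc k)
    then obtain C where C: "1 \<le> C" and IH:
      "\<And>I (U::'a set) (V::'c set) M D (F::real \<Rightarrow> 'c \<Rightarrow> 'b) g1 g2. open U \<Longrightarrow> open V \<Longrightarrow> convex V \<Longrightarrow>
        hfam k \<mu> I V M F \<Longrightarrow> \<forall>t\<in>I. hfam (Suc k) \<mu> {t} V M F \<Longrightarrow> lipfam k \<mu> I U L g1 \<Longrightarrow> lipfam k \<mu> I U L g2 \<Longrightarrow>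
        hfam k \<mu> I U D (\<lambda>t x. g1 t x - g2 t x) \<Longrightarrow> \<forall>t\<in>I. \<forall>x\<in>U. g1 t x \<in> V \<Longrightarrow> \<forall>t\<in>I. \<forall>x\<in>U. g2 t x \<in> V \<Longrightarrow>
        hfam k \<mu> I U (\<lambda>t. C * (M t * D t)) (\<lambda>t x. F t (g1 t x) - F t (g2 t x))"
      by blast
    obtain C2 where C2: "1 \<le> C2" and comp:
      "\<And>I (U::'a set) (V::'c set) M (F::real \<Rightarrow> 'c \<Rightarrow> 'b) g. open U \<Longrightarrow> hfam k \<mu> I V M F \<Longrightarrow> lipfam k \<mu> I U L g \<Longrightarrow>
        \<forall>t\<in>I. \<forall>x\<in>U. g t x \<in> V \<Longrightarrow> hfam k \<mu> I U (\<lambda>t. C2 * M t) (\<lambda>t x. F t (g t x))"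
      using hfam_compose[OF L \<mu>, where k=k and 'a='a and 'b='b and 'c='c] by blast
    define P where "P = real DIM('c) * (2 ^ Suc k * (L * C + C2))"
    have P: "0 \<le> P" using L C C2 by (simp add: P_def)
    show ?case
    proof (intro exI[of _ "C0 + P"] conjI allI impI)
      show "1 \<le> C0 + P" using C0 P by simp
    next
      fix I and U :: "'a set" and V :: "'c set" and M D and F :: "real \<Rightarrow> 'c \<Rightarrow> 'b" and g1 g2
      assume U: "open U" and V: "open V" "convex V"
        and F: "hfam (Suc k) \<mu> I V M F" and F': "\<forall>t\<in>I. hfam (Suc (Suc k)) \<mu> {t} V M F"
        and g1: "lipfam (Suc k) \<mu> I U L g1" and g2: "lipfam (Suc k) \<mu> I U L g2"
        and D: "hfam (Suc k) \<mu> I U D (\<lambda>t x. g1 t x - g2 t x)"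
        and V1: "\<forall>t\<in>I. \<forall>x\<in>U. g1 t x \<in> V" and V2: "\<forall>t\<in>I. \<forall>x\<in>U. g2 t x \<in> V"
      have "hfam0 \<mu> I U (\<lambda>t. (C0 + P) * (M t * D t)) (\<lambda>t x. F t (g1 t x) - F t (g2 t x))"
        by (rule base[OF _ V F F' g1 g2 D V1 V2]) (use P in simp)
      moreover have diff: "(\<lambda>x. F t (g t x)) differentiable (at x)"
        if "t \<in> I" "x \<in> U" "lipfam (Suc k) \<mu> I U L g" "g t x \<in> V" for t x g
        using differentiable_chain_at[OF lipfam_differentiable[OF that(3,1,2)] hfam_differentiable[OF F that(1,4)]]
        by (simp add: o_def)
      moreover have "hfam k \<mu> I U (\<lambda>t. (C0 + P) * (M t * D t)) (\<lambda>t. partial b (\<lambda>x. F t (g1 t x) - F t (g2 t x)))"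
        if b: "b \<in> Basis" for b
      proof -
        have 1: "hfam k \<mu> I U (\<lambda>t. 2 ^ Suc k * (L * (C * (M t * D t))))
            (\<lambda>t x. (partial b (g1 t) x \<bullet> c) *\<^sub>R (partial c (F t) (g1 t x) - partial c (F t) (g2 t x)))"
          if c: "c \<in> Basis" for c
        proof (rule hfam_scaleR[OF U hfam_inner[OF U lipfam_partial[OF g1 b] c]])
          show "hfam k \<mu> I U (\<lambda>t. C * (M t * D t)) (\<lambda>t x. partial c (F t) (g1 t x) - partial c (F t) (g2 t x))"
            by (rule IH[OF U V hfam_partial[OF F c] _ lipfam_Suc_lower[OF g1] lipfam_Suc_lower[OF g2] hfam_Suc_lower[OF D] V1 V2])
              (use F' c in auto)
        qed
        have 2: "hfam k \<mu> I U (\<lambda>t. 2 ^ Suc k * (D t * (C2 * M t)))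
            (\<lambda>t x. (partial b (\<lambda>x. g1 t x - g2 t x) x \<bullet> c) *\<^sub>R partial c (F t) (g2 t x))"
          if c: "c \<in> Basis" for c
          by (rule hfam_scaleR[OF U hfam_inner[OF U hfam_partial[OF D b] c]
                comp[OF U hfam_partial[OF F c] lipfam_Suc_lower[OF g2] V2]])
        have "hfam k \<mu> I U (\<lambda>t. \<Sum>c\<in>(Basis::'c set). 2 ^ Suc k * (L * (C * (M t * D t))) + 2 ^ Suc k * (D t * (C2 * M t)))
          (\<lambda>t x. \<Sum>c\<in>Basis. (partial b (g1 t) x \<bullet> c) *\<^sub>R (partial c (F t) (g1 t x) - partial c (F t) (g2 t x)) +
             (partial b (\<lambda>x. g1 t x - g2 t x) x \<bullet> c) *\<^sub>R partial c (F t) (g2 t x))" (is "hfam _ _ _ _ _ ?S")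
          by (intro hfam_sum U finite_Basis hfam_add 1 2)
        then have "hfam k \<mu> I U (\<lambda>t. P * (M t * D t)) ?S"
          by (simp add: P_def algebra_simps)
        then have "hfam k \<mu> I U (\<lambda>t. P * (M t * D t)) (\<lambda>t. partial b (\<lambda>x. F t (g1 t x) - F t (g2 t x)))"
        proof (rule hfam_cong[OF U])
          fix t x assume tx: "t \<in> I" "x \<in> U"
          have in_V: "g1 t x \<in> V" "g2 t x \<in> V" using V1 V2 tx by auto
          note dg = lipfam_differentiable[OF g1 tx] lipfam_differentiable[OF g2 tx]
          have minus: "partial b (\<lambda>x. p x - q x) x = partial b p x - partial b q x"
            if "p differentiable (at x)" "q differentiable (at x)" for p q :: "'a \<Rightarrow> 'e::real_normed_vector"
          proof -
            have "partial b (\<lambda>x. p x + - q x) x = partial b p x + partial b (\<lambda>x. - q x) x"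
              using that by (intro partial_add differentiable_minus)
            also have "partial b (\<lambda>x. - q x) x = - partial b q x"
              using that(2) by (intro partial_linear[of uminus q]) (simp add: bounded_linear_minus bounded_linear_ident)
            finally show ?thesis by simp
          qed
          have "partial b (\<lambda>x. F t (g1 t x) - F t (g2 t x)) x =
              (\<Sum>c\<in>Basis. (partial b (g1 t) x \<bullet> c) *\<^sub>R partial c (F t) (g1 t x)) -
              (\<Sum>c\<in>Basis. (partial b (g2 t) x \<bullet> c) *\<^sub>R partial c (F t) (g2 t x))"
            using diff[OF tx g1 in_V(1)] diff[OF tx g2 in_V(2)] dg hfam_differentiable[OF F tx(1)] in_V
            by (simp add: minus partial_compose)
          also have "\<dots> = ?S t x"
            using dg by (simp add: minus sum_subtractf[symmetric] sum.distrib[symmetric] algebra_simps inner_diff_left)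
          finally show "?S t x = partial b (\<lambda>x. F t (g1 t x) - F t (g2 t x)) x" by simp
        qed
        then show ?thesis
          by (rule hfam_mono) (use C0 V1 hfam_nonneg[OF F] hfam_nonneg[OF D] in \<open>fastforce intro!: mult_right_mono\<close>)
      qed
      ultimately show "hfam (Suc k) \<mu> I U (\<lambda>t. (C0 + P) * (M t * D t)) (\<lambda>t x. F t (g1 t x) - F t (g2 t x))"
        using V1 V2 g1 g2 by (auto intro!: differentiable_diff)
    qed
  qed
qed


section \<open>Joint continuity from uniform bounds\<close>

text \<open>
  If \<open>\<partial>\<^sub>b f\<^sup>t\<close> is Lipschitz uniformly in \<open>t\<close>, then the difference quotients of \<open>f\<close> with step \<open>h\<close>, which are
  jointly continuous, are uniformly within \<open>O(h)\<close> of \<open>\<partial>\<^sub>b f\<close>.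
\<close>

lemma partial_jointly_continuous:
  fixes f :: "real \<Rightarrow> 'a::euclidean_space \<Rightarrow> 'b::real_normed_vector"
  assumes U: "open U" and cont: "continuous_on (I \<times> U) (\<lambda>(t, x). f t x)"
    and diff: "\<And>t x. t \<in> I \<Longrightarrow> x \<in> U \<Longrightarrow> f t differentiable (at x)"
    and b: "b \<in> Basis" and L: "0 \<le> L"
    and lip: "\<And>t x y. t \<in> I \<Longrightarrow> x \<in> U \<Longrightarrow> y \<in> U \<Longrightarrow> norm (partial b (f t) x - partial b (f t) y) \<le> L * norm (x - y)"
  shows "continuous_on (I \<times> U) (\<lambda>(t, x). partial b (f t) x)"
  unfolding continuous_on_iff
proof (intro ballI allI impI)
  fix z0 and e :: real assume z0: "z0 \<in> I \<times> U" and e: "e > 0"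
  obtain t0 x0 where z0_eq: "z0 = (t0, x0)" and t0: "t0 \<in> I" and x0: "x0 \<in> U" using z0 by auto
  obtain d0 where d0: "d0 > 0" "ball x0 d0 \<subseteq> U" using U x0 openE by blast
  define h where "h = min (d0/2) (e / (4 * (L + 1)))"
  have h: "h > 0" "h \<le> d0/2" using d0 e L unfolding h_def by (simp, intro min.cobounded1)
  have "L * h \<le> (L + 1) * (e / (4 * (L + 1)))"
    using L h by (intro mult_mono) (auto simp: h_def)
  also have "\<dots> = e / 4" using L by (simp add: field_simps)
  finally have Lh: "L * h \<le> e / 4" .
  define Q where "Q = (\<lambda>(t, x). (1 / h) *\<^sub>R (f t (x + h *\<^sub>R b) - f t x))"
  have inU: "x + s *\<^sub>R b \<in> U" if "x \<in> ball x0 (d0/2)" "0 \<le> s" "s \<le> h" for x s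
  proof -
    have "dist x0 (x + s *\<^sub>R b) \<le> dist x0 x + norm (s *\<^sub>R b)"
      by (metis add_diff_cancel_left' dist_norm dist_triangle norm_minus_commute)
    also have "\<dots> < d0" using that b h by (simp add: norm_Basis)
    finally show ?thesis using d0(2) by auto
  qed
  have close: "norm (partial b (f t) x - Q (t, x)) \<le> e / 4" if t: "t \<in> I" and x: "x \<in> ball x0 (d0/2)" for t x
  proof -
    have "norm (f t (x + h *\<^sub>R b) - f t (x + 0 *\<^sub>R b) - (h - 0) *\<^sub>R partial b (f t) (x + 0 *\<^sub>R b)) \<le> norm (h - 0) * (L * h)"
    proof (rule vector_differentiable_bound_linearization[where S="{0..h}" and f="\<lambda>s. f t (x + s *\<^sub>R b)"
          and f'="\<lambda>s. partial b (f t) (x + s *\<^sub>R b)" and ?x0.0=0])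
      fix s assume s: "s \<in> {0..h}"
      then have sU: "x + s *\<^sub>R b \<in> U" using inU[OF x] by simp
      show "((\<lambda>s. f t (x + s *\<^sub>R b)) has_vector_derivative partial b (f t) (x + s *\<^sub>R b)) (at s within {0..h})"
        by (rule has_vector_derivative_at_within[OF
              has_vector_derivative_partial[OF differentiable_has_partial[OF diff[OF t sU]]]])
      have "norm (partial b (f t) (x + s *\<^sub>R b) - partial b (f t) (x + 0 *\<^sub>R b)) \<le> L * norm (x + s *\<^sub>R b - (x + 0 *\<^sub>R b))"
        using sU inU[OF x, of 0] h by (intro lip t) auto
      also have "\<dots> \<le> L * h" using L s b by (intro mult_left_mono) (auto simp: norm_Basis)
      finally show "norm (partial b (f t) (x + s *\<^sub>R b) - partial b (f t) (x + 0 *\<^sub>R b)) \<le> L * h" .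
    qed (use h in \<open>auto simp: closed_segment_eq_real_ivl\<close>)
    moreover have "norm (h - 0) * (L * h) \<le> h * (e / 4)"
      using mult_left_mono[OF Lh less_imp_le[OF h(1)]] h(1) by (simp only: diff_zero real_norm_def abs_of_pos)
    ultimately have le: "norm (f t (x + h *\<^sub>R b) - f t x - h *\<^sub>R partial b (f t) x) \<le> h * (e / 4)"
      by (simp only: diff_zero scaleR_zero_left add_0_right)
    have "h *\<^sub>R Q (t, x) = f t (x + h *\<^sub>R b) - f t x" using h(1) by (simp add: Q_def)
    then have "f t (x + h *\<^sub>R b) - f t x - h *\<^sub>R partial b (f t) x = h *\<^sub>R (Q (t, x) - partial b (f t) x)"
      by (simp add: scaleR_diff_right)
    then have "h * norm (partial b (f t) x - Q (t, x)) \<le> h * (e / 4)"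
      using le h(1) by (simp only: norm_scaleR abs_of_pos norm_minus_commute)
    then show ?thesis using h(1) by (simp only: mult_le_cancel_left_pos)
  qed
  have shift: "continuous_on (I \<times> ball x0 (d0/2)) (\<lambda>z. (\<lambda>(t, x). f t x) (fst z, snd z + c *\<^sub>R b))"
    if "0 \<le> c" "c \<le> h" for c
    by (rule continuous_on_compose2[OF cont]) (use inU that in \<open>auto intro!: continuous_intros\<close>)
  have "continuous_on (I \<times> ball x0 (d0/2)) Q"
    using shift[of h] shift[of 0] h unfolding Q_def split_beta by (auto intro!: continuous_intros)
  moreover have "z0 \<in> I \<times> ball x0 (d0/2)" using t0 d0 by (simp add: z0_eq)
  moreover have "e / 4 > 0" using e by simp
  ultimately have "\<exists>d>0. \<forall>z\<in>I \<times> ball x0 (d0/2). dist z z0 < d \<longrightarrow> dist (Q z) (Q z0) < e/4"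
    unfolding continuous_on_iff by blast
  then obtain d1 where d1: "d1 > 0"
    "\<And>z. z \<in> I \<times> ball x0 (d0/2) \<Longrightarrow> dist z z0 < d1 \<Longrightarrow> dist (Q z) (Q z0) < e/4" by blast
  show "\<exists>d>0. \<forall>z\<in>I \<times> U. dist z z0 < d \<longrightarrow>
      dist (case z of (t, x) \<Rightarrow> partial b (f t) x) (case z0 of (t, x) \<Rightarrow> partial b (f t) x) < e"
  proof (intro exI[of _ "min d1 (d0/2)"] conjI ballI impI)
    show "min d1 (d0/2) > 0" using d0 d1 by simp
    fix z assume z: "z \<in> I \<times> U" "dist z z0 < min d1 (d0/2)"
    obtain t x where zt: "z = (t, x)" by force
    have "dist x x0 \<le> dist z z0" using dist_snd_le[of z z0] by (simp add: zt z0_eq)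
    then have x: "x \<in> ball x0 (d0/2)" using z by (simp add: dist_commute)
    have t: "t \<in> I" using z zt by auto
    have "norm (Q z - Q z0) < e/4" using d1(2)[of z] x t z by (simp add: zt dist_norm)
    moreover have "norm (partial b (f t) x - Q z) \<le> e/4" using close[OF t x] by (simp add: zt)
    moreover have "norm (partial b (f t0) x0 - Q z0) \<le> e/4" using close[OF t0, of x0] d0 by (simp add: z0_eq)
    moreover have "norm (partial b (f t) x - partial b (f t0) x0) \<le>
        norm (partial b (f t) x - Q z) + norm (Q z - Q z0) + norm (partial b (f t0) x0 - Q z0)"
      using norm_triangle_ineq4[of "(partial b (f t) x - Q z) + (Q z - Q z0)" "partial b (f t0) x0 - Q z0"]
        norm_triangle_ineq[of "partial b (f t) x - Q z" "Q z - Q z0"] by simp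
    ultimately have "norm (partial b (f t) x - partial b (f t0) x0) < e" using e by linarith
    then show "dist (case z of (t, x) \<Rightarrow> partial b (f t) x) (case z0 of (t, x) \<Rightarrow> partial b (f t) x) < e"
      by (simp add: zt z0_eq dist_norm)
  qed
qed

text \<open>
  Bounds at each time and continuity of \<open>f\<close> itself suffice: the next order of differentiability
  makes each derivative Lipschitz in \<open>x\<close> uniformly in \<open>t\<close>, and \<open>partial_jointly_continuous\<close> applies
  order by order.
\<close>

lemma hfam_joint:
  fixes f :: "real \<Rightarrow> 'a::euclidean_space \<Rightarrow> 'b::real_normed_vector"
  assumes U: "open U" "convex U" and M: "\<And>t. t \<in> I \<Longrightarrow> M t \<le> M0"
    and cont: "continuous_on (I \<times> U) (\<lambda>(t, x). f t x)"
    and f: "\<forall>t\<in>I. hfam (Suc k) \<mu> {t} U M f"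
  shows "hfam k \<mu> I U M f"
  using cont f
proof (induction k arbitrary: f)
  case 0
  then show ?case by (auto simp: hfam0_def)
next
  case (Suc k)
  have "hfam0 \<mu> I U M f" using Suc.prems by (auto simp: hfam0_def)
  moreover have "hfam k \<mu> I U M (\<lambda>t. partial b (f t))" if b: "b \<in> Basis" for b
  proof (rule Suc.IH)
    show "\<forall>t\<in>I. hfam (Suc k) \<mu> {t} U M (\<lambda>t. partial b (f t))" using Suc.prems b by simp
    show "continuous_on (I \<times> U) (\<lambda>(t, x). partial b (f t) x)"
    proof (rule partial_jointly_continuous[OF U(1) Suc.prems(1) _ b, where L="real DIM('a) * \<bar>M0\<bar>"])
      fix t x y assume t: "t \<in> I" and x: "x \<in> U" and y: "y \<in> U"
      have ft: "hfam (Suc k) \<mu> {t} U M (\<lambda>t. partial b (f t))" using Suc.prems b t by simp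
      show "norm (partial b (f t) x - partial b (f t) y) \<le> real DIM('a) * \<bar>M0\<bar> * norm (x - y)"
      proof (rule lipschitz_if_bounded_partials[OF U(2,1) _ _ x y])
        fix z assume z: "z \<in> U"
        show "partial b (f t) differentiable (at z)" using hfam_differentiable[OF ft _ z] by simp
        fix c :: 'a assume c: "c \<in> Basis"
        have "norm (partial c (partial b (f t)) z) \<le> M t"
          using hfam_bound[OF hfam_partial[OF ft c] _ z] by simp
        then show "norm (partial c (partial b (f t)) z) \<le> \<bar>M0\<bar>" using M[OF t] by linarith
      qed
    qed (use Suc.prems in auto)
  qed
  ultimately show ?case using Suc.prems by simp
qed


section \<open>Series\<close>

text \<open>
  At every order the derivatives of the terms have the same summable majorant, so that the series
  may be differentiated term by term and all its derivatives are uniform limits.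
\<close>

lemma hfam_series:
  fixes g :: "nat \<Rightarrow> real \<Rightarrow> 'a::euclidean_space \<Rightarrow> 'b::banach"
  assumes U: "open U" "convex U" and M: "\<And>t. t \<in> I \<Longrightarrow> 0 \<le> M t" "\<And>t. t \<in> I \<Longrightarrow> M t \<le> M0"
    and c: "summable c" "\<And>n. 0 \<le> c n"
    and g: "\<And>n. hfam k \<mu> I U (\<lambda>t. c n * M t) (g n)"
  shows "hfam k \<mu> I U (\<lambda>t. suminf c * M t) (\<lambda>t x. \<Sum>n. g n t x)"
proof -
  have summ: "summable (\<lambda>n. g n t x)" if "\<And>n. hfam k \<mu> I U (\<lambda>t. c n * M t) (g n)" "t \<in> I" "x \<in> U"
    for g :: "nat \<Rightarrow> real \<Rightarrow> 'a \<Rightarrow> 'b" and k t x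
    by (rule summable_comparison_test'[OF summable_mult2[OF c(1), of "M t"]])
      (rule hfam_bound[OF that])
  have base: "hfam0 \<mu> I U (\<lambda>t. suminf c * M t) (\<lambda>t x. \<Sum>n. g n t x)"
    if g: "\<And>n. hfam k \<mu> I U (\<lambda>t. c n * M t) (g n)" for g :: "nat \<Rightarrow> real \<Rightarrow> 'a \<Rightarrow> 'b" and k
  proof -
    have "uniform_limit (I \<times> U) (\<lambda>n z. \<Sum>i<n. g i (fst z) (snd z)) (\<lambda>z. \<Sum>i. g i (fst z) (snd z)) sequentially"
    proof (rule Weierstrass_m_test)
      show "summable (\<lambda>n. c n * M0)" by (rule summable_mult2[OF c(1)])
      fix n and z :: "real \<times> 'a" assume z: "z \<in> I \<times> U"
      then have "norm (g n (fst z) (snd z)) \<le> c n * M (fst z)" by (intro hfam_bound[OF g]) auto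
      also have "\<dots> \<le> c n * M0" using M(2) c(2) z by (intro mult_left_mono) auto
      finally show "norm (g n (fst z) (snd z)) \<le> c n * M0" .
    qed
    then have "continuous_on (I \<times> U) (\<lambda>z. \<Sum>i. g i (fst z) (snd z))"
      by (rule uniform_limit_theorem[rotated])
        (use hfam_continuous[OF g] in \<open>auto simp: split_beta intro!: always_eventually continuous_on_sum\<close>)
    moreover have "norm (\<Sum>n. g n t x) \<le> suminf c * M t \<and>
        norm ((\<Sum>n. g n t x) - (\<Sum>n. g n t y)) \<le> suminf c * M t * norm (x - y) powr \<mu>"
      if t: "t \<in> I" "x \<in> U" "y \<in> U" for t x y
    proof -
      have "norm (\<Sum>n. g n t x) \<le> (\<Sum>n. c n * M t)"
        by (rule norm_suminf_le[OF hfam_bound[OF g t(1,2)] summable_mult2[OF c(1)]])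
      moreover have "norm (\<Sum>n. g n t x - g n t y) \<le> (\<Sum>n. c n * (M t * norm (x - y) powr \<mu>))"
        by (rule norm_suminf_le[OF _ summable_mult2[OF c(1)]])
          (use hfam_holder[OF g t] in \<open>simp add: algebra_simps\<close>)
      moreover have "suminf c * M t = (\<Sum>n. c n * M t)" by (rule suminf_mult2[OF c(1)])
      moreover have "suminf c * M t * norm (x - y) powr \<mu> = (\<Sum>n. c n * (M t * norm (x - y) powr \<mu>))"
        unfolding mult.assoc by (rule suminf_mult2[OF c(1)])
      ultimately show ?thesis
        by (simp only: suminf_diff[OF summ[OF g t(1,2)] summ[OF g t(1,3)]])
    qed
    ultimately show ?thesis by (auto simp: hfam0_def split_beta)
  qed
  show ?thesis using g
  proof (induction k arbitrary: g)
    case 0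
    then show ?case using base[of 0 g] by simp
  next
    case (Suc k)
    have deriv: "((\<lambda>x. \<Sum>n. g n t x) has_derivative (\<lambda>h. \<Sum>b\<in>Basis. (h \<bullet> b) *\<^sub>R (\<Sum>n. partial b (g n t) x))) (at x)"
      if t: "t \<in> I" and x: "x \<in> U" for t x
    proof -
      have "\<exists>G. \<forall>x\<in>U. (\<lambda>n. g n t x) sums G x \<and>
          (G has_derivative (\<lambda>h. \<Sum>b\<in>Basis. (h \<bullet> b) *\<^sub>R (\<Sum>n. partial b (g n t) x))) (at x within U)"
      proof (rule has_derivative_series[where f="\<lambda>n. g n t" and x=x and l="\<Sum>n. g n t x"
            and f'="\<lambda>n x h. \<Sum>b\<in>Basis. (h \<bullet> b) *\<^sub>R partial b (g n t) x"])
        fix n x assume x': "x \<in> U"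
        show "(g n t has_derivative (\<lambda>h. \<Sum>b\<in>Basis. (h \<bullet> b) *\<^sub>R partial b (g n t) x)) (at x within U)"
          by (rule has_derivative_at_withinI[OF has_derivative_partials[OF hfam_differentiable[OF Suc.prems t x']]])
      next
        show "convex U" by (rule U(2))
        show "x \<in> U" by (rule x)
        show "(\<lambda>n. g n t x) sums (\<Sum>n. g n t x)" by (rule summable_sums[OF summ[OF Suc.prems t x]])
      next
        fix e :: real assume e: "e > 0"
        define e' where "e' = e / (real DIM('a))"
        have e': "e' > 0" using e by (simp add: e'_def)
        have "summable (\<lambda>n. c n * M t)" by (rule summable_mult2[OF c(1)])
        from suminf_exist_split[OF e' this] obtain N where
          N: "\<And>n. n \<ge> N \<Longrightarrow> norm (\<Sum>i. c (i + n) * M t) < e'" by auto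
        have tail: "norm ((\<Sum>i<n. partial b (g i t) x) - (\<Sum>i. partial b (g i t) x)) \<le> e'"
          if "n \<ge> N" "x \<in> U" "b \<in> Basis" for n x b
        proof -
          have pg: "\<And>n. hfam k \<mu> I U (\<lambda>t. c n * M t) (\<lambda>t. partial b (g n t))"
            by (rule hfam_partial[OF Suc.prems that(3)])
          have "norm (\<Sum>i. partial b (g (i + n) t) x) \<le> (\<Sum>i. c (i + n) * M t)"
          proof (rule norm_suminf_le)
            show "norm (partial b (g (i + n) t) x) \<le> c (i + n) * M t" for i
              by (rule hfam_bound[OF pg t that(2)])
            show "summable (\<lambda>i. c (i + n) * M t)"
              using \<open>summable (\<lambda>n. c n * M t)\<close> summable_ignore_initial_segment by blast
          qed
          also have "\<dots> \<le> e'" using N[OF that(1)] by simp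
          finally show ?thesis
            using suminf_split_initial_segment[OF summ[OF pg t that(2)], of n] by (simp add: norm_minus_commute)
        qed
        have "norm ((\<Sum>i<n. \<Sum>b\<in>Basis. (h \<bullet> b) *\<^sub>R partial b (g i t) x) - (\<Sum>b\<in>Basis. (h \<bullet> b) *\<^sub>R (\<Sum>i. partial b (g i t) x))) \<le> e * norm h"
          if n: "n \<ge> N" and x: "x \<in> U" for n x h
        proof -
          have "(\<Sum>i<n. \<Sum>b\<in>Basis. (h \<bullet> b) *\<^sub>R partial b (g i t) x) - (\<Sum>b\<in>Basis. (h \<bullet> b) *\<^sub>R (\<Sum>i. partial b (g i t) x)) =
            (\<Sum>b\<in>Basis. (h \<bullet> b) *\<^sub>R ((\<Sum>i<n. partial b (g i t) x) - (\<Sum>i. partial b (g i t) x)))"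
            by (subst sum.swap) (simp add: sum_subtractf scaleR_diff_right scaleR_sum_right)
          also have "norm \<dots> \<le> (\<Sum>b\<in>(Basis::'a set). norm h * e')"
            by (rule sum_norm_le) (use tail[OF n x] in \<open>auto intro!: mult_mono Basis_le_norm\<close>)
          also have "\<dots> = e * norm h" by (simp add: e'_def)
          finally show ?thesis .
        qed
        then show "\<forall>\<^sub>F n in sequentially. \<forall>x\<in>U. \<forall>h. norm ((\<Sum>i<n. \<Sum>b\<in>Basis. (h \<bullet> b) *\<^sub>R partial b (g i t) x) -
            (\<Sum>b\<in>Basis. (h \<bullet> b) *\<^sub>R (\<Sum>n. partial b (g n t) x))) \<le> e * norm h"
          unfolding eventually_sequentially by blast
      qed
      then obtain G where G: "\<And>x. x \<in> U \<Longrightarrow> (\<lambda>n. g n t x) sums G x"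
        "(G has_derivative (\<lambda>h. \<Sum>b\<in>Basis. (h \<bullet> b) *\<^sub>R (\<Sum>n. partial b (g n t) x))) (at x within U)"
        using x by blast
      from G(2) have "(G has_derivative (\<lambda>h. \<Sum>b\<in>Basis. (h \<bullet> b) *\<^sub>R (\<Sum>n. partial b (g n t) x))) (at x)"
        unfolding at_within_open[OF x U(1)] .
      then show ?thesis
        by (rule has_derivative_transform_within_open[OF _ U(1) x]) (rule sums_unique[OF G(1)])
    qed
    have "hfam k \<mu> I U (\<lambda>t. suminf c * M t) (\<lambda>t. partial b (\<lambda>x. \<Sum>n. g n t x))" if b: "b \<in> Basis" for b
    proof (rule hfam_cong[OF U(1) Suc.IH[OF hfam_partial[OF Suc.prems b]]])
      fix t x assume "t \<in> I" "x \<in> U"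
      then have "partial b (\<lambda>x. \<Sum>n. g n t x) x = (\<Sum>c\<in>Basis. (b \<bullet> c) *\<^sub>R (\<Sum>n. partial c (g n t) x))"
        by (rule has_partial_of_derivative(2)[OF deriv])
      then show "(\<Sum>n. partial b (g n t) x) = partial b (\<lambda>x. \<Sum>n. g n t x) x"
        by (simp only: sum_Basis_inner[OF b])
    qed
    moreover have "(\<lambda>x. \<Sum>n. g n t x) differentiable (at x)" if "t \<in> I" "x \<in> U" for t x
      by (rule differentiableI[OF deriv[OF that]])
    ultimately show ?case using base[OF Suc.prems] by simp
  qed
qed


section \<open>Integrals over infinite time intervals\<close>

lemma absolutely_integrable_tail:
  fixes f :: "real \<Rightarrow> 'b::euclidean_space"
  assumes "f absolutely_integrable_on {T..}" "T \<le> t"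
  shows "f absolutely_integrable_on {t..}"
  by (rule set_integrable_subset[OF assms(1)]) (use assms(2) in auto)

lemma integral_tail_split:
  fixes f :: "real \<Rightarrow> 'b::euclidean_space"
  assumes "f absolutely_integrable_on {T..}" "T \<le> t" "t \<le> s"
  shows "integral {t..} f = integral {t..s} f + integral {s..} f"
proof -
  have "f absolutely_integrable_on {t..}" by (rule absolutely_integrable_tail[OF assms(1,2)])
  then have "f absolutely_integrable_on {t..s}" "f absolutely_integrable_on {s..}"
    using assms(3) by (auto intro: set_integrable_subset)
  then have "f integrable_on {t..s}" "f integrable_on {s..}" using set_lebesgue_integral_eq_integral(1) by blast+
  moreover have "negligible ({t..s} \<inter> {s..})"
    by (rule negligible_subset[of "{s}"]) auto
  ultimately have "integral ({t..s} \<union> {s..}) f = integral {t..s} f + integral {s..} f" by simp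
  moreover have "{t..s} \<union> {s..} = {t..}" using assms(3) by auto
  ultimately show ?thesis by simp
qed

lemma tail_has_vector_derivative:
  fixes f :: "real \<Rightarrow> 'b::euclidean_space"
  assumes "continuous_on {T..} f" "f absolutely_integrable_on {T..}" "T \<le> t"
  shows "((\<lambda>t. integral {t..} f) has_vector_derivative - f t) (at t within {T..})"
proof -
  have "((\<lambda>u. integral {T..u} f) has_vector_derivative f t) (at t within {T..t + 1})"
    by (rule integral_has_vector_derivative) (use assms in \<open>auto elim: continuous_on_subset\<close>)
  moreover have "at t within {T..t + 1} = at t within {T..}"
    by (rule at_within_nhd[of t "{..<t + 1}"]) (use assms in auto)
  ultimately have "((\<lambda>u. integral {T..} f - integral {T..u} f) has_vector_derivative 0 - f t) (at t within {T..})"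
    by (intro has_vector_derivative_diff) auto
  moreover have "integral {T..} f - integral {T..u} f = integral {u..} f" if "u \<in> {T..}" for u
    using integral_tail_split[OF assms(2) order_refl, of u] that by simp
  ultimately show ?thesis
    using assms(3) by (auto elim: has_vector_derivative_transform[rotated 2])
qed

lemma hfam_tail_integrable:
  fixes f :: "real \<Rightarrow> 'a::euclidean_space \<Rightarrow> 'b::euclidean_space"
  assumes f: "hfam k \<mu> {T..} UNIV M f" and M: "M absolutely_integrable_on {T..}" and t: "T \<le> t"
  shows "(\<lambda>s. f s x) absolutely_integrable_on {t..}" and "continuous_on {T..} (\<lambda>s. f s x)"
proof -
  have "continuous_on {T..} (\<lambda>s. (\<lambda>(s, x). f s x) (s, x))"
    by (rule continuous_on_compose2[OF hfam_continuous[OF f]]) (auto intro!: continuous_intros)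
  then show cont: "continuous_on {T..} (\<lambda>s. f s x)" by simp
  have "(\<lambda>s. f s x) absolutely_integrable_on {T..}"
  proof (rule measurable_bounded_by_integrable_imp_absolutely_integrable)
    show "(\<lambda>s. f s x) \<in> borel_measurable (lebesgue_on {T..})"
      by (rule continuous_imp_measurable_on_sets_lebesgue[OF cont]) simp
    show "M integrable_on {T..}" using M set_lebesgue_integral_eq_integral(1) by blast
    show "norm (f s x) \<le> M s" if "s \<in> {T..}" for s using hfam_bound[OF f that] by simp
  qed simp
  then show "(\<lambda>s. f s x) absolutely_integrable_on {t..}" by (rule absolutely_integrable_tail[OF _ t])
qed

text \<open>
  The integral is Lipschitz in \<open>t\<close> with constant \<open>M0\<close> uniformly in \<open>x\<close>, and for fixed \<open>t\<close> continuous in \<open>x\<close>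
  by dominated convergence; together this is joint continuity.
\<close>

lemma hfam_tail_integral_base:
  fixes f :: "real \<Rightarrow> 'a::euclidean_space \<Rightarrow> 'b::euclidean_space"
  assumes f: "hfam k \<mu> {T..} UNIV M f" and M: "M absolutely_integrable_on {T..}" and M0: "\<And>t. T \<le> t \<Longrightarrow> M t \<le> M0"
  shows "hfam0 \<mu> {T..} UNIV (\<lambda>t. integral {t..} M) (\<lambda>t x. integral {t..} (\<lambda>s. f s x))"
proof -
  let ?g = "\<lambda>t x. integral {t..} (\<lambda>s. f s x)"
  have fint: "(\<lambda>s. f s x) integrable_on {t..}" if "T \<le> t" for t x
    using hfam_tail_integrable(1)[OF f M that] set_lebesgue_integral_eq_integral(1) by blast
  have Mint: "M integrable_on {t..}" if "T \<le> t" for t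
    using absolutely_integrable_tail[OF M that] set_lebesgue_integral_eq_integral(1) by blast
  have fb: "norm (f s x) \<le> M s" if "T \<le> s" for s x using hfam_bound[OF f] that by simp
  have bound: "norm (?g t x) \<le> integral {t..} M" if "T \<le> t" for t x
    by (rule Henstock_Kurzweil_Integration.integral_norm_bound_integral[OF fint[OF that] Mint[OF that]])
      (use fb that in auto)
  have hold: "norm (?g t x - ?g t y) \<le> integral {t..} M * norm (x - y) powr \<mu>" if "T \<le> t" for t x y
  proof -
    have "norm (integral {t..} (\<lambda>s. f s x - f s y)) \<le> integral {t..} (\<lambda>s. M s * norm (x - y) powr \<mu>)"
      by (rule Henstock_Kurzweil_Integration.integral_norm_bound_integral)
        (use that hfam_holder[OF f] in \<open>auto intro!: integrable_diff fint integrable_on_mult_left Mint\<close>)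
    then show ?thesis by (simp add: integral_diff[OF fint[OF that] fint[OF that]])
  qed
  have lip: "norm (?g t x - ?g t' x) \<le> M0 * \<bar>t - t'\<bar>" if "T \<le> t" "T \<le> t'" for t t' x
  proof -
    have *: "norm (?g t x - ?g t' x) \<le> M0 * \<bar>t - t'\<bar>" if "T \<le> t" "t \<le> t'" for t t'
    proof -
      have "?g t x - ?g t' x = integral {t..t'} (\<lambda>s. f s x)"
        using integral_tail_split[OF hfam_tail_integrable(1)[OF f M order_refl] that] by simp
      also have "norm \<dots> \<le> M0 * (t' - t)"
        proof (rule integral_bound[OF that(2)])
          show "continuous_on {t..t'} (\<lambda>s. f s x)"
            by (rule continuous_on_subset[OF hfam_tail_integrable(2)[OF f M order_refl]]) (use that in auto)
          show "norm (f s x) \<le> M0" if "s \<in> {t..t'}" for s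
            using fb[of s x] M0[of s] \<open>T \<le> t\<close> that by simp
        qed
      finally show ?thesis using that by simp
    qed
    show ?thesis
      using *[of t t'] *[of t' t] that by (cases "t \<le> t'") (auto simp: norm_minus_commute abs_minus_commute)
  qed
  have cont_x: "(\<lambda>n. ?g t (X n)) \<longlonglongrightarrow> ?g t x" if t: "T \<le> t" and X: "X \<longlonglongrightarrow> x" for t X x
  proof (rule dominated_convergence(2)[OF fint[OF t] Mint[OF t]])
    fix s assume s: "s \<in> {t..}"
    have "continuous_on UNIV (\<lambda>x. (\<lambda>(s, x). f s x) (s, x))"
      by (rule continuous_on_compose2[OF hfam_continuous[OF f]]) (use s t in \<open>auto intro!: continuous_intros\<close>)
    then show "(\<lambda>n. f s (X n)) \<longlonglongrightarrow> f s x" using X by (auto dest: continuous_on_tendsto_compose)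
  qed (use fb t in auto)
  have "continuous_on ({T..} \<times> UNIV) (\<lambda>(t, x). ?g t x)"
    unfolding continuous_on_sequentially
  proof (intro allI ballI impI)
    fix Z and z :: "real \<times> 'a" assume z: "z \<in> {T..} \<times> UNIV" and Z: "(\<forall>n. Z n \<in> {T..} \<times> UNIV) \<and> Z \<longlonglongrightarrow> z"
    have 1: "(\<lambda>n. fst (Z n)) \<longlonglongrightarrow> fst z" and 2: "(\<lambda>n. snd (Z n)) \<longlonglongrightarrow> snd z"
      using Z by (auto intro: tendsto_fst tendsto_snd)
    have "(\<lambda>n. ?g (fst (Z n)) (snd (Z n)) - ?g (fst z) (snd (Z n))) \<longlonglongrightarrow> 0"
    proof (rule tendsto_norm_zero_cancel, rule tendsto_sandwich[OF _ _ tendsto_const])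
      show "\<forall>\<^sub>F n in sequentially. norm (?g (fst (Z n)) (snd (Z n)) - ?g (fst z) (snd (Z n))) \<le> M0 * \<bar>fst (Z n) - fst z\<bar>"
        using Z z by (intro always_eventually allI lip) (auto simp: mem_Times_iff)
      show "(\<lambda>n. M0 * \<bar>fst (Z n) - fst z\<bar>) \<longlonglongrightarrow> 0"
        using tendsto_mult_right_zero[OF tendsto_rabs_zero[OF LIM_zero[OF 1]], of M0] by simp
    qed simp
    from tendsto_add[OF this cont_x[OF _ 2, of "fst z"]] z
    have "(\<lambda>n. ?g (fst (Z n)) (snd (Z n))) \<longlonglongrightarrow> ?g (fst z) (snd z)" by auto
    then show "((\<lambda>(t, x). ?g t x) \<circ> Z) \<longlonglongrightarrow> (\<lambda>(t, x). ?g t x) z" by (simp add: o_def split_beta)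
  qed
  then show ?thesis using bound hold by (auto simp: hfam0_def)
qed

text \<open>
  Dominated convergence for the remainder of the first order expansion divided by the increment,
  which the mean value theorem bounds by a multiple of \<open>M\<close>.
\<close>

lemma tail_integral_has_derivative:
  fixes f :: "real \<Rightarrow> 'a::euclidean_space \<Rightarrow> 'b::euclidean_space"
  assumes f: "hfam (Suc k) \<mu> {T..} UNIV M f" and M: "M absolutely_integrable_on {T..}" and t: "T \<le> t"
  shows "((\<lambda>x. integral {t..} (\<lambda>s. f s x)) has_derivative
      (\<lambda>h. \<Sum>b\<in>Basis. (h \<bullet> b) *\<^sub>R integral {t..} (\<lambda>s. partial b (f s) x))) (at x)"
  unfolding has_derivative_iff_norm tendsto_at_iff_sequentially
proof (intro conjI allI impI)
  show "bounded_linear (\<lambda>h. \<Sum>b\<in>Basis. (h \<bullet> b) *\<^sub>R integral {t..} (\<lambda>s. partial b (f s) x))"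
    by (intro bounded_linear_sum bounded_linear_compose[OF bounded_linear_scaleR_left] bounded_linear_inner_left)
  fix X assume X0: "\<forall>i::nat. X i \<in> UNIV - {x}" and X: "X \<longlonglongrightarrow> x"
  have fint: "(\<lambda>s. f s y) integrable_on {t..}" for y
    using hfam_tail_integrable(1)[OF f M t] set_lebesgue_integral_eq_integral(1) by blast
  have pint: "(\<lambda>s. partial b (f s) y) integrable_on {t..}" if "b \<in> Basis" for b y
    using hfam_tail_integrable(1)[OF hfam_partial[OF f that] M t] set_lebesgue_integral_eq_integral(1) by blast
  have Mint: "M integrable_on {t..}"
    using absolutely_integrable_tail[OF M t] set_lebesgue_integral_eq_integral(1) by blast
  let ?D = "\<lambda>s h. \<Sum>b\<in>Basis. (h \<bullet> b) *\<^sub>R partial b (f s) x"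
  have Dint: "(\<lambda>s. ?D s h) integrable_on {t..}" for h
    by (intro integrable_sum finite_Basis integrable_cmul pint)
  define e where "e = (\<lambda>n s. inverse (norm (X n - x)) *\<^sub>R (f s (X n) - f s x - ?D s (X n - x)))"
  have pos: "norm (X n - x) > 0" for n using X0 by auto
  have "(\<lambda>n. integral {t..} (e n)) \<longlonglongrightarrow> integral {t..} (\<lambda>s. 0)"
  proof (rule dominated_convergence(2))
    show "e n integrable_on {t..}" for n
      unfolding e_def by (intro integrable_cmul integrable_diff fint Dint)
    show "(\<lambda>s. 2 * real DIM('a) * M s) integrable_on {t..}" by (intro integrable_on_mult_right Mint)
    fix s assume s: "s \<in> {t..}"
    have ds: "f s differentiable (at y)" for y using hfam_differentiable[OF f] s t by simp
    have bs: "norm (partial b (f s) y) \<le> M s" if "b \<in> Basis" for b y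
      using hfam_bound[OF hfam_partial[OF f that]] s t by simp
    show "norm (e n s) \<le> 2 * real DIM('a) * M s" for n
    proof -
      have 1: "norm (f s (X n) - f s x) \<le> real DIM('a) * M s * norm (X n - x)"
        by (rule lipschitz_if_bounded_partials[OF convex_UNIV open_UNIV ds bs]) auto
      have "norm (?D s (X n - x)) \<le> (\<Sum>b\<in>(Basis::'a set). norm (X n - x) * M s)"
        by (rule sum_norm_le) (auto intro!: mult_mono bs Basis_le_norm)
      then have 2: "norm (?D s (X n - x)) \<le> real DIM('a) * M s * norm (X n - x)" by (simp add: algebra_simps)
      have "norm (f s (X n) - f s x - ?D s (X n - x)) \<le> 2 * real DIM('a) * M s * norm (X n - x)"
        using norm_triangle_ineq4[of "f s (X n) - f s x" "?D s (X n - x)"] 1 2 by linarith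
      then show ?thesis using pos[of n] by (simp add: e_def divide_simps mult.commute)
    qed
    have "((\<lambda>y. norm ((f s y - f s x) - ?D s (y - x)) / norm (y - x)) \<longlongrightarrow> 0) (at x)"
      using has_derivative_partials[OF ds] unfolding has_derivative_iff_norm by blast
    then have "(\<lambda>n. norm ((f s (X n) - f s x) - ?D s (X n - x)) / norm (X n - x)) \<longlonglongrightarrow> 0"
      using X0 X unfolding tendsto_at_iff_sequentially o_def by blast
    then have "(\<lambda>n. norm (e n s)) \<longlonglongrightarrow> 0"
      by (simp add: e_def divide_inverse mult.commute)
    then show "(\<lambda>n. e n s) \<longlonglongrightarrow> 0" by (rule tendsto_norm_zero_cancel)
  qed
  then have lim: "(\<lambda>n. norm (integral {t..} (e n))) \<longlonglongrightarrow> 0" by (simp add: tendsto_norm_zero)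
  have "integral {t..} (e n) = inverse (norm (X n - x)) *\<^sub>R
      (integral {t..} (\<lambda>s. f s (X n)) - integral {t..} (\<lambda>s. f s x) -
       (\<Sum>b\<in>Basis. ((X n - x) \<bullet> b) *\<^sub>R integral {t..} (\<lambda>s. partial b (f s) x)))" for n
    unfolding e_def
    by (simp add: integral_diff integrable_diff fint Dint integral_sum integrable_cmul pint)
  then show "((\<lambda>y. norm (integral {t..} (\<lambda>s. f s y) - integral {t..} (\<lambda>s. f s x) -
      (\<Sum>b\<in>Basis. ((y - x) \<bullet> b) *\<^sub>R integral {t..} (\<lambda>s. partial b (f s) x))) / norm (y - x)) \<circ> X) \<longlonglongrightarrow> 0"
    using lim by (simp add: o_def divide_inverse mult.commute)
qed

lemma tail_integral_partial:
  fixes f :: "real \<Rightarrow> 'a::euclidean_space \<Rightarrow> 'b::euclidean_space"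
  assumes "hfam (Suc k) \<mu> {T..} UNIV M f" "M absolutely_integrable_on {T..}" "T \<le> t" "b \<in> Basis"
  shows "partial b (\<lambda>x. integral {t..} (\<lambda>s. f s x)) x = integral {t..} (\<lambda>s. partial b (f s) x)"
  using has_partial_of_derivative(2)[OF tail_integral_has_derivative[OF assms(1-3)], of b x]
  by (simp only: sum_Basis_inner[OF assms(4)])

text \<open>
  The weight \<open>M\<close> dominates the derivatives of every order, so all of them pass under the integral and
  inherit the tail integral of \<open>M\<close> as their weight.
\<close>

lemma hfam_tail_integral:
  fixes f :: "real \<Rightarrow> 'a::euclidean_space \<Rightarrow> 'b::euclidean_space"
  assumes f: "hfam k \<mu> {T..} UNIV M f" and M: "M absolutely_integrable_on {T..}" "\<And>t. T \<le> t \<Longrightarrow> M t \<le> M0"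
  shows "hfam k \<mu> {T..} UNIV (\<lambda>t. integral {t..} M) (\<lambda>t x. integral {t..} (\<lambda>s. f s x))"
  using f
proof (induction k arbitrary: f)
  case 0
  then show ?case using hfam_tail_integral_base[OF _ M, of 0] by simp
next
  case (Suc k)
  have "hfam k \<mu> {T..} UNIV (\<lambda>t. integral {t..} M) (\<lambda>t. partial b (\<lambda>x. integral {t..} (\<lambda>s. f s x)))"
    if b: "b \<in> Basis" for b
    by (rule hfam_cong[OF open_UNIV Suc.IH[OF hfam_partial[OF Suc.prems b]]])
      (use tail_integral_partial[OF Suc.prems M(1) _ b] in simp)
  moreover have "(\<lambda>x. integral {t..} (\<lambda>s. f s x)) differentiable (at x)" if "t \<in> {T..}" for t x
    by (rule differentiableI[OF tail_integral_has_derivative[OF Suc.prems M(1)]]) (use that in simp)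
  ultimately show ?case using hfam_tail_integral_base[OF Suc.prems M] by simp
qed


lemma tail_integral_tendsto_0:
  fixes f :: "real \<Rightarrow> real"
  assumes f: "f absolutely_integrable_on {T..}"
  shows "((\<lambda>t. integral {t..} f) \<longlongrightarrow> 0) at_top"
proof -
  have "((\<lambda>t. LINT x:{T..t}|lebesgue. f x) \<longlongrightarrow> (LINT x:{T..}|lebesgue. f x)) at_top"
    by (rule tendsto_set_lebesgue_integral_at_top[OF _ f]) simp
  moreover have "(LINT x:{T..t}|lebesgue. f x) = integral {T..t} f" for t
    by (rule set_lebesgue_integral_eq_integral(2)) (rule set_integrable_subset[OF f], auto)
  ultimately have "((\<lambda>t. integral {T..} f - integral {T..t} f) \<longlongrightarrow> integral {T..} f - integral {T..} f) at_top"
    using set_lebesgue_integral_eq_integral(2)[OF f] by (intro tendsto_intros) simp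
  moreover have "\<forall>\<^sub>F t in at_top. integral {T..} f - integral {T..t} f = integral {t..} f"
    using eventually_ge_at_top[of T]
    by eventually_elim (use integral_tail_split[OF f order_refl] in simp)
  ultimately show ?thesis using tendsto_cong by fastforce
qed


section \<open>Averages along the fibres\<close>

lemma norm_dilate_snd_le:
  assumes "s \<in> {0..1::real}"
  shows "norm ((fst x, s *\<^sub>R snd x) - (fst y, s *\<^sub>R snd y)) \<le> norm (x - y)"
proof -
  have "norm (s *\<^sub>R (snd x - snd y)) \<le> norm (snd x - snd y)"
    using assms by (simp add: mult_left_le_one_le)
  then have "norm (s *\<^sub>R snd x - s *\<^sub>R snd y) \<le> norm (snd x - snd y)" by (simp add: scaleR_diff_right)
  then have "sqrt ((norm (fst x - fst y))\<^sup>2 + (norm (s *\<^sub>R snd x - s *\<^sub>R snd y))\<^sup>2)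
      \<le> sqrt ((norm (fst x - fst y))\<^sup>2 + (norm (snd x - snd y))\<^sup>2)"
    by (intro real_sqrt_le_mono add_left_mono power_mono) auto
  then show ?thesis by (simp add: norm_prod_def)
qed

text \<open>
  The weight is part of the statement because differentiating in a fibre direction multiplies it
  by the dilation factor \<open>s\<close>.
\<close>

lemma hfam_fibre_average:
  fixes F :: "real \<Rightarrow> 'a::euclidean_space \<times> 'c::euclidean_space \<Rightarrow> 'b::euclidean_space"
  assumes U: "open U" and star: "\<And>x s. x \<in> U \<Longrightarrow> s \<in> {0..1} \<Longrightarrow> (fst x, s *\<^sub>R snd x) \<in> U"
    and \<mu>: "0 \<le> \<mu>"
    and w: "continuous_on {0..1} w" "\<And>s. s \<in> {0..1} \<Longrightarrow> \<bar>w s\<bar> \<le> 1"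
    and F: "hfam k \<mu> I U M F"
  shows "hfam k \<mu> I U M (\<lambda>t x. integral {0..1} (\<lambda>s. w s *\<^sub>R F t (fst x, s *\<^sub>R snd x)))"
proof -
  have cont: "continuous_on ((I \<times> U) \<times> cbox 0 1) (\<lambda>(z, s). w s *\<^sub>R F (fst z) (fst (snd z), s *\<^sub>R snd (snd z)))"
    if "hfam k \<mu> I U M F" "continuous_on {0..1} w" for k w and F :: "real \<Rightarrow> 'a \<times> 'c \<Rightarrow> 'b"
  proof -
    have "continuous_on ((I \<times> U) \<times> cbox 0 1) (\<lambda>z. (\<lambda>(t, x). F t x) (fst (fst z), (fst (snd (fst z)), snd z *\<^sub>R snd (snd (fst z)))))"
    proof (rule continuous_on_compose2[OF hfam_continuous[OF that(1)]])
      show "continuous_on ((I \<times> U) \<times> cbox 0 1) (\<lambda>z. (fst (fst z), fst (snd (fst z)), snd z *\<^sub>R snd (snd (fst z))))"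
        by (intro continuous_intros)
      show "(\<lambda>z. (fst (fst z), fst (snd (fst z)), snd z *\<^sub>R snd (snd (fst z)))) ` ((I \<times> U) \<times> cbox 0 1) \<subseteq> I \<times> U"
        using star by force
    qed
    moreover have "continuous_on ((I \<times> U) \<times> cbox 0 1) (\<lambda>z. w (snd z))"
      by (rule continuous_on_compose2[OF that(2)]) (auto intro!: continuous_intros)
    ultimately show ?thesis by (auto simp: split_beta intro!: continuous_on_scaleR)
  qed
  have cont1: "continuous_on {0..1} (\<lambda>s. w s *\<^sub>R F t (fst x, s *\<^sub>R snd x))"
    if "hfam k \<mu> I U M F" "continuous_on {0..1} w" "t \<in> I" "x \<in> U"
    for k w t x and F :: "real \<Rightarrow> 'a \<times> 'c \<Rightarrow> 'b"
  proof -
    have "continuous_on {0..1} (\<lambda>s. (\<lambda>(z, s). w s *\<^sub>R F (fst z) (fst (snd z), s *\<^sub>R snd (snd z))) ((t, x), s))"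
      by (rule continuous_on_compose2[OF cont[OF that(1,2)]]) (use that(3,4) in \<open>auto intro!: continuous_intros\<close>)
    then show ?thesis by simp
  qed
  have base: "hfam0 \<mu> I U M (\<lambda>t x. integral {0..1} (\<lambda>s. w s *\<^sub>R F t (fst x, s *\<^sub>R snd x)))"
    if F: "hfam k \<mu> I U M F" and w: "continuous_on {0..1} w" "\<And>s. s \<in> {0..1} \<Longrightarrow> \<bar>w s\<bar> \<le> 1"
    for k w and F :: "real \<Rightarrow> 'a \<times> 'c \<Rightarrow> 'b"
  proof -
    have "continuous_on (I \<times> U) (\<lambda>z. integral (cbox 0 1) (\<lambda>s. w s *\<^sub>R F (fst z) (fst (snd z), s *\<^sub>R snd (snd z))))"
      by (rule integral_continuous_on_param[OF cont[OF F w(1)]])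
    moreover have "norm (integral {0..1} (\<lambda>s. w s *\<^sub>R F t (fst x, s *\<^sub>R snd x))) \<le> M t"
      if t: "t \<in> I" "x \<in> U" for t x
    proof -
      have "norm (integral {0..1} (\<lambda>s. w s *\<^sub>R F t (fst x, s *\<^sub>R snd x))) \<le> M t * (1 - 0)"
      proof (rule integral_bound)
        fix s :: real assume s: "s \<in> {0..1}"
        have "\<bar>w s\<bar> * norm (F t (fst x, s *\<^sub>R snd x)) \<le> 1 * M t"
          using w(2)[OF s] hfam_bound[OF F t(1) star[OF t(2) s]] by (intro mult_mono) auto
        then show "norm (w s *\<^sub>R F t (fst x, s *\<^sub>R snd x)) \<le> M t" by simp
      qed (use cont1[OF F w(1) t] in auto)
      then show ?thesis by simp
    qed
    moreover have "norm (integral {0..1} (\<lambda>s. w s *\<^sub>R F t (fst x, s *\<^sub>R snd x)) - integral {0..1} (\<lambda>s. w s *\<^sub>R F t (fst y, s *\<^sub>R snd y)))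
        \<le> M t * norm (x - y) powr \<mu>" if t: "t \<in> I" "x \<in> U" "y \<in> U" for t x y
    proof -
      have "norm (integral {0..1} (\<lambda>s. w s *\<^sub>R F t (fst x, s *\<^sub>R snd x) - w s *\<^sub>R F t (fst y, s *\<^sub>R snd y)))
          \<le> (M t * norm (x - y) powr \<mu>) * (1 - 0)"
      proof (rule integral_bound)
        fix s :: real assume s: "s \<in> {0..1}"
        have "norm (F t (fst x, s *\<^sub>R snd x) - F t (fst y, s *\<^sub>R snd y))
            \<le> M t * norm ((fst x, s *\<^sub>R snd x) - (fst y, s *\<^sub>R snd y)) powr \<mu>"
          by (rule hfam_holder[OF F t(1) star[OF t(2) s] star[OF t(3) s]])
        also have "\<dots> \<le> M t * norm (x - y) powr \<mu>"
          by (rule mult_left_mono[OF powr_mono2[OF \<mu> norm_ge_zero norm_dilate_snd_le[OF s]] hfam_nonneg[OF F t(1,2)]])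
        finally have "\<bar>w s\<bar> * norm (F t (fst x, s *\<^sub>R snd x) - F t (fst y, s *\<^sub>R snd y)) \<le> 1 * (M t * norm (x - y) powr \<mu>)"
          using w(2)[OF s] by (intro mult_mono) auto
        then show "norm (w s *\<^sub>R F t (fst x, s *\<^sub>R snd x) - w s *\<^sub>R F t (fst y, s *\<^sub>R snd y)) \<le> M t * norm (x - y) powr \<mu>"
          by (simp add: scaleR_diff_right[symmetric])
      qed (use cont1[OF F w(1) t(1,2)] cont1[OF F w(1) t(1,3)] in \<open>auto intro!: continuous_on_diff\<close>)
      then show ?thesis
        using integral_diff[OF integrable_continuous_real[OF cont1[OF F w(1) t(1,2)]]
            integrable_continuous_real[OF cont1[OF F w(1) t(1,3)]]] by simp
    qed
    ultimately show ?thesis by (auto simp: hfam0_def split_beta)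
  qed
  show ?thesis using w F
  proof (induction k arbitrary: F w)
    case 0
    then show ?case using base[of 0 F w] by simp
  next
    case (Suc k)
    let ?G = "\<lambda>t x. integral {0..1} (\<lambda>s. w s *\<^sub>R F t (fst x, s *\<^sub>R snd x))"
    define wt where "wt = (\<lambda>b s. w s * (if snd (b :: 'a \<times> 'c) = 0 then 1 else s))"
    have wt: "continuous_on {0..1} (wt b)" "\<And>s. s \<in> {0..1} \<Longrightarrow> \<bar>wt b s\<bar> \<le> 1" for b
    proof -
      show "continuous_on {0..1} (wt b)"
        using Suc.prems(1) by (cases "snd b = 0") (auto simp: wt_def intro!: continuous_intros)
      show "\<bar>wt b s\<bar> \<le> 1" if "s \<in> {0..1}" for s
        using Suc.prems(2)[OF that] that by (auto simp: wt_def abs_mult intro!: mult_le_one)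
    qed
    let ?P = "\<lambda>b t x. integral {0..1} (\<lambda>s. wt b s *\<^sub>R partial b (F t) (fst x, s *\<^sub>R snd x))"
    have P: "hfam k \<mu> I U M (?P b)" if b: "b \<in> Basis" for b
      by (rule Suc.IH[OF wt hfam_partial[OF Suc.prems(3) b]])
    have deriv: "((\<lambda>u. ?G t (x + u *\<^sub>R b)) has_vector_derivative ?P b t x) (at 0)"
      if b: "b \<in> Basis" and t: "t \<in> I" and x: "x \<in> U" for b t x
    proof -
      obtain d where d: "d > 0" "ball x d \<subseteq> U" using U x openE by blast
      have line: "x + u *\<^sub>R b \<in> U" if "u \<in> {-d<..<d}" for u
      proof -
        have "norm (u *\<^sub>R b) < d" using that b by (auto simp: norm_Basis)
        then show ?thesis using d(2) by (auto simp: dist_norm)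
      qed
      have dil: "(fst (x + u *\<^sub>R b), s *\<^sub>R snd (x + u *\<^sub>R b)) = (fst x, s *\<^sub>R snd x) + (u * (if snd b = 0 then 1 else s)) *\<^sub>R b" for u s
        using b by (auto simp: Basis_prod_def prod_eq_iff algebra_simps)
      have "((\<lambda>u. integral (cbox 0 1) (\<lambda>s. w s *\<^sub>R F t (fst (x + u *\<^sub>R b), s *\<^sub>R snd (x + u *\<^sub>R b)))) has_vector_derivative
          integral (cbox 0 1) (\<lambda>s. wt b s *\<^sub>R partial b (F t) (fst (x + 0 *\<^sub>R b), s *\<^sub>R snd (x + 0 *\<^sub>R b)))) (at 0 within {-d<..<d})"
      proof (rule leibniz_rule_vector_derivative[where fx="\<lambda>u s. wt b s *\<^sub>R partial b (F t) (fst (x + u *\<^sub>R b), s *\<^sub>R snd (x + u *\<^sub>R b))"])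
        fix u and s :: real assume u: "u \<in> {-d<..<d}" and s: "s \<in> cbox 0 1"
        let ?c = "if snd b = 0 then 1 else s"
        have inU: "(fst x, s *\<^sub>R snd x) + (u * ?c) *\<^sub>R b \<in> U"
          using star[OF line[OF u], of s] s unfolding dil by simp
        have part: "has_partial b (F t) ((fst x, s *\<^sub>R snd x) + (u * ?c) *\<^sub>R b)"
          by (rule differentiable_has_partial[OF hfam_differentiable[OF Suc.prems(3) t inU]])
        have lin: "((\<lambda>u. u * ?c) has_vector_derivative ?c) (at u)"
          by (auto intro!: derivative_eq_intros simp: has_real_derivative_iff_has_vector_derivative[symmetric])
        have "((\<lambda>v. F t ((fst x, s *\<^sub>R snd x) + v *\<^sub>R b)) \<circ> (\<lambda>u. u * ?c) has_vector_derivative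
            ?c *\<^sub>R partial b (F t) ((fst x, s *\<^sub>R snd x) + (u * ?c) *\<^sub>R b)) (at u)"
          by (rule vector_diff_chain_at[OF lin has_vector_derivative_partial[OF part]])
        then have "((\<lambda>u. F t ((fst x, s *\<^sub>R snd x) + (u * ?c) *\<^sub>R b)) has_vector_derivative
            ?c *\<^sub>R partial b (F t) ((fst x, s *\<^sub>R snd x) + (u * ?c) *\<^sub>R b)) (at u within {-d<..<d})"
          unfolding o_def by (rule has_vector_derivative_at_within)
        then have "((\<lambda>u. w s *\<^sub>R F t ((fst x, s *\<^sub>R snd x) + (u * ?c) *\<^sub>R b)) has_vector_derivative
            w s *\<^sub>R (?c *\<^sub>R partial b (F t) ((fst x, s *\<^sub>R snd x) + (u * ?c) *\<^sub>R b))) (at u within {-d<..<d})"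
          by (rule bounded_linear.has_vector_derivative[OF bounded_linear_scaleR_right])
        then show "((\<lambda>u. w s *\<^sub>R F t (fst (x + u *\<^sub>R b), s *\<^sub>R snd (x + u *\<^sub>R b))) has_vector_derivative
            wt b s *\<^sub>R partial b (F t) (fst (x + u *\<^sub>R b), s *\<^sub>R snd (x + u *\<^sub>R b))) (at u within {-d<..<d})"
          unfolding dil wt_def scaleR_scaleR .
      next
        fix u assume u: "u \<in> {-d<..<d}"
        show "(\<lambda>s. w s *\<^sub>R F t (fst (x + u *\<^sub>R b), s *\<^sub>R snd (x + u *\<^sub>R b))) integrable_on cbox 0 1"
          using integrable_continuous_real[OF cont1[OF Suc.prems(3,1) t line[OF u]]] by simp
      next
        have "continuous_on ({-d<..<d} \<times> cbox 0 1) (\<lambda>z. (\<lambda>(z, s). wt b s *\<^sub>R partial b (F (fst z)) (fst (snd z), s *\<^sub>R snd (snd z)))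
            ((t, x + fst z *\<^sub>R b), snd z))"
          by (rule continuous_on_compose2[OF cont[OF hfam_partial[OF Suc.prems(3) b] wt(1)]])
            (use line t in \<open>auto intro!: continuous_intros\<close>)
        then show "continuous_on ({-d<..<d} \<times> cbox 0 1) (\<lambda>(u, s). wt b s *\<^sub>R partial b (F t) (fst (x + u *\<^sub>R b), s *\<^sub>R snd (x + u *\<^sub>R b)))"
          by (simp add: split_beta)
      qed (use d in auto)
      then show ?thesis using d(1) by (simp add: at_within_open[of 0 "{-d<..<d}"])
    qed
    have part: "partial b (?G t) x = ?P b t x" if "b \<in> Basis" "t \<in> I" "x \<in> U" for b t x
      by (rule trans[OF partial_def vector_derivative_at[OF deriv[OF that]]])
    have hpart: "has_partial b (?G t) x" if "b \<in> Basis" "t \<in> I" "x \<in> U" for b t x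
      unfolding has_partial_def by (rule differentiableI_vector[OF deriv[OF that]])
    have "?G t differentiable (at x)" if t: "t \<in> I" and x: "x \<in> U" for t x
    proof (rule differentiable_if_continuous_partials[OF U x])
      fix b :: "'a \<times> 'c" assume b: "b \<in> Basis"
      show "has_partial b (?G t) y" if "y \<in> U" for y by (rule hpart[OF b t that])
      have "continuous_on U (\<lambda>x. (\<lambda>(t, x). ?P b t x) (t, x))"
        by (rule continuous_on_compose2[OF hfam_continuous[OF P[OF b]]]) (use t in \<open>auto intro!: continuous_intros\<close>)
      then have "continuous_on U (?P b t)" by simp
      then show "continuous_on U (partial b (?G t))"
        by (rule continuous_on_eq) (use part[OF b t] in simp)
    qed
    moreover have "hfam k \<mu> I U M (\<lambda>t. partial b (?G t))" if b: "b \<in> Basis" for b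
      by (rule hfam_cong[OF U P[OF b]]) (use part[OF b] in simp)
    ultimately show ?case using base[OF Suc.prems(3,1,2)] by simp
  qed
qed


section \<open>Comparison with the Hoelder norms\<close>

lemma partials_simps:
  "partials [] f = f" "partials (b # bs) f = partial b (partials bs f)"
  "partials (bs @ [b]) f = partials bs (partial b f)"
  by (simp_all add: partials_def)

text \<open>
  The hypotheses bound a Hoelder quotient at order \<open>k\<close> only. At lower orders it is bounded by the next
  derivative when \<open>|x - y| \<le> 1\<close>, and by twice the supremum otherwise, hence the factor \<open>DIM('a) + 2\<close>.
\<close>

lemma hfam_if_bounded_partials:
  fixes f :: "'a::euclidean_space \<Rightarrow> 'b::real_normed_vector"
  assumes U: "open U" "convex U" and \<mu>: "0 \<le> \<mu>" "\<mu> \<le> 1" and M: "0 \<le> M"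
    and "\<And>bs. bs \<in> dirs_le k \<Longrightarrow> continuous_on U (partials bs f)"
    and "\<And>bs x. bs \<in> dirs_le k \<Longrightarrow> x \<in> U \<Longrightarrow> norm (partials bs f x) \<le> M"
    and "\<And>bs b x. bs \<in> dirs_le k \<Longrightarrow> length bs < k \<Longrightarrow> b \<in> Basis \<Longrightarrow> x \<in> U \<Longrightarrow> has_partial b (partials bs f) x"
    and "\<And>bs x y. bs \<in> dirs_eq k \<Longrightarrow> x \<in> U \<Longrightarrow> y \<in> U \<Longrightarrow>
      norm (partials bs f x - partials bs f y) \<le> M * norm (x - y) powr \<mu>"
  shows "hfam k \<mu> {t} U (\<lambda>_. (real DIM('a) + 2) * M) (\<lambda>_. f)"
  using assms(6-)
proof (induction k arbitrary: f)
  case 0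
  have nil: "([] :: 'a list) \<in> dirs_le 0" "([] :: 'a list) \<in> dirs_eq 0" by (auto simp: dirs_le_def dirs_eq_def)
  have le: "M \<le> (real DIM('a) + 2) * M" using M by (simp add: algebra_simps)
  have "continuous_on ({t} \<times> U) (\<lambda>z. f (snd z))"
    by (rule continuous_on_compose2[of U f]) (use 0(1)[OF nil(1)] in \<open>auto simp: partials_simps intro!: continuous_intros\<close>)
  moreover have "norm (f x) \<le> (real DIM('a) + 2) * M" if "x \<in> U" for x
    using 0(2)[OF nil(1) that] le by (simp add: partials_simps)
  moreover have "norm (f x - f y) \<le> (real DIM('a) + 2) * M * norm (x - y) powr \<mu>" if "x \<in> U" "y \<in> U" for x y
    using 0(4)[OF nil(2) that] mult_right_mono[OF le, of "norm (x - y) powr \<mu>"] by (simp add: partials_simps)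
  ultimately show ?case by (auto simp: hfam0_def split_beta)
next
  case (Suc k)
  have le: "M \<le> (real DIM('a) + 2) * M" using M by (simp add: algebra_simps)
  have nil: "([] :: 'a list) \<in> dirs_le (Suc k)" by (auto simp: dirs_le_def)
  have one: "[b] \<in> dirs_le (Suc k)" if "b \<in> Basis" for b :: 'a using that by (auto simp: dirs_le_def)
  have diff: "f differentiable (at x)" if "x \<in> U" for x
    by (rule differentiable_if_continuous_partials[OF U(1) that])
      (use Suc.prems(1)[OF one] Suc.prems(3)[OF nil] in \<open>auto simp: partials_simps\<close>)
  have part: "norm (partial b f x) \<le> M" if "b \<in> Basis" "x \<in> U" for b x
    using Suc.prems(2)[OF one[OF that(1)] that(2)] by (simp add: partials_simps)
  have fM: "norm (f x) \<le> M" if "x \<in> U" for x using Suc.prems(2)[OF nil that] by (simp add: partials_simps)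
  have hold: "norm (f x - f y) \<le> (real DIM('a) + 2) * M * norm (x - y) powr \<mu>" if x: "x \<in> U" and y: "y \<in> U" for x y
  proof (cases "norm (x - y) \<le> 1")
    case True
    have "norm (f x - f y) \<le> real DIM('a) * M * norm (x - y)"
      by (rule lipschitz_if_bounded_partials[OF U(2,1) diff part x y])
    also have "\<dots> \<le> (real DIM('a) + 2) * M * norm (x - y) powr \<mu>"
    proof (rule mult_mono)
      show "norm (x - y) \<le> norm (x - y) powr \<mu>"
        using True \<mu> powr_mono'[of \<mu> 1 "norm (x - y)"] by (cases "x = y") auto
    qed (use M in \<open>auto simp: algebra_simps\<close>)
    finally show ?thesis .
  next
    case False
    have "norm (f x - f y) \<le> 2 * M * 1"
      using norm_triangle_ineq4[of "f x" "f y"] fM[OF x] fM[OF y] by linarith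
    also have "\<dots> \<le> (real DIM('a) + 2) * M * norm (x - y) powr \<mu>"
      using False \<mu> M by (intro mult_mono) (auto simp: ge_one_powr_ge_zero algebra_simps)
    finally show ?thesis .
  qed
  have "continuous_on ({t} \<times> U) (\<lambda>z. f (snd z))"
    by (rule continuous_on_compose2[of U f]) (use Suc.prems(1)[OF nil] in \<open>auto simp: partials_simps intro!: continuous_intros\<close>)
  then have "hfam0 \<mu> {t} U (\<lambda>_. (real DIM('a) + 2) * M) (\<lambda>_. f)"
    using hold fM le by (force simp: hfam0_def split_beta intro: order_trans)
  moreover have "hfam k \<mu> {t} U (\<lambda>_. (real DIM('a) + 2) * M) (\<lambda>_. partial b f)" if b: "b \<in> Basis" for b
  proof (rule Suc.IH)
    fix bs :: "'a list"
    have app: "bs \<in> dirs_le k \<Longrightarrow> bs @ [b] \<in> dirs_le (Suc k)" "bs \<in> dirs_eq k \<Longrightarrow> bs @ [b] \<in> dirs_eq (Suc k)"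
      using b by (auto simp: dirs_le_def dirs_eq_def)
    show "bs \<in> dirs_le k \<Longrightarrow> continuous_on U (partials bs (partial b f))"
      using Suc.prems(1)[OF app(1)] by (simp add: partials_simps)
    show "norm (partials bs (partial b f) x) \<le> M" if "bs \<in> dirs_le k" "x \<in> U" for x
      using Suc.prems(2)[OF app(1)] that by (simp add: partials_simps)
    show "has_partial c (partials bs (partial b f)) x" if "bs \<in> dirs_le k" "length bs < k" "c \<in> Basis" "x \<in> U" for c x
      using Suc.prems(3)[OF app(1), of c x] that by (simp add: partials_simps)
    show "norm (partials bs (partial b f) x - partials bs (partial b f) y) \<le> M * norm (x - y) powr \<mu>"
      if "bs \<in> dirs_eq k" "x \<in> U" "y \<in> U" for x y
      using Suc.prems(4)[OF app(2), of x y] that by (simp add: partials_simps)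
  qed
  ultimately show ?case using diff by simp
qed

lemma norm_le_if_components_le:
  fixes x :: "'b::euclidean_space"
  assumes "\<And>j. j \<in> Basis \<Longrightarrow> \<bar>x \<bullet> j\<bar> \<le> M"
  shows "norm x \<le> real DIM('b) * M"
  using norm_le_l1[of x] sum_bounded_above[of "Basis :: 'b set" "\<lambda>j. \<bar>x \<bullet> j\<bar>" M] assms by simp

text \<open>The factor 2 covers integer \<open>\<sigma>\<close>, where the Hoelder condition of exponent 0 bounds the oscillation.\<close>

lemma hfam_of_holder_norm:
  fixes f :: "'a::euclidean_space \<Rightarrow> 'b::euclidean_space"
  assumes U: "open U" "convex U" and M: "0 \<le> M"
    and Ck: "Ck_on (nat \<lfloor>\<sigma>\<rfloor>) U f" and norm: "holder_norm \<sigma> U f \<le> ennreal M"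
  shows "hfam (nat \<lfloor>\<sigma>\<rfloor>) (frac \<sigma>) {t} U (\<lambda>_. (real DIM('a) + 2) * (2 * real DIM('b) * M)) (\<lambda>_. f)"
proof (rule hfam_if_bounded_partials[OF U])
  let ?k = "nat \<lfloor>\<sigma>\<rfloor>"
  let ?S = "\<lambda>j. SUP bs\<in>dirs_le ?k. SUP x\<in>U. ennreal \<bar>partials bs f x \<bullet> j\<bar>"
  let ?H = "\<lambda>j. if \<sigma> \<in> \<int> then 0 else (SUP bs\<in>dirs_eq ?k. SUP (x, y)\<in>{(x, y). x \<in> U \<and> y \<in> U \<and> x \<noteq> y}.
        ennreal (\<bar>partials bs f x \<bullet> j - partials bs f y \<bullet> j\<bar> / norm (x - y) powr frac \<sigma>))"
  have j: "?S j + ?H j \<le> ennreal M" if "j \<in> Basis" for j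
    using order_trans[OF SUP_upper[OF that, of "\<lambda>j. ?S j + ?H j"] norm[unfolded holder_norm_def]] .
  have S: "?S j \<le> ennreal M" and Hj: "?H j \<le> ennreal M" if "j \<in> Basis" for j
    by (rule order_trans[OF _ j[OF that]], simp)+
  have comp: "\<bar>partials bs f x \<bullet> j\<bar> \<le> M" if "bs \<in> dirs_le ?k" "x \<in> U" "j \<in> Basis" for bs x j
  proof -
    have "ennreal \<bar>partials bs f x \<bullet> j\<bar> \<le> (SUP x\<in>U. ennreal \<bar>partials bs f x \<bullet> j\<bar>)" by (rule SUP_upper[OF that(2)])
    also have "\<dots> \<le> ?S j" by (rule SUP_upper[OF that(1)])
    also have "\<dots> \<le> ennreal M" by (rule S[OF that(3)])
    finally show ?thesis using M by (simp only: ennreal_le_iff)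
  qed
  have bd: "norm (partials bs f x) \<le> real DIM('b) * M" if "bs \<in> dirs_le ?k" "x \<in> U" for bs x
    by (rule norm_le_if_components_le[OF comp[OF that]])
  show "0 \<le> frac \<sigma>" "frac \<sigma> \<le> 1" by (auto simp: frac_lt_1 less_imp_le)
  show "0 \<le> 2 * real DIM('b) * M" using M by simp
  show "continuous_on U (partials bs f)" if "bs \<in> dirs_le ?k" for bs using Ck that by (auto simp: Ck_on_def)
  show "has_partial b (partials bs f) x" if "bs \<in> dirs_le ?k" "length bs < ?k" "b \<in> Basis" "x \<in> U" for bs b x
    using Ck that by (auto simp: Ck_on_def)
  show "norm (partials bs f x) \<le> 2 * real DIM('b) * M" if "bs \<in> dirs_le ?k" "x \<in> U" for bs x
    using bd[OF that] mult_nonneg_nonneg[OF of_nat_0_le_iff M, of "DIM('b)"] unfolding mult.assoc by linarith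
  show "norm (partials bs f x - partials bs f y) \<le> 2 * real DIM('b) * M * norm (x - y) powr frac \<sigma>"
    if bs: "bs \<in> dirs_eq ?k" and x: "x \<in> U" and y: "y \<in> U" for bs x y
  proof (cases "x = y")
    case True
    then show ?thesis by simp
  next
    case False
    have bs': "bs \<in> dirs_le ?k" using bs by (auto simp: dirs_eq_def dirs_le_def)
    show ?thesis
    proof (cases "\<sigma> \<in> \<int>")
      case True
      have "norm (partials bs f x - partials bs f y) \<le> 2 * real DIM('b) * M"
        using norm_triangle_ineq4[of "partials bs f x" "partials bs f y"] bd[OF bs' x] bd[OF bs' y] by linarith
      then show ?thesis using True False by (simp add: frac_eq_0_iff[THEN iffD2])
    next
      case nint: False
      have pos: "norm (x - y) powr frac \<sigma> > 0" using False by simp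
      have "\<bar>(partials bs f x - partials bs f y) \<bullet> j\<bar> \<le> M * norm (x - y) powr frac \<sigma>" if j: "j \<in> Basis" for j
      proof -
        let ?Q = "\<lambda>(x, y). ennreal (\<bar>partials bs f x \<bullet> j - partials bs f y \<bullet> j\<bar> / norm (x - y) powr frac \<sigma>)"
        have "?Q (x, y) \<le> (SUP z\<in>{(x, y). x \<in> U \<and> y \<in> U \<and> x \<noteq> y}. ?Q z)"
          by (rule SUP_upper) (use x y False in auto)
        also have "\<dots> \<le> (SUP bs\<in>dirs_eq ?k. SUP (x, y)\<in>{(x, y). x \<in> U \<and> y \<in> U \<and> x \<noteq> y}.
            ennreal (\<bar>partials bs f x \<bullet> j - partials bs f y \<bullet> j\<bar> / norm (x - y) powr frac \<sigma>))"
          by (rule SUP_upper[OF bs])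
        also have "\<dots> \<le> ennreal M" using Hj[OF j] nint by simp
        finally have "\<bar>partials bs f x \<bullet> j - partials bs f y \<bullet> j\<bar> / norm (x - y) powr frac \<sigma> \<le> M"
          using M by (simp add: ennreal_le_iff)
        then show ?thesis using pos by (simp add: divide_le_eq inner_diff_left)
      qed
      then have "norm (partials bs f x - partials bs f y) \<le> real DIM('b) * (M * norm (x - y) powr frac \<sigma>)"
        by (rule norm_le_if_components_le)
      also have "\<dots> \<le> 2 * real DIM('b) * M * norm (x - y) powr frac \<sigma>" using M by simp
      finally show ?thesis .
    qed
  qed
qed

lemma hfam_partials:
  assumes "hfam k \<mu> I U M f" "set bs \<subseteq> Basis" "length bs \<le> k"
  shows "hfam (k - length bs) \<mu> I U M (\<lambda>t. partials bs (f t))"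
  using assms(2,3)
proof (induction bs)
  case Nil
  then show ?case using assms(1) by (simp add: partials_simps)
next
  case (Cons b bs)
  then have "hfam (Suc (k - length (b # bs))) \<mu> I U M (\<lambda>t. partials bs (f t))"
    by (simp add: Suc_diff_Suc del: hfam.simps)
  then show ?case using Cons.prems unfolding partials_simps by (intro hfam_partial) auto
qed

lemma hfam_continuous_at: "hfam k \<mu> I U M f \<Longrightarrow> t \<in> I \<Longrightarrow> continuous_on U (f t)"
  using continuous_on_compose2[of "I \<times> U" "\<lambda>(t, x). f t x" U "\<lambda>x. (t, x)"] hfam_continuous
  by (fastforce intro: continuous_intros)

lemma Ck_on_of_hfam:
  fixes f :: "real \<Rightarrow> 'a::euclidean_space \<Rightarrow> 'b::euclidean_space"
  assumes f: "hfam k \<mu> I U M f" and t: "t \<in> I"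
  shows "Ck_on k U (f t)"
  unfolding Ck_on_def
proof (intro ballI conjI impI)
  fix bs :: "'a list" assume bs: "bs \<in> dirs_le k"
  then have p: "hfam (k - length bs) \<mu> I U M (\<lambda>t. partials bs (f t))"
    by (intro hfam_partials[OF f]) (auto simp: dirs_le_def)
  show "continuous_on U (partials bs (f t))" by (rule hfam_continuous_at[OF p t])
  fix b x :: 'a assume "length bs < k" "b \<in> Basis" "x \<in> U"
  then have "k - length bs = Suc (k - length bs - 1)" by simp
  with p have "hfam (Suc (k - length bs - 1)) \<mu> I U M (\<lambda>t. partials bs (f t))" by metis
  then show "has_partial b (partials bs (f t)) x"
    by (intro differentiable_has_partial hfam_differentiable[OF _ t \<open>x \<in> U\<close>])
qed

lemma holder_norm_le_of_hfam:
  assumes f: "hfam (nat \<lfloor>\<sigma>\<rfloor>) (frac \<sigma>) I U M f" and t: "t \<in> I" and M: "0 \<le> M t"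
  shows "holder_norm \<sigma> U (f t) \<le> ennreal (2 * M t)"
proof -
  let ?k = "nat \<lfloor>\<sigma>\<rfloor>"
  have p: "hfam (?k - length bs) (frac \<sigma>) I U M (\<lambda>t. partials bs (f t))" if "bs \<in> dirs_le ?k" for bs
    using that by (intro hfam_partials[OF f]) (auto simp: dirs_le_def)
  have 1: "ennreal \<bar>partials bs (f t) x \<bullet> j\<bar> \<le> ennreal (M t)" if "bs \<in> dirs_le ?k" "x \<in> U" "j \<in> Basis" for bs x j
    using hfam_bound[OF p[OF that(1)] t that(2)] Basis_le_norm[OF that(3), of "partials bs (f t) x"]
    by (intro ennreal_leI) linarith
  have 2: "ennreal (\<bar>partials bs (f t) x \<bullet> j - partials bs (f t) y \<bullet> j\<bar> / norm (x - y) powr frac \<sigma>) \<le> ennreal (M t)"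
    if "bs \<in> dirs_eq ?k" "x \<in> U" "y \<in> U" "x \<noteq> y" "j \<in> Basis" for bs x y j
  proof (rule ennreal_leI)
    have "bs \<in> dirs_le ?k" using that(1) by (auto simp: dirs_eq_def dirs_le_def)
    from hfam_holder[OF p[OF this] t that(2,3)]
    have "\<bar>(partials bs (f t) x - partials bs (f t) y) \<bullet> j\<bar> \<le> M t * norm (x - y) powr frac \<sigma>"
      using Basis_le_norm[OF that(5), of "partials bs (f t) x - partials bs (f t) y"] by linarith
    then show "\<bar>partials bs (f t) x \<bullet> j - partials bs (f t) y \<bullet> j\<bar> / norm (x - y) powr frac \<sigma> \<le> M t"
      using that(4) by (simp add: divide_le_eq inner_diff_left)
  qed
  have "ennreal (2 * M t) = ennreal (M t) + ennreal (M t)" using M by (simp flip: ennreal_plus)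
  then show ?thesis unfolding holder_norm_def
    by (auto intro!: SUP_least add_mono 1 2)
qed

lemma holder_on_of_hfam:
  assumes f: "hfam (nat \<lfloor>\<sigma>\<rfloor>) (frac \<sigma>) I U M f" and t: "t \<in> I" and M: "0 \<le> M t"
  shows "holder_on \<sigma> U (f t)"
  unfolding holder_on_def
  using Ck_on_of_hfam[OF f t] holder_norm_le_of_hfam[OF f t M] by (auto intro: le_less_trans)


section \<open>Symmetry of the second derivative\<close>

text \<open>
  As a function of the length \<open>\<tau>\<close> of the increment along \<open>w\<close>, the difference
  \<open>H(x + s v + \<tau> w) - H(x + \<tau> w) - \<tau> s (g' v \<bullet> w)\<close> has derivative \<open>o(s)\<close>, by differentiability of the
  gradient \<open>g\<close> at the single point \<open>x\<close>; apply the mean value theorem on \<open>[0, s]\<close>.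
\<close>

lemma second_difference_estimate:
  fixes H :: "'a::real_inner \<Rightarrow> real"
  assumes U: "open U" "x \<in> U" and H: "\<And>y. y \<in> U \<Longrightarrow> (H has_derivative (\<lambda>v. g y \<bullet> v)) (at y)"
    and g: "(g has_derivative g') (at x)" and e: "0 < e"
  shows "\<exists>d>0. \<forall>s. 0 < s \<and> s < d \<longrightarrow>
    \<bar>H (x + s *\<^sub>R v + s *\<^sub>R w) - H (x + s *\<^sub>R w) - H (x + s *\<^sub>R v) + H x - s\<^sup>2 * (g' v \<bullet> w)\<bar> \<le> e * s\<^sup>2"
proof -
  interpret g': bounded_linear g' by (rule has_derivative_bounded_linear[OF g])
  define N where "N = norm v + norm w + 1"
  have N: "N \<ge> 1" by (simp add: N_def)
  define e1 where "e1 = e / (2 * N * N)"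
  have e1: "e1 > 0" using e N by (simp add: e1_def)
  obtain d1 where d1: "d1 > 0" "\<And>y. norm (y - x) < d1 \<Longrightarrow> norm (g y - g x - g' (y - x)) \<le> e1 * norm (y - x)"
    using g e1 unfolding has_derivative_at_alt by blast
  obtain d0 where d0: "d0 > 0" "ball x d0 \<subseteq> U" using U openE by blast
  show ?thesis
  proof (intro exI[of _ "min d0 d1 / N"] conjI allI impI)
    show "min d0 d1 / N > 0" using d0 d1 N by simp
    fix s assume s: "0 < s \<and> s < min d0 d1 / N"
    have sN: "s * N < min d0 d1" using s N by (simp add: pos_less_divide_eq)
    have near: "norm (c *\<^sub>R v + \<tau> *\<^sub>R w) \<le> s * N" if "c \<in> {0..s}" "\<tau> \<in> {0..s}" for c \<tau>
    proof -
      have "norm (c *\<^sub>R v + \<tau> *\<^sub>R w) \<le> \<bar>c\<bar> * norm v + \<bar>\<tau>\<bar> * norm w" by (metis norm_scaleR norm_triangle_ineq)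
      also have "\<dots> \<le> s * norm v + s * norm w" using that by (intro add_mono mult_right_mono) auto
      also have "\<dots> \<le> s * N" using s by (simp add: N_def algebra_simps)
      finally show ?thesis .
    qed
    have inU: "x + c *\<^sub>R v + \<tau> *\<^sub>R w \<in> U" if "c \<in> {0..s}" "\<tau> \<in> {0..s}" for c \<tau>
    proof -
      have "dist (x + (c *\<^sub>R v + \<tau> *\<^sub>R w)) x < d0" using near[OF that] sN by (simp add: dist_norm)
      then show ?thesis using d0(2) by (auto simp: dist_commute add.assoc)
    qed
    have gb: "norm (g (x + c *\<^sub>R v + \<tau> *\<^sub>R w) - g x - g' (c *\<^sub>R v + \<tau> *\<^sub>R w)) \<le> e1 * (s * N)"
      if "c \<in> {0..s}" "\<tau> \<in> {0..s}" for c \<tau>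
    proof -
      have "norm (g (x + c *\<^sub>R v + \<tau> *\<^sub>R w) - g x - g' (x + c *\<^sub>R v + \<tau> *\<^sub>R w - x)) \<le> e1 * norm (x + c *\<^sub>R v + \<tau> *\<^sub>R w - x)"
        by (rule d1(2)) (use near[OF that] sN in \<open>simp add: add.assoc\<close>)
      also have "\<dots> \<le> e1 * (s * N)" using near[OF that] e1 by (simp add: add.assoc)
      finally show ?thesis by (simp add: add.assoc)
    qed
    let ?\<phi> = "\<lambda>\<tau>. H (x + s *\<^sub>R v + \<tau> *\<^sub>R w) - H (x + 0 *\<^sub>R v + \<tau> *\<^sub>R w) - \<tau> * (s * (g' v \<bullet> w))"
    let ?D = "\<lambda>\<tau>. (g (x + s *\<^sub>R v + \<tau> *\<^sub>R w) - g (x + 0 *\<^sub>R v + \<tau> *\<^sub>R w)) \<bullet> w - s * (g' v \<bullet> w)"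
    have "norm (?\<phi> s - ?\<phi> 0) \<le> (e * s) * norm (s - 0)"
    proof (rule differentiable_bound[where S="{0..s}" and f'="\<lambda>\<tau> u. u * ?D \<tau>"])
      fix \<tau> assume \<tau>: "\<tau> \<in> {0..s}"
      have Hd: "((\<lambda>\<tau>. H (x + c *\<^sub>R v + \<tau> *\<^sub>R w)) has_derivative (\<lambda>u. g (x + c *\<^sub>R v + \<tau> *\<^sub>R w) \<bullet> (u *\<^sub>R w))) (at \<tau> within {0..s})"
        if "c \<in> {0..s}" for c
      proof (rule has_derivative_compose[where g=H and f="\<lambda>\<tau>. x + c *\<^sub>R v + \<tau> *\<^sub>R w", OF _ H[OF inU[OF that \<tau>]]])
        show "((\<lambda>\<tau>. x + c *\<^sub>R v + \<tau> *\<^sub>R w) has_derivative (\<lambda>u. u *\<^sub>R w)) (at \<tau> within {0..s})"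
          by (auto intro!: derivative_eq_intros)
      qed
      have "0 \<in> {0..s}" "s \<in> {0..s}" using s by auto
      from has_derivative_diff[OF has_derivative_diff[OF Hd[OF this(2)] Hd[OF this(1)]]
          has_derivative_mult_left[OF has_derivative_ident, of "s * (g' v \<bullet> w)"]]
      show "(?\<phi> has_derivative (\<lambda>u. u * ?D \<tau>)) (at \<tau> within {0..s})"
        by (rule has_derivative_eq_rhs) (auto simp: algebra_simps inner_diff_left)
      have lin: "g' (s *\<^sub>R v + \<tau> *\<^sub>R w) - g' (0 *\<^sub>R v + \<tau> *\<^sub>R w) = s *\<^sub>R g' v" by (simp add: g'.add g'.scaleR)
      let ?a = "g (x + s *\<^sub>R v + \<tau> *\<^sub>R w) - g x - g' (s *\<^sub>R v + \<tau> *\<^sub>R w)"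
      let ?b = "g (x + 0 *\<^sub>R v + \<tau> *\<^sub>R w) - g x - g' (0 *\<^sub>R v + \<tau> *\<^sub>R w)"
      have "?D \<tau> = (?a - ?b) \<bullet> w" using arg_cong[OF lin, of "\<lambda>z. z \<bullet> w"] by (simp add: inner_diff_left algebra_simps)
      also have "\<bar>\<dots>\<bar> \<le> norm (?a - ?b) * norm w" by (rule Cauchy_Schwarz_ineq2)
      also have "\<dots> \<le> (2 * (e1 * (s * N))) * N"
      proof (rule mult_mono)
        have "norm ?a \<le> e1 * (s * N)" "norm ?b \<le> e1 * (s * N)" using gb[OF _ \<tau>, of s] gb[OF _ \<tau>, of 0] s by auto
        then show "norm (?a - ?b) \<le> 2 * (e1 * (s * N))" using norm_triangle_ineq4[of ?a ?b] by linarith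
      qed (use s e1 N in \<open>auto simp: N_def\<close>)
      also have "\<dots> = e * s" using N by (simp add: e1_def field_simps)
      finally have "\<bar>?D \<tau>\<bar> \<le> e * s" .
      then show "onorm (\<lambda>u. u * ?D \<tau>) \<le> e * s"
        by (intro onorm_le) (use mult_right_mono in \<open>fastforce simp: abs_mult mult.commute\<close>)
    qed (use s in auto)
    moreover have "?\<phi> s - ?\<phi> 0 = H (x + s *\<^sub>R v + s *\<^sub>R w) - H (x + s *\<^sub>R w) - H (x + s *\<^sub>R v) + H x - s\<^sup>2 * (g' v \<bullet> w)"
      by (simp add: power2_eq_square algebra_simps)
    ultimately show "\<bar>H (x + s *\<^sub>R v + s *\<^sub>R w) - H (x + s *\<^sub>R w) - H (x + s *\<^sub>R v) + H x - s\<^sup>2 * (g' v \<bullet> w)\<bar> \<le> e * s\<^sup>2"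
      using s by (simp only: real_norm_def power2_eq_square) (simp add: mult.assoc)
  qed
qed

text \<open>
  The second difference of \<open>H\<close> is symmetric in the two increments, and divided by \<open>s\<^sup>2\<close> it tends
  to the second derivative.
\<close>

lemma second_derivative_symmetric:
  fixes H :: "'a::real_inner \<Rightarrow> real"
  assumes U: "open U" "x \<in> U" and H: "\<And>y. y \<in> U \<Longrightarrow> (H has_derivative (\<lambda>v. g y \<bullet> v)) (at y)"
    and g: "(g has_derivative g') (at x)"
  shows "g' v \<bullet> w = g' w \<bullet> v"
proof (rule ccontr)
  assume ne: "g' v \<bullet> w \<noteq> g' w \<bullet> v"
  define e where "e = \<bar>g' v \<bullet> w - g' w \<bullet> v\<bar> / 3"
  have e: "e > 0" using ne by (simp add: e_def)
  let ?\<Delta> = "\<lambda>v w s. H (x + s *\<^sub>R v + s *\<^sub>R w) - H (x + s *\<^sub>R w) - H (x + s *\<^sub>R v) + H x"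
  obtain d1 where d1: "d1 > 0" "\<And>s. 0 < s \<and> s < d1 \<Longrightarrow> \<bar>?\<Delta> v w s - s\<^sup>2 * (g' v \<bullet> w)\<bar> \<le> e * s\<^sup>2"
    using second_difference_estimate[OF U H g e, of v w] by blast
  obtain d2 where d2: "d2 > 0" "\<And>s. 0 < s \<and> s < d2 \<Longrightarrow> \<bar>?\<Delta> w v s - s\<^sup>2 * (g' w \<bullet> v)\<bar> \<le> e * s\<^sup>2"
    using second_difference_estimate[OF U H g e, of w v] by blast
  define s where "s = min d1 d2 / 2"
  have s: "0 < s" "s < d1" "s < d2" using d1 d2 by (auto simp: s_def)
  have "?\<Delta> w v s = ?\<Delta> v w s" by (simp add: add.commute add.left_commute)
  then have "\<bar>s\<^sup>2 * (g' v \<bullet> w) - s\<^sup>2 * (g' w \<bullet> v)\<bar> \<le> 2 * (e * s\<^sup>2)"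
    using d1(2)[of s] d2(2)[of s] s by linarith
  moreover have "s\<^sup>2 * (g' v \<bullet> w) - s\<^sup>2 * (g' w \<bullet> v) = s\<^sup>2 * (g' v \<bullet> w - g' w \<bullet> v)"
    by (simp add: right_diff_distrib)
  ultimately have "s\<^sup>2 * \<bar>g' v \<bullet> w - g' w \<bullet> v\<bar> \<le> s\<^sup>2 * (2 * e)"
    by (simp add: abs_mult mult.commute mult.left_commute)
  then have "\<bar>g' v \<bullet> w - g' w \<bullet> v\<bar> \<le> 2 * e" using s by simp
  then show False using e by (simp add: e_def)
qed


section \<open>The vector field near the torus\<close>

text \<open>
  The coefficients of the field have one derivative more than the solution, because the difference
  of two compositions loses one derivative. That top derivative is controlled at each time separately.
\<close>

definition coeff_fam :: "nat \<Rightarrow> real \<Rightarrow> 'a::euclidean_space set \<Rightarrow> (real \<Rightarrow> real)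
    \<Rightarrow> (real \<Rightarrow> 'a \<Rightarrow> 'b::real_normed_vector) \<Rightarrow> bool" where
  "coeff_fam k \<mu> V M F \<longleftrightarrow> hfam k \<mu> {0..} V M F \<and> (\<forall>t\<ge>0. hfam (Suc k) \<mu> {t} V M F)"

lemma open_phase_space: "open (phase_space r)"
  by (auto simp: phase_space_def intro: open_Times)

lemma convex_phase_space: "convex (phase_space r)"
  by (auto simp: phase_space_def intro: convex_Times)

text \<open>
  The field is \<open>(GU, GV)\<close>, minus its value \<open>(\<omega>, 0)\<close> on the unperturbed torus, expanded at \<open>p = 0\<close>
  with the sizes \<open>\<beta>, B \<sim> b\<close>, \<open>\<alpha> \<sim> a\<close> and \<open>A, C \<sim> K\<close>.
\<close>

locale kam_field =
  fixes \<omega> :: "real ^ 'n" and r \<mu> K :: real and k :: nat and a b :: "real \<Rightarrow> real"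
    and \<alpha> \<beta> :: "real \<Rightarrow> (real ^ 'n) \<times> (real ^ 'n) \<Rightarrow> real ^ 'n"
    and A B :: "'n \<Rightarrow> real \<Rightarrow> (real ^ 'n) \<times> (real ^ 'n) \<Rightarrow> real ^ 'n"
    and C :: "'n \<Rightarrow> 'n \<Rightarrow> real \<Rightarrow> (real ^ 'n) \<times> (real ^ 'n) \<Rightarrow> real ^ 'n"
  assumes r: "0 < r" and \<mu>: "0 \<le> \<mu>" "\<mu> \<le> 1" and K: "1 \<le> K"
    and a: "\<And>t. 0 \<le> t \<Longrightarrow> 0 < a t" "\<And>s t. 0 \<le> s \<Longrightarrow> s \<le> t \<Longrightarrow> a t \<le> a s" "a absolutely_integrable_on {0..}"
    and b: "\<And>t. 0 \<le> t \<Longrightarrow> 0 < b t" "\<And>s t. 0 \<le> s \<Longrightarrow> s \<le> t \<Longrightarrow> b t \<le> b s" "b absolutely_integrable_on {0..}"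
    and \<alpha>: "coeff_fam (Suc k) \<mu> (phase_space r) a \<alpha>"
    and \<beta>: "coeff_fam (Suc k) \<mu> (phase_space r) b \<beta>"
    and A: "\<And>i. coeff_fam (Suc k) \<mu> (phase_space r) (\<lambda>_. K) (A i)"
    and B: "\<And>i. coeff_fam (Suc k) \<mu> (phase_space r) b (B i)"
    and C: "\<And>i j. coeff_fam (Suc k) \<mu> (phase_space r) (\<lambda>_. K) (C i j)"
begin

definition GU :: "real \<Rightarrow> (real ^ 'n) \<times> (real ^ 'n) \<Rightarrow> real ^ 'n" where
  "GU t z = \<beta> t z + (\<Sum>i\<in>UNIV. (snd z $ i) *\<^sub>R A i t z)"

definition GV :: "real \<Rightarrow> (real ^ 'n) \<times> (real ^ 'n) \<Rightarrow> real ^ 'n" where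
  "GV t z = \<alpha> t z + (\<Sum>i\<in>UNIV. (snd z $ i) *\<^sub>R B i t z) +
     (\<Sum>i\<in>UNIV. \<Sum>j\<in>UNIV. (snd z $ i * snd z $ j) *\<^sub>R C i j t z)"

text \<open>The linear flow displaced by \<open>(u, v)\<close>.\<close>

definition psi :: "(real \<Rightarrow> real ^ 'n \<Rightarrow> real ^ 'n) \<Rightarrow> (real \<Rightarrow> real ^ 'n \<Rightarrow> real ^ 'n)
    \<Rightarrow> real \<Rightarrow> real ^ 'n \<Rightarrow> (real ^ 'n) \<times> (real ^ 'n)" where
  "psi u v t q = (q + t *\<^sub>R \<omega> + u t q, v t q)"

text \<open>
  The regularity of the torus; \<open>k + 1 + \<mu>\<close> will be \<open>\<sigma>\<close>.
\<close>

definition reg :: "real \<Rightarrow> (real \<Rightarrow> real) \<Rightarrow> (real \<Rightarrow> real ^ 'n \<Rightarrow> 'b::real_normed_vector) \<Rightarrow> bool" where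
  "reg T M f \<longleftrightarrow> hfam (Suc k) \<mu> {T..} UNIV M f"

text \<open>
  Each partial derivative of \<open>psi u v\<close> is a unit vector plus one derivative of \<open>u\<close> and one of \<open>v\<close>, three
  terms of size at most 1.
\<close>

lemma lipfam_psi:
  assumes u: "reg T (\<lambda>_. 1) u" and v: "reg T (\<lambda>_. 1) v"
  shows "lipfam (Suc k) \<mu> {T..} UNIV (3 * real CARD('n)) (psi u v)"
proof -
  note u' = u[unfolded reg_def] and v' = v[unfolded reg_def]
  have one: "1 \<le> real CARD('n)" by (simp add: Suc_leI)
  have deriv: "(psi u v t has_derivative (\<lambda>h. (h + Du h, Dv h))) (at q)"
    if "(u t has_derivative Du) (at q)" "(v t has_derivative Dv) (at q)" for t q Du Dv
    unfolding psi_def[abs_def] using that by (auto intro!: derivative_eq_intros)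
  have dpsi: "psi u v t differentiable (at q)"
      "partial c (psi u v t) q = (c, 0) + ((partial c (u t) q, 0) + (0, partial c (v t) q))"
    if t: "t \<in> {T..}" for t q c
  proof -
    obtain Du Dv where D: "(u t has_derivative Du) (at q)" "(v t has_derivative Dv) (at q)"
      using hfam_differentiable[OF u' t, of q] hfam_differentiable[OF v' t, of q] by (auto simp: differentiable_def)
    show "psi u v t differentiable (at q)" by (rule differentiableI[OF deriv[OF D]])
    show "partial c (psi u v t) q = (c, 0) + ((partial c (u t) q, 0) + (0, partial c (v t) q))"
      using has_partial_of_derivative(2)[OF deriv[OF D]] has_partial_of_derivative(2)[OF D(1)]
        has_partial_of_derivative(2)[OF D(2)] by simp
  qed
  have cont: "continuous_on ({T..} \<times> UNIV) (\<lambda>(t, q). psi u v t q)"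
    using hfam_continuous[OF u'] hfam_continuous[OF v'] unfolding psi_def split_beta
    by (intro continuous_intros) auto
  have hp: "hfam k \<mu> {T..} UNIV (\<lambda>_. 3) (\<lambda>t. partial c (psi u v t))" if c: "c \<in> Basis" for c
  proof (rule hfam_cong[OF open_UNIV])
    have "hfam k \<mu> {T..} UNIV (\<lambda>_. 1 + (1 + 1)) (\<lambda>t q. (c, 0) + ((partial c (u t) q, 0) + (0, partial c (v t) q)))"
      by (intro hfam_add open_UNIV hfam_Pair0 hfam_partial[OF u' c] hfam_partial[OF v' c] hfam_const)
        (use c in simp)
    then show "hfam k \<mu> {T..} UNIV (\<lambda>_. 3) (\<lambda>t q. (c, 0) + ((partial c (u t) q, 0) + (0, partial c (v t) q)))" by simp
  qed (use dpsi in simp)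
  have "norm (psi u v t x - psi u v t y) \<le> 3 * real CARD('n) * norm (x - y)" if t: "t \<in> {T..}" for t x y
  proof -
    have "norm (psi u v t x - psi u v t y) \<le> real DIM(real ^ 'n) * 3 * norm (x - y)"
      by (rule lipschitz_if_bounded_partials[OF convex_UNIV open_UNIV dpsi(1)[OF t] hfam_bound[OF hp t]]) auto
    then show ?thesis by simp
  qed
  moreover have "hfam k \<mu> {T..} UNIV (\<lambda>_. 3 * real CARD('n)) (\<lambda>t. partial c (psi u v t))" if "c \<in> Basis" for c
    by (rule hfam_mono[OF hp[OF that]]) (use one in simp)
  ultimately show ?thesis using cont dpsi(1) by (auto simp: lipfam_def)
qed

text \<open>
  The product rule \<open>p\<^sub>1 f\<^sub>1 - p\<^sub>2 f\<^sub>2 = (p\<^sub>1 - p\<^sub>2) f\<^sub>1 + p\<^sub>2 (f\<^sub>1 - f\<^sub>2)\<close> for a momentum monomial \<open>p\<close> of size \<open>W\<close>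
  and a coefficient \<open>f\<close> of size \<open>M\<close>.
\<close>

lemma reg_scaled_coefficient:
  assumes "reg T W p1" "reg T W p2" "reg T dp (\<lambda>t q. p1 t q - p2 t q :: real)"
    and "reg T M f1" "reg T (\<lambda>t. M t * D t) (\<lambda>t q. f1 t q - f2 t q)"
  shows "reg T (\<lambda>t. 2 ^ Suc (Suc k) * (M t * (dp t + W t * D t))) (\<lambda>t q. p1 t q *\<^sub>R f1 t q - p2 t q *\<^sub>R f2 t q)"
    and "reg T (\<lambda>t. 2 ^ Suc (Suc k) * (M t * W t)) (\<lambda>t q. p1 t q *\<^sub>R f1 t q)"
proof -
  note * = assms[unfolded reg_def]
  have "reg T (\<lambda>t. 2 ^ Suc (Suc k) * (dp t * M t) + 2 ^ Suc (Suc k) * (W t * (M t * D t)))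
      (\<lambda>t q. (p1 t q - p2 t q) *\<^sub>R f1 t q + p2 t q *\<^sub>R (f1 t q - f2 t q))"
    unfolding reg_def
    by (rule hfam_add[OF open_UNIV hfam_scaleR[OF open_UNIV *(3) *(4)] hfam_scaleR[OF open_UNIV *(2) *(5)]])
  then show "reg T (\<lambda>t. 2 ^ Suc (Suc k) * (M t * (dp t + W t * D t))) (\<lambda>t q. p1 t q *\<^sub>R f1 t q - p2 t q *\<^sub>R f2 t q)"
    by (simp add: algebra_simps)
  have "reg T (\<lambda>t. 2 ^ Suc (Suc k) * (W t * M t)) (\<lambda>t q. p1 t q *\<^sub>R f1 t q)"
    unfolding reg_def by (rule hfam_scaleR[OF open_UNIV *(1) *(4)])
  then show "reg T (\<lambda>t. 2 ^ Suc (Suc k) * (M t * W t)) (\<lambda>t q. p1 t q *\<^sub>R f1 t q)"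
    by (simp add: mult.commute)
qed

lemma reg_mono: "reg T M f \<Longrightarrow> (\<And>t. T \<le> t \<Longrightarrow> M t \<le> N t) \<Longrightarrow> reg T N f"
  unfolding reg_def by (rule hfam_mono) auto

lemma reg_add: "reg T M f \<Longrightarrow> reg T N g \<Longrightarrow> reg T (\<lambda>t. M t + N t) (\<lambda>t q. f t q + g t q)"
  unfolding reg_def by (rule hfam_add[OF open_UNIV])

lemma reg_sum:
  assumes "\<And>i. reg T M (f i)"
  shows "reg T (\<lambda>t. real CARD('n) * M t) (\<lambda>t q. \<Sum>i\<in>(UNIV::'n set). f i t q)"
  using hfam_sum[OF open_UNIV, of "UNIV :: 'n set" "Suc k" \<mu> "{T..}" "\<lambda>_. M" f] assms unfolding reg_def by simp

lemma reg_component: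
  fixes f :: "real \<Rightarrow> real ^ 'n \<Rightarrow> real ^ 'n"
  shows "reg T M f \<Longrightarrow> reg T M (\<lambda>t q. f t q $ i)"
  using hfam_inner[OF open_UNIV, of "Suc k" \<mu> "{T..}" M f "axis i 1"] unfolding reg_def
  by (simp add: inner_axis axis_in_Basis_iff)

text \<open>
  \<open>w\<close> bounds the momenta and \<open>du\<close>, \<open>dv\<close> the distance of the two approximate solutions. The
  estimates are those of the product rule: each factor of \<open>p\<close> contributes one factor \<open>w\<close> or its
  increment \<open>dv\<close>, and differences of coefficients contribute \<open>du + dv\<close>.
\<close>

lemma field_estimates:
  "\<exists>E\<ge>1. \<forall>T u1 v1 u2 v2 w du dv. 0 \<le> T \<longrightarrow> reg T (\<lambda>_. 1) u1 \<longrightarrow> reg T (\<lambda>_. 1) u2 \<longrightarrow>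
     reg T w v1 \<longrightarrow> reg T w v2 \<longrightarrow> (\<forall>t\<ge>T. w t \<le> 1) \<longrightarrow>
     (\<forall>t\<ge>T. \<forall>q. norm (v1 t q) < r) \<longrightarrow> (\<forall>t\<ge>T. \<forall>q. norm (v2 t q) < r) \<longrightarrow>
     reg T du (\<lambda>t q. u1 t q - u2 t q) \<longrightarrow> reg T dv (\<lambda>t q. v1 t q - v2 t q) \<longrightarrow>
     reg T (\<lambda>t. E * (b t * (du t + dv t) + K * (dv t + w t * (du t + dv t))))
       (\<lambda>t q. GU t (psi u1 v1 t q) - GU t (psi u2 v2 t q)) \<and>
     reg T (\<lambda>t. E * (a t * (du t + dv t) + b t * (dv t + w t * (du t + dv t)) +
         K * (w t * dv t + w t * w t * (du t + dv t))))
       (\<lambda>t q. GV t (psi u1 v1 t q) - GV t (psi u2 v2 t q)) \<and>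
     reg T (\<lambda>t. E * (b t + K * w t)) (\<lambda>t q. GU t (psi u1 v1 t q)) \<and>
     reg T (\<lambda>t. E * (a t + b t * w t + K * (w t * w t))) (\<lambda>t q. GV t (psi u1 v1 t q))"
proof -
  let ?L = "3 * real CARD('n)"
  have N1: "1 \<le> real CARD('n)" by (simp add: Suc_leI)
  then have L: "1 \<le> ?L" by linarith
  obtain E1 where E1: "1 \<le> E1" and comp:
    "\<And>I (U::(real^'n) set) (V::((real^'n)\<times>(real^'n)) set) M (F::real \<Rightarrow> (real^'n)\<times>(real^'n) \<Rightarrow> real^'n) g.
       open U \<Longrightarrow> hfam (Suc k) \<mu> I V M F \<Longrightarrow> lipfam (Suc k) \<mu> I U ?L g \<Longrightarrow> \<forall>t\<in>I. \<forall>x\<in>U. g t x \<in> V \<Longrightarrow>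
       hfam (Suc k) \<mu> I U (\<lambda>t. E1 * M t) (\<lambda>t x. F t (g t x))"
    using hfam_compose[OF L \<mu>, where k="Suc k" and 'a="real^'n" and 'b="real^'n" and 'c="(real^'n)\<times>(real^'n)"] by blast
  obtain E2 where E2: "1 \<le> E2" and compd:
    "\<And>I (U::(real^'n) set) (V::((real^'n)\<times>(real^'n)) set) M D (F::real \<Rightarrow> (real^'n)\<times>(real^'n) \<Rightarrow> real^'n) g1 g2.
       open U \<Longrightarrow> open V \<Longrightarrow> convex V \<Longrightarrow> hfam (Suc k) \<mu> I V M F \<Longrightarrow> \<forall>t\<in>I. hfam (Suc (Suc k)) \<mu> {t} V M F \<Longrightarrow>
       lipfam (Suc k) \<mu> I U ?L g1 \<Longrightarrow> lipfam (Suc k) \<mu> I U ?L g2 \<Longrightarrow> hfam (Suc k) \<mu> I U D (\<lambda>t x. g1 t x - g2 t x) \<Longrightarrow>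
       \<forall>t\<in>I. \<forall>x\<in>U. g1 t x \<in> V \<Longrightarrow> \<forall>t\<in>I. \<forall>x\<in>U. g2 t x \<in> V \<Longrightarrow>
       hfam (Suc k) \<mu> I U (\<lambda>t. E2 * (M t * D t)) (\<lambda>t x. F t (g1 t x) - F t (g2 t x))"
    using hfam_compose_diff[OF L \<mu>, where k="Suc k" and 'a="real^'n" and 'b="real^'n" and 'c="(real^'n)\<times>(real^'n)"] by blast
  define E0 where "E0 = max E1 E2"
  have E0: "1 \<le> E0" "E1 \<le> E0" "E2 \<le> E0" using E1 by (auto simp: E0_def)
  define P where "P = (2::real) ^ Suc (Suc k)"
  have P: "1 \<le> P" unfolding P_def by (rule one_le_power) simp
  define N where "N = real CARD('n)"
  have N: "1 \<le> N" using N1 by (simp add: N_def)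
  define E where "E = 2 * N * N * P * P * E0"
  have pos: "0 \<le> N" "0 \<le> P" "0 \<le> E0" using N P E0 by auto
  have NP: "1 \<le> N * P" "1 \<le> N * N" "1 \<le> P * P"
    using mult_mono[of 1 N 1 P] mult_mono[of 1 N 1 N] mult_mono[of 1 P 1 P] N P by auto
  have le: "E0 \<le> E" "N * P * E0 \<le> E" "N * N * P * E0 * (2 * P) \<le> E" "N * N * P * E0 * P \<le> E"
  proof -
    have "1 * E0 \<le> (N * P) * E0" using NP pos by (intro mult_right_mono) auto
    moreover have "(N * P * E0) * 1 \<le> (N * P * E0) * (2 * (N * P))" using NP pos by (intro mult_left_mono) auto
    moreover have "0 \<le> N * N * P * E0 * P" using pos by simp
    ultimately show "E0 \<le> E" "N * P * E0 \<le> E" "N * N * P * E0 * (2 * P) \<le> E" "N * N * P * E0 * P \<le> E"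
      by (auto simp: E_def algebra_simps)
  qed
  show ?thesis
  proof (intro exI[of _ E] conjI allI impI)
    show "1 \<le> E" using le E0 by linarith
  next
    fix T w du dv and u1 v1 u2 v2 :: "real \<Rightarrow> real ^ 'n \<Rightarrow> real ^ 'n"
    assume T: "0 \<le> T" and u: "reg T (\<lambda>_. 1) u1" "reg T (\<lambda>_. 1) u2" and v: "reg T w v1" "reg T w v2"
      and w: "\<forall>t\<ge>T. w t \<le> 1" and ball: "\<forall>t\<ge>T. \<forall>q. norm (v1 t q) < r" "\<forall>t\<ge>T. \<forall>q. norm (v2 t q) < r"
      and du: "reg T du (\<lambda>t q. u1 t q - u2 t q)" and dv: "reg T dv (\<lambda>t q. v1 t q - v2 t q)"
    define D where "D = (\<lambda>t. du t + dv t)"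
    have v1: "reg T (\<lambda>_. 1) v1" "reg T (\<lambda>_. 1) v2" using v w by (auto intro: reg_mono)
    note lip = lipfam_psi[OF u(1) v1(1)] lipfam_psi[OF u(2) v1(2)]
    have in_V: "\<forall>t\<in>{T..}. \<forall>q\<in>UNIV. psi u1 v1 t q \<in> phase_space r" "\<forall>t\<in>{T..}. \<forall>q\<in>UNIV. psi u2 v2 t q \<in> phase_space r"
      using ball by (auto simp: psi_def phase_space_def dist_norm)
    have "hfam (Suc k) \<mu> {T..} UNIV D (\<lambda>t q. (u1 t q - u2 t q, v1 t q - v2 t q))"
      unfolding D_def by (rule hfam_Pair[OF open_UNIV du[unfolded reg_def] dv[unfolded reg_def]])
    then have D: "hfam (Suc k) \<mu> {T..} UNIV D (\<lambda>t q. psi u1 v1 t q - psi u2 v2 t q)"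
      by (simp add: psi_def del: hfam.simps)
    have nonneg: "0 \<le> w t" "0 \<le> du t" "0 \<le> dv t" "0 \<le> D t" "0 < a t" "0 < b t" if "T \<le> t" for t
      using that T a(1) b(1) hfam_nonneg[OF v(1)[unfolded reg_def], of t 0] hfam_nonneg[OF du[unfolded reg_def], of t 0]
        hfam_nonneg[OF dv[unfolded reg_def], of t 0] hfam_nonneg[OF D, of t 0] by auto
    have F1: "reg T (\<lambda>t. E0 * M t) (\<lambda>t q. F t (psi u1 v1 t q))"
      and F2: "reg T (\<lambda>t. E0 * M t * D t) (\<lambda>t q. F t (psi u1 v1 t q) - F t (psi u2 v2 t q))"
      if F: "coeff_fam (Suc k) \<mu> (phase_space r) M F" for M and F :: "real \<Rightarrow> (real ^ 'n) \<times> (real ^ 'n) \<Rightarrow> real ^ 'n"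
    proof -
      have F': "hfam (Suc k) \<mu> {T..} (phase_space r) M F"
        by (rule hfam_subset_mono[of _ _ "{0..}" "phase_space r" M]) (use F T in \<open>auto simp: coeff_fam_def simp del: hfam.simps\<close>)
      have F'': "\<forall>t\<in>{T..}. hfam (Suc (Suc k)) \<mu> {t} (phase_space r) M F"
        using F T by (auto simp: coeff_fam_def simp del: hfam.simps)
      have M: "0 \<le> M t" if "T \<le> t" for t
        using hfam_nonneg[OF F', of t "psi u1 v1 t 0"] in_V that by simp
      show "reg T (\<lambda>t. E0 * M t) (\<lambda>t q. F t (psi u1 v1 t q))"
        unfolding reg_def by (rule hfam_mono[OF comp[OF open_UNIV F' lip(1) in_V(1)]])
          (use M E0 in \<open>auto intro: mult_right_mono\<close>)
      show "reg T (\<lambda>t. E0 * M t * D t) (\<lambda>t q. F t (psi u1 v1 t q) - F t (psi u2 v2 t q))"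
        unfolding reg_def
        by (rule hfam_mono[OF compd[OF open_UNIV open_phase_space convex_phase_space F' F'' lip D in_V]])
          (use M E0 nonneg in \<open>auto simp: mult.assoc intro!: mult_right_mono\<close>)
    qed
    note F1 = F1 and F2 = F2
    have comps: "reg T w (\<lambda>t q. v1 t q $ i)" "reg T w (\<lambda>t q. v2 t q $ i)" "reg T dv (\<lambda>t q. v1 t q $ i - v2 t q $ i)" for i
      using reg_component[OF v(1)] reg_component[OF v(2)] reg_component[OF dv] by auto
    have quad: "reg T (\<lambda>t. P * (w t * w t)) (\<lambda>t q. v1 t q $ i * v1 t q $ j)"
      "reg T (\<lambda>t. P * (w t * w t)) (\<lambda>t q. v2 t q $ i * v2 t q $ j)"
      "reg T (\<lambda>t. P * (2 * (w t * dv t))) (\<lambda>t q. v1 t q $ i * v1 t q $ j - v2 t q $ i * v2 t q $ j)" for i j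
    proof -
      note h = comps[unfolded reg_def]
      show "reg T (\<lambda>t. P * (w t * w t)) (\<lambda>t q. v1 t q $ i * v1 t q $ j)"
        using hfam_scaleR[OF open_UNIV h(1)[of i] h(1)[of j]] by (simp add: reg_def P_def)
      show "reg T (\<lambda>t. P * (w t * w t)) (\<lambda>t q. v2 t q $ i * v2 t q $ j)"
        using hfam_scaleR[OF open_UNIV h(2)[of i] h(2)[of j]] by (simp add: reg_def P_def)
      have "reg T (\<lambda>t. P * (dv t * w t) + P * (w t * dv t)) (\<lambda>t q. (v1 t q $ i - v2 t q $ i) * v1 t q $ j + v2 t q $ i * (v1 t q $ j - v2 t q $ j))"
        using reg_add[OF hfam_scaleR[OF open_UNIV h(3)[of i] h(1)[of j], folded reg_def] hfam_scaleR[OF open_UNIV h(2)[of i] h(3)[of j], folded reg_def]]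
        by (simp add: P_def)
      then show "reg T (\<lambda>t. P * (2 * (w t * dv t))) (\<lambda>t q. v1 t q $ i * v1 t q $ j - v2 t q $ i * v2 t q $ j)"
        by (simp add: algebra_simps)
    qed
    have Dt: "du t + dv t = D t" for t by (simp add: D_def)
    note lin_term = reg_scaled_coefficient[OF comps F1 F2, folded P_def]
    note quad_term = reg_scaled_coefficient[OF quad F1 F2, folded P_def]
    have eqU: "GU t (psi u v t q) = \<beta> t (psi u v t q) + (\<Sum>i\<in>UNIV. (v t q $ i) *\<^sub>R A i t (psi u v t q))" for u v t q
      by (simp add: GU_def psi_def)
    have eqV: "GV t (psi u v t q) = \<alpha> t (psi u v t q) + (\<Sum>i\<in>UNIV. (v t q $ i) *\<^sub>R B i t (psi u v t q)) +
       (\<Sum>i\<in>UNIV. \<Sum>j\<in>UNIV. (v t q $ i * v t q $ j) *\<^sub>R C i j t (psi u v t q))" for u v t q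
      by (simp add: GV_def psi_def)
    have scale: "x * y \<le> E * y" if "x \<le> E" "0 \<le> y" for x y by (rule mult_right_mono[OF that])
    show "reg T (\<lambda>t. E * (b t * (du t + dv t) + K * (dv t + w t * (du t + dv t))))
       (\<lambda>t q. GU t (psi u1 v1 t q) - GU t (psi u2 v2 t q))"
    proof -
      have "reg T (\<lambda>t. E0 * b t * D t + N * (P * (E0 * K * (dv t + w t * D t))))
        (\<lambda>t q. (\<beta> t (psi u1 v1 t q) - \<beta> t (psi u2 v2 t q)) +
          (\<Sum>i\<in>UNIV. (v1 t q $ i) *\<^sub>R A i t (psi u1 v1 t q) - (v2 t q $ i) *\<^sub>R A i t (psi u2 v2 t q)))"
        unfolding N_def by (intro reg_add reg_sum F2 \<beta> lin_term(1) A)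
      then have "reg T (\<lambda>t. E0 * b t * D t + N * (P * (E0 * K * (dv t + w t * D t))))
        (\<lambda>t q. GU t (psi u1 v1 t q) - GU t (psi u2 v2 t q))"
        by (simp add: eqU sum_subtractf algebra_simps)
      then show ?thesis
      proof (rule reg_mono)
        fix t assume t: "T \<le> t"
        note nn = nonneg[OF t]
        have "E0 * (b t * D t) \<le> E * (b t * D t)" using nn le by (intro scale) auto
        moreover have "N * P * E0 * (K * (dv t + w t * D t)) \<le> E * (K * (dv t + w t * D t))"
          using nn le K by (intro scale) auto
        ultimately show "E0 * b t * D t + N * (P * (E0 * K * (dv t + w t * D t)))
            \<le> E * (b t * (du t + dv t) + K * (dv t + w t * (du t + dv t)))"
          unfolding Dt by (simp add: distrib_left mult.assoc)
      qed
    qed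
    show "reg T (\<lambda>t. E * (b t + K * w t)) (\<lambda>t q. GU t (psi u1 v1 t q))"
    proof -
      have "reg T (\<lambda>t. E0 * b t + N * (P * (E0 * K * w t))) (\<lambda>t q. GU t (psi u1 v1 t q))"
        unfolding N_def eqU by (intro reg_add reg_sum F1 \<beta> lin_term(2) A)
      then show ?thesis
      proof (rule reg_mono)
        fix t assume t: "T \<le> t"
        note nn = nonneg[OF t]
        have "E0 * b t \<le> E * b t" using nn le by (intro scale) auto
        moreover have "N * P * E0 * (K * w t) \<le> E * (K * w t)" using nn le K by (intro scale) auto
        ultimately show "E0 * b t + N * (P * (E0 * K * w t)) \<le> E * (b t + K * w t)"
          by (simp add: distrib_left mult.assoc)
      qed
    qed
    show "reg T (\<lambda>t. E * (a t * (du t + dv t) + b t * (dv t + w t * (du t + dv t)) +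
         K * (w t * dv t + w t * w t * (du t + dv t))))
       (\<lambda>t q. GV t (psi u1 v1 t q) - GV t (psi u2 v2 t q))"
    proof -
      have "reg T (\<lambda>t. E0 * a t * D t + N * (P * (E0 * b t * (dv t + w t * D t))) +
          N * (N * (P * (E0 * K * (P * (2 * (w t * dv t)) + P * (w t * w t) * D t)))))
        (\<lambda>t q. (\<alpha> t (psi u1 v1 t q) - \<alpha> t (psi u2 v2 t q)) +
          (\<Sum>i\<in>UNIV. (v1 t q $ i) *\<^sub>R B i t (psi u1 v1 t q) - (v2 t q $ i) *\<^sub>R B i t (psi u2 v2 t q)) +
          (\<Sum>i\<in>UNIV. \<Sum>j\<in>UNIV. (v1 t q $ i * v1 t q $ j) *\<^sub>R C i j t (psi u1 v1 t q) - (v2 t q $ i * v2 t q $ j) *\<^sub>R C i j t (psi u2 v2 t q)))"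
        unfolding N_def by (intro reg_add reg_sum F2 \<alpha> lin_term(1) quad_term(1) B C)
      then have "reg T (\<lambda>t. E0 * a t * D t + N * (P * (E0 * b t * (dv t + w t * D t))) +
          N * (N * (P * (E0 * K * (P * (2 * (w t * dv t)) + P * (w t * w t) * D t)))))
        (\<lambda>t q. GV t (psi u1 v1 t q) - GV t (psi u2 v2 t q))"
        by (simp add: eqV sum_subtractf algebra_simps)
      then show ?thesis
      proof (rule reg_mono)
        fix t assume t: "T \<le> t"
        note nn = nonneg[OF t]
        have "E0 * (a t * D t) \<le> E * (a t * D t)" using nn le by (intro scale) auto
        moreover have "N * P * E0 * (b t * (dv t + w t * D t)) \<le> E * (b t * (dv t + w t * D t))"
          using nn le by (intro scale) auto
        moreover have "N * N * P * E0 * (2 * P) * (K * (w t * dv t)) \<le> E * (K * (w t * dv t))"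
          using nn le K by (intro scale) auto
        moreover have "N * N * P * E0 * P * (K * (w t * w t * D t)) \<le> E * (K * (w t * w t * D t))"
          using nn le K by (intro scale) auto
        ultimately show "E0 * a t * D t + N * (P * (E0 * b t * (dv t + w t * D t))) +
          N * (N * (P * (E0 * K * (P * (2 * (w t * dv t)) + P * (w t * w t) * D t))))
            \<le> E * (a t * (du t + dv t) + b t * (dv t + w t * (du t + dv t)) + K * (w t * dv t + w t * w t * (du t + dv t)))"
          unfolding Dt by (simp add: distrib_left mult.assoc mult.left_commute)
      qed
    qed
    show "reg T (\<lambda>t. E * (a t + b t * w t + K * (w t * w t))) (\<lambda>t q. GV t (psi u1 v1 t q))"
    proof -
      have "reg T (\<lambda>t. E0 * a t + N * (P * (E0 * b t * w t)) + N * (N * (P * (E0 * K * (P * (w t * w t))))))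
        (\<lambda>t q. GV t (psi u1 v1 t q))"
        unfolding N_def eqV by (intro reg_add reg_sum F1 \<alpha> lin_term(2) quad_term(2) B C)
      then show ?thesis
      proof (rule reg_mono)
        fix t assume t: "T \<le> t"
        note nn = nonneg[OF t]
        have "E0 * a t \<le> E * a t" using nn le by (intro scale) auto
        moreover have "N * P * E0 * (b t * w t) \<le> E * (b t * w t)" using nn le by (intro scale) auto
        moreover have "N * N * P * E0 * P * (K * (w t * w t)) \<le> E * (K * (w t * w t))" using nn le K by (intro scale) auto
        ultimately show "E0 * a t + N * (P * (E0 * b t * w t)) + N * (N * (P * (E0 * K * (P * (w t * w t)))))
            \<le> E * (a t + b t * w t + K * (w t * w t))"
          by (simp add: distrib_left mult.assoc mult.left_commute)
      qed
    qed
  qed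
qed

end


section \<open>Solution of the integral equation\<close>

text \<open>
  \<open>A\<close> and \<open>B\<close> stand for the tails \<open>aa t\<close> and \<open>bb t\<close>. Apart from \<open>K \<theta> A \<le> K \<theta> \<Lambda> b\<close>, whose smallness is due
  to \<open>\<theta>\<close>, every term on the left contains \<open>b\<close> or \<open>A \<le> \<Lambda> b\<close> and in addition a factor \<open>A\<close> or \<open>B\<close>, both at most \<open>\<epsilon>\<close>.
\<close>

lemma contraction_bound_position:
  fixes E K \<Lambda> \<theta> c \<epsilon> d b A B :: real
  assumes "0 \<le> A" "A \<le> \<Lambda> * b" "A \<le> \<epsilon>" "0 \<le> B" "B \<le> \<epsilon>" "0 \<le> \<theta>" "\<theta> \<le> 1" "0 \<le> d" "0 \<le> E" "0 \<le> K" "0 \<le> c" "0 \<le> b" "0 \<le> \<Lambda>"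
    and \<theta>: "E * K * \<Lambda> * \<theta> \<le> 1 / 4" and \<epsilon>: "2 * E * (1 + K * c * \<Lambda>) * \<epsilon> \<le> 1 / 4"
  shows "E * (b * (d * B + d * \<theta> * A) + K * (d * \<theta> * A + c * A * (d * B + d * \<theta> * A))) \<le> d / 2 * b"
proof -
  define D where "D = B + \<theta> * A"
  have "\<theta> * A \<le> 1 * \<epsilon>" using assms by (intro mult_mono) auto
  then have D: "0 \<le> D" "D \<le> 2 * \<epsilon>" using assms by (auto simp: D_def)
  have 1: "E * (b * D) \<le> E * (b * (2 * \<epsilon>))" using assms D by (intro mult_left_mono) auto
  have 2: "E * K * \<theta> * A \<le> E * K * \<theta> * (\<Lambda> * b)" using assms by (intro mult_left_mono) auto
  have 3: "E * K * c * (A * D) \<le> E * K * c * ((\<Lambda> * b) * (2 * \<epsilon>))"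
    using assms D by (intro mult_left_mono mult_mono) auto
  have 4: "E * K * \<theta> * (\<Lambda> * b) \<le> 1 / 4 * b" using mult_right_mono[OF \<theta> \<open>0 \<le> b\<close>] by (simp add: algebra_simps)
  have 5: "E * (b * (2 * \<epsilon>)) + E * K * c * ((\<Lambda> * b) * (2 * \<epsilon>)) \<le> 1 / 4 * b"
    using mult_right_mono[OF \<epsilon> \<open>0 \<le> b\<close>] by (simp add: algebra_simps)
  have "E * (b * D) + E * K * \<theta> * A + E * K * c * (A * D) \<le> 1 / 2 * b" using 1 2 3 4 5 by linarith
  from mult_left_mono[OF this \<open>0 \<le> d\<close>] show ?thesis by (simp add: D_def algebra_simps)
qed

text \<open>
  Here all terms are small compared with \<open>a\<close>: those with \<open>a\<close> contain \<open>A\<close> or \<open>B\<close>, and \<open>b A \<le> \<Lambda> a \<epsilon>\<close> as well as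
  \<open>A\<^sup>2 \<le> \<Lambda> b A \<le> \<Lambda>\<^sup>2 a \<epsilon>\<close>. The gain can therefore be required relative to the smaller weight \<open>\<theta> a\<close>.
\<close>

lemma contraction_bound_momentum:
  fixes E K \<Lambda> \<theta> c \<epsilon> d a b A B :: real
  assumes "0 \<le> A" "A \<le> \<Lambda> * b" "A \<le> \<epsilon>" "0 \<le> B" "B \<le> \<epsilon>" "0 \<le> \<theta>" "\<theta> \<le> 1" "0 \<le> d" "0 \<le> E" "0 \<le> K" "0 \<le> c" "0 \<le> a" "0 \<le> b" "0 \<le> \<Lambda>"
    and AB: "A * b \<le> \<Lambda> * (a * B)" and half: "\<epsilon> \<le> 1 / 2"
    and \<epsilon>: "E * \<epsilon> * (2 + \<Lambda> * (1 + c) + K * \<Lambda> * \<Lambda> * (c + c * c)) \<le> \<theta> / 2"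
  shows "E * (a * (d * B + d * \<theta> * A) + b * (d * \<theta> * A + c * A * (d * B + d * \<theta> * A)) +
      K * (c * A * (d * \<theta> * A) + c * A * (c * A) * (d * B + d * \<theta> * A))) \<le> d / 2 * \<theta> * a"
proof -
  define D where "D = B + \<theta> * A"
  have "\<theta> * A \<le> 1 * \<epsilon>" using assms by (intro mult_mono) auto
  then have D: "0 \<le> D" "D \<le> 2 * \<epsilon>" "D \<le> 1" using assms by (auto simp: D_def)
  have Ab: "A * b \<le> \<Lambda> * (a * \<epsilon>)" using AB assms by (meson mult_left_mono order_trans)
  have "A * A \<le> (\<Lambda> * b) * A" using assms by (intro mult_right_mono) auto
  also have "\<dots> = \<Lambda> * (A * b)" by simp
  also have "\<dots> \<le> \<Lambda> * (\<Lambda> * (a * \<epsilon>))" using Ab assms by (intro mult_left_mono) auto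
  finally have AA: "A * A \<le> \<Lambda> * (\<Lambda> * (a * \<epsilon>))" .
  have \<theta>D: "\<theta> + c * D \<le> 1 + c" "c * \<theta> + c * c * D \<le> c + c * c" "0 \<le> \<theta> + c * D" "0 \<le> c * \<theta> + c * c * D"
    using assms D mult_left_mono[of D 1 c] mult_left_mono[of \<theta> 1 c] mult_left_mono[of D 1 "c * c"] by auto
  have 1: "a * D \<le> a * (2 * \<epsilon>)" using assms D by (intro mult_left_mono) auto
  have 2: "(A * b) * (\<theta> + c * D) \<le> (\<Lambda> * (a * \<epsilon>)) * (1 + c)" by (rule mult_mono) (use Ab \<theta>D assms in auto)
  have "K * (A * A) * (c * \<theta> + c * c * D) \<le> K * (\<Lambda> * (\<Lambda> * (a * \<epsilon>))) * (c + c * c)"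
    by (rule mult_mono[OF mult_left_mono[OF AA]]) (use \<theta>D assms in auto)
  with 1 2 have "a * D + (A * b) * (\<theta> + c * D) + K * (A * A) * (c * \<theta> + c * c * D)
      \<le> a * (2 * \<epsilon>) + (\<Lambda> * (a * \<epsilon>)) * (1 + c) + K * (\<Lambda> * (\<Lambda> * (a * \<epsilon>))) * (c + c * c)" by linarith
  from mult_left_mono[OF this \<open>0 \<le> E\<close>]
  have "E * (a * D + (A * b) * (\<theta> + c * D) + K * (A * A) * (c * \<theta> + c * c * D))
      \<le> (E * \<epsilon> * (2 + \<Lambda> * (1 + c) + K * \<Lambda> * \<Lambda> * (c + c * c))) * a" by (simp add: algebra_simps)
  also have "\<dots> \<le> \<theta> / 2 * a" using \<epsilon> \<open>0 \<le> a\<close> by (rule mult_right_mono)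
  finally have "E * (a * D + (A * b) * (\<theta> + c * D) + K * (A * A) * (c * \<theta> + c * c * D)) \<le> \<theta> / 2 * a" .
  from mult_left_mono[OF this \<open>0 \<le> d\<close>] show ?thesis by (simp add: D_def algebra_simps)
qed

lemma tail_antimono:
  fixes g :: "real \<Rightarrow> real"
  assumes g: "g absolutely_integrable_on {0..}" "\<forall>t\<ge>0. 0 < g t" and st: "0 \<le> s" "s \<le> t"
  shows "integral {t..} g \<le> integral {s..} g" and "0 \<le> integral {t..} g"
proof -
  have "g absolutely_integrable_on {s..t}" by (rule set_integrable_subset[OF g(1)]) (use st in auto)
  then have "g integrable_on {s..t}" by (rule set_lebesgue_integral_eq_integral(1))
  then have "0 \<le> integral {s..t} g" using g(2) st by (intro integral_nonneg) (auto intro: less_imp_le)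
  then show "integral {t..} g \<le> integral {s..} g" using integral_tail_split[OF g(1) st] by simp
  have "g absolutely_integrable_on {t..}" by (rule absolutely_integrable_tail[OF g(1)]) (use st in simp)
  then have "g integrable_on {t..}" by (rule set_lebesgue_integral_eq_integral(1))
  then show "0 \<le> integral {t..} g" using g(2) st by (intro integral_nonneg) (auto intro: less_imp_le)
qed

context kam_field
begin

text \<open>
  A displaced linear flow is a trajectory that approaches the linear flow if and only if the
  displacement is a fixed point of \<open>(TU, TV)\<close>.
\<close>

definition TU :: "(real \<Rightarrow> real ^ 'n \<Rightarrow> real ^ 'n) \<Rightarrow> (real \<Rightarrow> real ^ 'n \<Rightarrow> real ^ 'n)
    \<Rightarrow> real \<Rightarrow> real ^ 'n \<Rightarrow> real ^ 'n" where
  "TU u v t q = - integral {t..} (\<lambda>s. GU s (psi u v s q))"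

definition TV :: "(real \<Rightarrow> real ^ 'n \<Rightarrow> real ^ 'n) \<Rightarrow> (real \<Rightarrow> real ^ 'n \<Rightarrow> real ^ 'n)
    \<Rightarrow> real \<Rightarrow> real ^ 'n \<Rightarrow> real ^ 'n" where
  "TV u v t q = - integral {t..} (\<lambda>s. GV s (psi u v s q))"

abbreviation "aa t \<equiv> integral {t..} a"
abbreviation "bb t \<equiv> integral {t..} b"

lemma reg_tail_integral:
  assumes g: "g absolutely_integrable_on {0..}" "antimono_on {0..} g"
    and T: "0 \<le> T" and m: "0 \<le> m" and f: "reg T (\<lambda>t. m * g t) (f :: real \<Rightarrow> real ^ 'n \<Rightarrow> real ^ 'n)"
  shows "reg T (\<lambda>t. m * integral {t..} g) (\<lambda>t q. integral {t..} (\<lambda>s. f s q))"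
    and "T \<le> t \<Longrightarrow> (\<lambda>s. f s q) integrable_on {t..}"
proof -
  have gT: "(\<lambda>t. m * g t) absolutely_integrable_on {T..}"
    using absolutely_integrable_tail[OF g(1) T] by (rule set_integrable_mult_right)
  have "reg T (\<lambda>t. integral {t..} (\<lambda>t. m * g t)) (\<lambda>t q. integral {t..} (\<lambda>s. f s q))"
    unfolding reg_def
    by (rule hfam_tail_integral[OF f[unfolded reg_def] gT, of "m * g T"]) (use T m in \<open>auto intro!: mult_left_mono monotone_onD[OF g(2)]\<close>)
  then show "reg T (\<lambda>t. m * integral {t..} g) (\<lambda>t q. integral {t..} (\<lambda>s. f s q))" by simp
  show "(\<lambda>s. f s q) integrable_on {t..}" if "T \<le> t"
    using hfam_tail_integrable(1)[OF f[unfolded reg_def] gT that] set_lebesgue_integral_eq_integral(1) by blast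
qed

lemma a_pos: "\<forall>t\<ge>0. 0 < a t" and b_pos: "\<forall>t\<ge>0. 0 < b t"
  and a_anti: "antimono_on {0..} a" and b_anti: "antimono_on {0..} b"
  using a b by (auto simp: monotone_on_def)

lemma reg_minus: "reg T M f \<Longrightarrow> reg T M (\<lambda>t q. - f t q)"
  unfolding reg_def by (rule hfam_minus[OF open_UNIV])

text \<open>
  Picard iteration in the norms weighted by \<open>bb\<close> and \<open>aa\<close>. The influence of \<open>v\<close> on \<open>u\<close> is of size \<open>aa\<close>,
  which the first hypothesis on \<open>a\<close>, \<open>b\<close> bounds by a multiple of \<open>b\<close>. This is not small, and is compensated
  by a factor \<open>\<theta>\<close> in the weight of \<open>v\<close>. All other contributions are small for large times, the
  quadratic and mixed ones in the equation for \<open>v\<close> because the second hypothesis makes \<open>b aa\<close>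
  negligible against \<open>a\<close>.
\<close>

theorem asymptotic_solution:
  assumes \<upsilon>: "0 \<le> \<upsilon>" and \<Lambda>: "1 \<le> \<Lambda>"
    and ab: "\<And>t. \<upsilon> \<le> t \<Longrightarrow> aa t \<le> \<Lambda> * b t" "\<And>t. \<upsilon> \<le> t \<Longrightarrow> aa t * b t \<le> \<Lambda> * (a t * bb t)"
    and per: "\<And>t q p m. 0 \<le> t \<Longrightarrow> norm p < r \<Longrightarrow> m \<in> int_lattice \<Longrightarrow> GU t (q + m, p) = GU t (q, p)"
      "\<And>t q p m. 0 \<le> t \<Longrightarrow> norm p < r \<Longrightarrow> m \<in> int_lattice \<Longrightarrow> GV t (q + m, p) = GV t (q, p)"
  shows "\<exists>T\<ge>\<upsilon>. \<exists>u v c1 c2 m1 m2. 0 \<le> c1 \<and> 0 \<le> c2 \<and> reg T (\<lambda>t. c1 * bb t) u \<and> reg T (\<lambda>t. c2 * aa t) v \<and>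
     (\<forall>t\<ge>T. c1 * bb t \<le> 1 / (2 * real CARD('n))) \<and> (\<forall>t\<ge>T. c2 * aa t \<le> 1) \<and>
     (\<forall>t\<ge>T. \<forall>q. norm (v t q) < r) \<and>
     reg T (\<lambda>t. m1 * b t) (\<lambda>t q. GU t (psi u v t q)) \<and> reg T (\<lambda>t. m2 * a t) (\<lambda>t q. GV t (psi u v t q)) \<and>
     (\<forall>t\<ge>T. \<forall>q. u t q = TU u v t q \<and> v t q = TV u v t q) \<and>
     (\<forall>t\<ge>T. \<forall>q. \<forall>m\<in>int_lattice. u t (q + m) = u t q \<and> v t (q + m) = v t q)"
proof -
  obtain E where E: "1 \<le> E" and est: "\<And>T u1 v1 u2 v2 w du dv. 0 \<le> T \<Longrightarrow> reg T (\<lambda>_. 1) u1 \<Longrightarrow> reg T (\<lambda>_. 1) u2 \<Longrightarrow>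
     reg T w v1 \<Longrightarrow> reg T w v2 \<Longrightarrow> (\<forall>t\<ge>T. w t \<le> 1) \<Longrightarrow>
     (\<forall>t\<ge>T. \<forall>q. norm (v1 t q) < r) \<Longrightarrow> (\<forall>t\<ge>T. \<forall>q. norm (v2 t q) < r) \<Longrightarrow>
     reg T du (\<lambda>t q. u1 t q - u2 t q) \<Longrightarrow> reg T dv (\<lambda>t q. v1 t q - v2 t q) \<Longrightarrow>
     reg T (\<lambda>t. E * (b t * (du t + dv t) + K * (dv t + w t * (du t + dv t))))
       (\<lambda>t q. GU t (psi u1 v1 t q) - GU t (psi u2 v2 t q)) \<and>
     reg T (\<lambda>t. E * (a t * (du t + dv t) + b t * (dv t + w t * (du t + dv t)) +
         K * (w t * dv t + w t * w t * (du t + dv t))))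
       (\<lambda>t q. GV t (psi u1 v1 t q) - GV t (psi u2 v2 t q)) \<and>
     reg T (\<lambda>t. E * (b t + K * w t)) (\<lambda>t q. GU t (psi u1 v1 t q)) \<and>
     reg T (\<lambda>t. E * (a t + b t * w t + K * (w t * w t))) (\<lambda>t q. GV t (psi u1 v1 t q))"
    using field_estimates by blast
  define N where "N = real CARD('n)"
  have N: "1 \<le> N" by (simp add: N_def Suc_leI)
  \<comment> \<open>the influence of \<open>v\<close> on \<open>u\<close> becomes a quarter of the distance of the two arguments\<close>
  define \<theta> where "\<theta> = 1 / (4 * E * K * \<Lambda>)"
  have EKL: "1 \<le> E * K * \<Lambda>" using E K \<Lambda> mult_mono[of 1 E 1 K] mult_mono[of 1 "E * K" 1 \<Lambda>] by simp
  have \<theta>: "0 < \<theta>" "\<theta> \<le> 1" "E * K * \<Lambda> * \<theta> \<le> 1 / 4"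
    using EKL E K \<Lambda> by (auto simp: \<theta>_def field_simps)
  \<comment> \<open>the first Picard step has size at most \<open>d0\<close> in the norm weighted by \<open>bb\<close> and \<open>\<theta> aa\<close>, since \<open>d0 \<theta> = E\<close>
     and \<open>E \<le> d0\<close>; the following steps are halved each time, so all iterates have size at most \<open>2 d0\<close>\<close>
  define d0 where "d0 = E / \<theta>"
  define c1 where "c1 = 2 * d0"
  define c2 where "c2 = 2 * E"
  have d0: "0 \<le> d0" "E \<le> d0" "d0 * \<theta> = E" "0 \<le> c1" "0 \<le> c2"
    using E \<theta> by (auto simp: d0_def c1_def c2_def divide_simps)
  define S where "S = 2 + \<Lambda> * (1 + c2) + K * \<Lambda> * \<Lambda> * (c2 + c2 * c2)"
  define S' where "S' = 2 * E * (1 + K * c2 * \<Lambda>)"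
  have S: "0 \<le> S" "0 \<le> S'" using E K \<Lambda> d0 by (auto simp: S_def S'_def)
  \<comment> \<open>each summand is the reciprocal of one of the smallness conditions on \<open>\<epsilon>\<close>\<close>
  define Q where "Q = 2 + 4 * S' + 2 * (E * S) / \<theta> + 2 * N * c1 + c2 + 2 * c2 / r"
  define \<epsilon> where "\<epsilon> = 1 / Q"
  have Qs: "0 \<le> 4 * S'" "0 \<le> 2 * (E * S) / \<theta>" "0 \<le> 2 * N * c1" "0 \<le> 2 * c2 / r"
    using S E \<theta> N d0 r by auto
  then have Q: "2 \<le> Q" using d0 by (simp add: Q_def)
  have small: "y * \<epsilon> \<le> 1" if "y \<le> Q" for y using that Q by (simp add: \<epsilon>_def)
  have \<epsilon>: "0 < \<epsilon>" "\<epsilon> \<le> 1 / 2" "S' * \<epsilon> \<le> 1 / 4" "E * \<epsilon> * S \<le> \<theta> / 2" "c1 * \<epsilon> \<le> 1 / (2 * N)" "c2 * \<epsilon> \<le> 1" "c2 * \<epsilon> < r"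
  proof -
    show "0 < \<epsilon>" using Q by (simp add: \<epsilon>_def)
    show "\<epsilon> \<le> 1 / 2" using small[of 2] Q by simp
    show "S' * \<epsilon> \<le> 1 / 4" using small[of "4 * S'"] Qs d0 by (simp add: Q_def)
    have "2 * (E * S) / \<theta> * \<epsilon> \<le> 1" by (rule small) (use Qs d0 in \<open>simp add: Q_def\<close>)
    then show "E * \<epsilon> * S \<le> \<theta> / 2" using \<theta>(1) by (simp add: field_simps)
    have "2 * N * c1 * \<epsilon> \<le> 1" by (rule small) (use Qs d0 in \<open>simp add: Q_def\<close>)
    then show "c1 * \<epsilon> \<le> 1 / (2 * N)" using N by (simp add: field_simps)
    show "c2 * \<epsilon> \<le> 1" by (rule small) (use Qs d0 in \<open>simp add: Q_def\<close>)
    have "2 * c2 / r * \<epsilon> \<le> 1" by (rule small) (use Qs d0 in \<open>simp add: Q_def\<close>)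
    then have "2 * (c2 * \<epsilon>) \<le> r" using r by (simp add: field_simps)
    then show "c2 * \<epsilon> < r" using r by linarith
  qed
  have "((\<lambda>t. aa t) \<longlongrightarrow> 0) at_top" "((\<lambda>t. bb t) \<longlongrightarrow> 0) at_top"
    using tail_integral_tendsto_0[OF a(3)] tail_integral_tendsto_0[OF b(3)] by auto
  then have "\<forall>\<^sub>F t in at_top. aa t < \<epsilon>" "\<forall>\<^sub>F t in at_top. bb t < \<epsilon>"
    using \<epsilon>(1) by (auto dest: order_tendstoD(2))
  then have "\<forall>\<^sub>F t in at_top. aa t < \<epsilon> \<and> bb t < \<epsilon> \<and> \<upsilon> \<le> t"
    using eventually_ge_at_top[of \<upsilon>] by eventually_elim auto
  then obtain T where T: "aa T < \<epsilon>" "bb T < \<epsilon>" "\<upsilon> \<le> T" by (auto dest: eventually_happens)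
  have T0: "0 \<le> T" using T \<upsilon> by linarith
  have AB: "0 \<le> aa t" "aa t \<le> \<epsilon>" "0 \<le> bb t" "bb t \<le> \<epsilon>" "aa t \<le> \<Lambda> * b t" "aa t * b t \<le> \<Lambda> * (a t * bb t)" "0 \<le> a t" "0 \<le> b t"
    if t: "T \<le> t" for t
    using tail_antimono[OF a(3) a_pos T0 t] tail_antimono[OF b(3) b_pos T0 t] ab[of t] a(1)[of t] b(1)[of t] T T0 t by auto
  have N\<epsilon>: "1 / (2 * N) \<le> 1" using N by simp
  have ball_u: "reg T (\<lambda>_. 1) u" if "reg T (\<lambda>t. c1 * bb t) u" for u :: "real \<Rightarrow> real ^ 'n \<Rightarrow> real ^ 'n"
    using that
  proof (rule reg_mono)
    fix t assume "T \<le> t"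
    then have "c1 * bb t \<le> c1 * \<epsilon>" using d0 AB by (intro mult_left_mono) auto
    then show "c1 * bb t \<le> 1" using \<epsilon>(5) N\<epsilon> by linarith
  qed
  have c2aa: "c2 * aa t \<le> c2 * \<epsilon>" if "T \<le> t" for t using d0 AB[OF that] by (intro mult_left_mono) auto
  have w1: "\<forall>t\<ge>T. c2 * aa t \<le> 1" using c2aa \<epsilon>(6) by fastforce
  have vr: "\<forall>t\<ge>T. \<forall>q. norm (v t q) < r" if "reg T (\<lambda>t. c2 * aa t) v" for v :: "real \<Rightarrow> real ^ 'n \<Rightarrow> real ^ 'n"
  proof (intro allI impI)
    fix t q assume t: "T \<le> t"
    have "norm (v t q) \<le> c2 * aa t" using hfam_bound[OF that[unfolded reg_def], of t q] t by simp
    then show "norm (v t q) < r" using c2aa[OF t] \<epsilon>(7) by linarith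
  qed
  define m1 where "m1 = E * (1 + K * c2 * \<Lambda>)"
  define m2 where "m2 = E * (1 + c2 * \<Lambda> + K * c2 * c2 * \<Lambda> * \<Lambda>)"
  have m: "0 \<le> m1" "0 \<le> m2" using E K d0 \<Lambda> by (auto simp: m1_def m2_def)
  have zero: "reg T (\<lambda>t. 0) (\<lambda>t q. f t q - f t q)" for f :: "real \<Rightarrow> real ^ 'n \<Rightarrow> real ^ 'n"
    unfolding reg_def by (simp add: hfam_const del: hfam.simps)
  have fieldb: "reg T (\<lambda>t. m1 * b t) (\<lambda>t q. GU t (psi u v t q))" "reg T (\<lambda>t. m2 * a t) (\<lambda>t q. GV t (psi u v t q))"
    if u: "reg T (\<lambda>t. c1 * bb t) u" and v: "reg T (\<lambda>t. c2 * aa t) v" for u v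
  proof -
    note e = est[OF T0 ball_u[OF u] ball_u[OF u] v v w1 vr[OF v] vr[OF v] zero zero]
    have "reg T (\<lambda>t. E * (b t + K * (c2 * aa t))) (\<lambda>t q. GU t (psi u v t q))" using e by blast
    then show "reg T (\<lambda>t. m1 * b t) (\<lambda>t q. GU t (psi u v t q))"
    proof (rule reg_mono)
      fix t assume t: "T \<le> t"
      have "K * c2 * aa t \<le> K * c2 * (\<Lambda> * b t)" using AB[OF t] K d0 by (intro mult_left_mono) auto
      then have "E * (b t + K * c2 * aa t) \<le> E * (b t + K * c2 * (\<Lambda> * b t))" using E by (intro mult_left_mono) auto
      then show "E * (b t + K * (c2 * aa t)) \<le> m1 * b t" by (simp add: m1_def algebra_simps)
    qed
    have "reg T (\<lambda>t. E * (a t + b t * (c2 * aa t) + K * (c2 * aa t * (c2 * aa t)))) (\<lambda>t q. GV t (psi u v t q))" using e by blast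
    then show "reg T (\<lambda>t. m2 * a t) (\<lambda>t q. GV t (psi u v t q))"
    proof (rule reg_mono)
      fix t assume t: "T \<le> t"
      have "bb t \<le> 1" using AB[OF t] \<epsilon>(2) by linarith
      then have "a t * bb t \<le> a t * 1" using AB[OF t] by (intro mult_left_mono) auto
      then have "\<Lambda> * (a t * bb t) \<le> \<Lambda> * a t" using \<Lambda> by simp
      then have ba: "aa t * b t \<le> \<Lambda> * a t" using AB[OF t] by linarith
      have "aa t * aa t \<le> (\<Lambda> * b t) * aa t" using AB[OF t] by (intro mult_right_mono) auto
      also have "\<dots> = \<Lambda> * (aa t * b t)" by simp
      also have "\<dots> \<le> \<Lambda> * (\<Lambda> * a t)" using ba \<Lambda> by (intro mult_left_mono) auto
      finally have aa2: "aa t * aa t \<le> \<Lambda> * (\<Lambda> * a t)" .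
      have "c2 * (aa t * b t) \<le> c2 * (\<Lambda> * a t)" using ba d0 by (intro mult_left_mono) auto
      moreover have "K * c2 * c2 * (aa t * aa t) \<le> K * c2 * c2 * (\<Lambda> * (\<Lambda> * a t))"
        using aa2 d0 K by (intro mult_left_mono) auto
      ultimately have "E * (a t + c2 * (aa t * b t) + K * c2 * c2 * (aa t * aa t)) \<le> E * (a t + c2 * (\<Lambda> * a t) + K * c2 * c2 * (\<Lambda> * (\<Lambda> * a t)))"
        using E by (intro mult_left_mono) auto
      then show "E * (a t + b t * (c2 * aa t) + K * (c2 * aa t * (c2 * aa t))) \<le> m2 * a t"
        by (simp add: m2_def algebra_simps)
    qed
  qed
  note intU = reg_tail_integral(2)[OF b(3) b_anti T0 m(1) fieldb(1)]
  note intV = reg_tail_integral(2)[OF a(3) a_anti T0 m(2) fieldb(2)]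
  have contr: "reg T (\<lambda>t. d / 2 * bb t) (\<lambda>t q. TU u1 v1 t q - TU u2 v2 t q) \<and> reg T (\<lambda>t. d / 2 * \<theta> * aa t) (\<lambda>t q. TV u1 v1 t q - TV u2 v2 t q)"
    if u: "reg T (\<lambda>t. c1 * bb t) u1" "reg T (\<lambda>t. c1 * bb t) u2" and v: "reg T (\<lambda>t. c2 * aa t) v1" "reg T (\<lambda>t. c2 * aa t) v2"
      and d: "0 \<le> d" "reg T (\<lambda>t. d * bb t) (\<lambda>t q. u1 t q - u2 t q)" "reg T (\<lambda>t. d * \<theta> * aa t) (\<lambda>t q. v1 t q - v2 t q)"
    for u1 u2 v1 v2 d
  proof -
    note e = est[OF T0 ball_u[OF u(1)] ball_u[OF u(2)] v w1 vr[OF v(1)] vr[OF v(2)] d(2,3)]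
    have "reg T (\<lambda>t. d / 2 * b t) (\<lambda>t q. GU t (psi u1 v1 t q) - GU t (psi u2 v2 t q))"
      by (rule reg_mono[OF conjunct1[OF e]], rule contraction_bound_position[where \<Lambda>=\<Lambda> and \<epsilon>=\<epsilon>])
        (use AB E K \<Lambda> \<theta> \<epsilon> d0 d in \<open>auto simp: S'_def\<close>)
    from reg_minus[OF reg_tail_integral(1)[OF b(3) b_anti T0 _ this]] d(1)
    have "reg T (\<lambda>t. d / 2 * bb t) (\<lambda>t q. - integral {t..} (\<lambda>s. GU s (psi u1 v1 s q) - GU s (psi u2 v2 s q)))" by simp
    then have 1: "reg T (\<lambda>t. d / 2 * bb t) (\<lambda>t q. TU u1 v1 t q - TU u2 v2 t q)"
      unfolding reg_def by (rule hfam_cong[OF open_UNIV])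
        (use integral_diff[OF intU[OF u(1) v(1)] intU[OF u(2) v(2)]] in \<open>simp add: TU_def\<close>)
    have "reg T (\<lambda>t. d / 2 * \<theta> * a t) (\<lambda>t q. GV t (psi u1 v1 t q) - GV t (psi u2 v2 t q))"
      by (rule reg_mono[OF conjunct1[OF conjunct2[OF e]]], rule contraction_bound_momentum[where \<Lambda>=\<Lambda> and \<epsilon>=\<epsilon>])
        (use AB E K \<Lambda> \<theta> \<epsilon> d0 d in \<open>auto simp: S_def\<close>)
    from reg_minus[OF reg_tail_integral(1)[OF a(3) a_anti T0 _ this]] d(1) \<theta>
    have "reg T (\<lambda>t. d / 2 * \<theta> * aa t) (\<lambda>t q. - integral {t..} (\<lambda>s. GV s (psi u1 v1 s q) - GV s (psi u2 v2 s q)))" by simp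
    then have 2: "reg T (\<lambda>t. d / 2 * \<theta> * aa t) (\<lambda>t q. TV u1 v1 t q - TV u2 v2 t q)"
      unfolding reg_def by (rule hfam_cong[OF open_UNIV])
        (use integral_diff[OF intV[OF u(1) v(1)] intV[OF u(2) v(2)]] in \<open>simp add: TV_def\<close>)
    from 1 2 show ?thesis by blast
  qed
  define X where "X = (\<lambda>n. ((\<lambda>(u, v). (TU u v, TV u v)) ^^ n) (\<lambda>_ _. 0, \<lambda>_ _. 0))"
  define un where "un = (\<lambda>n. fst (X n))"
  define vn where "vn = (\<lambda>n. snd (X n))"
  have X0: "un 0 = (\<lambda>_ _. 0)" "vn 0 = (\<lambda>_ _. 0)" by (auto simp: un_def vn_def X_def)
  have XS: "un (Suc n) = TU (un n) (vn n)" "vn (Suc n) = TV (un n) (vn n)" for n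
    by (auto simp: un_def vn_def X_def split_beta)
  define s where "s = (\<lambda>n. \<Sum>i<n. (1 / 2 :: real) ^ i)"
  have s: "0 \<le> s n" "s n \<le> 2" for n
  proof -
    have "s n = 2 - 2 * (1 / 2) ^ n" by (induction n) (auto simp: s_def)
    then show "s n \<le> 2" by simp
    show "0 \<le> s n" by (simp add: s_def sum_nonneg)
  qed
  have in_ball: "reg T (\<lambda>t. c1 * bb t) u" "reg T (\<lambda>t. c2 * aa t) v"
    if "reg T (\<lambda>t. d0 * s n * bb t) u" "reg T (\<lambda>t. d0 * \<theta> * s n * aa t) v"
    for n and u v :: "real \<Rightarrow> real ^ 'n \<Rightarrow> real ^ 'n"
  proof -
    have "d0 * s n \<le> c1" "d0 * \<theta> * s n \<le> c2"
      using mult_left_mono[OF s(2)[of n] d0(1)] mult_left_mono[OF s(2)[of n], of E] E d0(3) by (auto simp: c1_def c2_def)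
    then show "reg T (\<lambda>t. c1 * bb t) u" "reg T (\<lambda>t. c2 * aa t) v"
      using AB by (auto intro!: reg_mono[OF that(1)] reg_mono[OF that(2)] mult_right_mono)
  qed
  have step: "reg T (\<lambda>t. d0 * s n * bb t) (un n) \<and> reg T (\<lambda>t. d0 * \<theta> * s n * aa t) (vn n) \<and>
     reg T (\<lambda>t. d0 * (1 / 2) ^ n * bb t) (\<lambda>t q. un (Suc n) t q - un n t q) \<and>
     reg T (\<lambda>t. d0 * (1 / 2) ^ n * \<theta> * aa t) (\<lambda>t q. vn (Suc n) t q - vn n t q)" for n
  proof (induction n)
    case 0
    have z: "reg T (\<lambda>t. d0 * s 0 * bb t) (un 0)" "reg T (\<lambda>t. d0 * \<theta> * s 0 * aa t) (vn 0)"
      using hfam_const[of "0::real^'n" 0] by (simp_all add: X0 s_def reg_def del: hfam.simps)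
    have z0: "reg T (\<lambda>_. 0) (vn 0)" using z(2) by (simp add: s_def)
    note zb = in_ball[OF z]
    note e = est[OF T0 ball_u[OF zb(1)] ball_u[OF zb(1)] z0 z0 _ vr[OF zb(2)] vr[OF zb(2)] zero zero]
    have "reg T (\<lambda>t. E * b t) (\<lambda>t q. GU t (psi (un 0) (vn 0) t q))" "reg T (\<lambda>t. E * a t) (\<lambda>t q. GV t (psi (un 0) (vn 0) t q))"
      using e by simp_all
    from reg_minus[OF reg_tail_integral(1)[OF b(3) b_anti T0 _ this(1)]] reg_minus[OF reg_tail_integral(1)[OF a(3) a_anti T0 _ this(2)]] E
    have "reg T (\<lambda>t. E * bb t) (un (Suc 0))" "reg T (\<lambda>t. E * aa t) (vn (Suc 0))"
      by (simp_all add: XS TU_def[abs_def] TV_def[abs_def])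
    moreover have "E * bb t \<le> d0 * bb t" if "T \<le> t" for t using d0 AB[OF that] by (intro mult_right_mono) auto
    ultimately show ?case using z d0(3) by (auto simp: X0 intro: reg_mono)
  next
    case (Suc n)
    have "reg T (\<lambda>t. d0 * s n * bb t + d0 * (1 / 2) ^ n * bb t) (\<lambda>t q. un n t q + (un (Suc n) t q - un n t q))"
      "reg T (\<lambda>t. d0 * \<theta> * s n * aa t + d0 * (1 / 2) ^ n * \<theta> * aa t) (\<lambda>t q. vn n t q + (vn (Suc n) t q - vn n t q))"
      using Suc.IH by (intro reg_add; blast)+
    then have z: "reg T (\<lambda>t. d0 * s (Suc n) * bb t) (un (Suc n))" "reg T (\<lambda>t. d0 * \<theta> * s (Suc n) * aa t) (vn (Suc n))"
      by (simp_all add: s_def algebra_simps)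
    have zn: "reg T (\<lambda>t. d0 * s n * bb t) (un n)" "reg T (\<lambda>t. d0 * \<theta> * s n * aa t) (vn n)" using Suc.IH by auto
    have "reg T (\<lambda>t. d0 * (1 / 2) ^ n / 2 * bb t) (\<lambda>t q. TU (un (Suc n)) (vn (Suc n)) t q - TU (un n) (vn n) t q) \<and>
      reg T (\<lambda>t. d0 * (1 / 2) ^ n / 2 * \<theta> * aa t) (\<lambda>t q. TV (un (Suc n)) (vn (Suc n)) t q - TV (un n) (vn n) t q)"
      by (rule contr[OF in_ball(1)[OF z] in_ball(1)[OF zn] in_ball(2)[OF z] in_ball(2)[OF zn]]) (use Suc.IH d0 in auto)
    then show ?case using z by (simp add: XS)
  qed
  have ball_n: "reg T (\<lambda>t. c1 * bb t) (un n)" "reg T (\<lambda>t. c2 * aa t) (vn n)" for n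
    using in_ball step by blast+
  define u where "u = (\<lambda>t q. \<Sum>n. un (Suc n) t q - un n t q)"
  define v where "v = (\<lambda>t q. \<Sum>n. vn (Suc n) t q - vn n t q)"
  have limit: "reg T (\<lambda>t. e * 2 * (1 / 2) ^ n * g t) (\<lambda>t q. (\<Sum>n. f (Suc n) t q - f n t q) - f n t q)"
    if g: "\<And>t. T \<le> t \<Longrightarrow> 0 \<le> g t" "\<And>t. T \<le> t \<Longrightarrow> g t \<le> \<epsilon>" and e: "0 \<le> e"
      and f: "\<And>n. reg T (\<lambda>t. e * (1 / 2) ^ n * g t) (\<lambda>t q. f (Suc n) t q - f n t q)" and f0: "f 0 = (\<lambda>_ _. 0)"
    for g e n and f :: "nat \<Rightarrow> real \<Rightarrow> real ^ 'n \<Rightarrow> real ^ 'n"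
  proof -
    have c: "(\<lambda>i. e * (1 / 2) ^ (i + n)) sums (e * 2 * (1 / 2) ^ n)"
      using sums_mult[OF geometric_sums[of "1/2 :: real"], of "e * (1 / 2) ^ n"]
      by (simp add: power_add algebra_simps)
    have "hfam (Suc k) \<mu> {T..} UNIV (\<lambda>t. (\<Sum>i. e * (1 / 2) ^ (i + n)) * g t) (\<lambda>t q. \<Sum>i. f (Suc (i + n)) t q - f (i + n) t q)"
      by (rule hfam_series[where ?M0.0=\<epsilon>]) (use g e c f in \<open>auto simp: reg_def sums_iff simp del: hfam.simps\<close>)
    then have "hfam (Suc k) \<mu> {T..} UNIV (\<lambda>t. e * 2 * (1 / 2) ^ n * g t) (\<lambda>t q. \<Sum>i. f (Suc (i + n)) t q - f (i + n) t q)"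
      using c by (simp only: sums_iff)
    then show ?thesis unfolding reg_def
    proof (rule hfam_cong[OF open_UNIV])
      fix t and q :: "real ^ 'n" assume t: "t \<in> {T..}"
      have "summable (\<lambda>n. f (Suc n) t q - f n t q)"
      proof (rule summable_comparison_test')
        show "summable (\<lambda>n. e * (1 / 2) ^ n * g t)" by (intro summable_mult2 summable_mult summable_geometric) simp
        show "norm (f (Suc n) t q - f n t q) \<le> e * (1 / 2) ^ n * g t" for n
          using hfam_bound[OF f[unfolded reg_def] t] by simp
      qed
      from suminf_split_initial_segment[OF this, of n]
      show "(\<Sum>i. f (Suc (i + n)) t q - f (i + n) t q) = (\<Sum>n. f (Suc n) t q - f n t q) - f n t q"
        using sum_lessThan_telescope[of "\<lambda>n. f n t q" n] by (simp add: f0)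
    qed
  qed
  have lu: "reg T (\<lambda>t. d0 * 2 * (1 / 2) ^ n * bb t) (\<lambda>t q. u t q - un n t q)" for n
    unfolding u_def by (rule limit) (use AB d0 step X0 in auto)
  have lv: "reg T (\<lambda>t. E * 2 * (1 / 2) ^ n * aa t) (\<lambda>t q. v t q - vn n t q)" for n
    unfolding v_def
  proof (rule limit)
    fix n
    have e: "d0 * (1 / 2) ^ n * \<theta> = E * (1 / 2) ^ n"
      unfolding d0(3)[symmetric] by (simp only: mult.commute mult.left_commute)
    have "reg T (\<lambda>t. d0 * (1 / 2) ^ n * \<theta> * aa t) (\<lambda>t q. vn (Suc n) t q - vn n t q)" using step[of n] by blast
    then show "reg T (\<lambda>t. E * (1 / 2) ^ n * aa t) (\<lambda>t q. vn (Suc n) t q - vn n t q)" unfolding e .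
  qed (use AB E X0 in auto)
  have u: "reg T (\<lambda>t. c1 * bb t) u" and v: "reg T (\<lambda>t. c2 * aa t) v"
    using lu[of 0] lv[of 0] by (simp_all add: X0 c1_def c2_def mult.commute)
  have fix1: "u t q = TU u v t q \<and> v t q = TV u v t q" if t: "T \<le> t" for t q
  proof -
    have c: "reg T (\<lambda>t. d0 * 2 * (1 / 2) ^ n / 2 * bb t) (\<lambda>t q. TU u v t q - TU (un n) (vn n) t q) \<and>
      reg T (\<lambda>t. d0 * 2 * (1 / 2) ^ n / 2 * \<theta> * aa t) (\<lambda>t q. TV u v t q - TV (un n) (vn n) t q)" for n
    proof (rule contr[OF u ball_n(1) v ball_n(2) _ lu])
      have e: "d0 * 2 * (1 / 2) ^ n * \<theta> = E * 2 * (1 / 2) ^ n"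
        unfolding d0(3)[symmetric] by (simp only: mult.commute mult.left_commute)
      show "reg T (\<lambda>t. d0 * 2 * (1 / 2) ^ n * \<theta> * aa t) (\<lambda>t q. v t q - vn n t q)" unfolding e by (rule lv)
    qed (use d0 in simp)
    have lim: "x = y" if "\<And>n. norm (x - z n) \<le> e * (1 / 2) ^ n" "\<And>n. norm (y - z n) \<le> e * (1 / 2) ^ n"
      for x y :: "real ^ 'n" and z e
    proof -
      have "norm (x - y) \<le> 2 * e * (1 / 2) ^ n" for n
        using that[of n] norm_triangle_ineq4[of "x - z n" "y - z n"] by simp
      moreover have "(\<lambda>n. 2 * e * (1 / 2) ^ n) \<longlonglongrightarrow> 2 * e * 0" by (intro tendsto_intros LIMSEQ_power_zero) simp
      ultimately have "norm (x - y) \<le> 0" by (intro LIMSEQ_le_const) auto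
      then show ?thesis by simp
    qed
    have "norm (u t q - un (Suc n) t q) \<le> d0 * \<epsilon> * (1 / 2) ^ n" "norm (TU u v t q - un (Suc n) t q) \<le> d0 * \<epsilon> * (1 / 2) ^ n"
      "norm (v t q - vn (Suc n) t q) \<le> d0 * \<epsilon> * (1 / 2) ^ n" "norm (TV u v t q - vn (Suc n) t q) \<le> d0 * \<epsilon> * (1 / 2) ^ n" for n
    proof -
      have B: "d0 * (1 / 2) ^ n * bb t \<le> d0 * \<epsilon> * (1 / 2) ^ n"
        using AB[OF t] d0 mult_left_mono[of "bb t" \<epsilon> "d0 * (1 / 2) ^ n"] by (simp add: algebra_simps)
      have A: "E * (1 / 2) ^ n * aa t \<le> d0 * \<epsilon> * (1 / 2) ^ n"
        using AB[OF t] d0 E mult_mono[of "E * (1 / 2) ^ n" "d0 * (1 / 2) ^ n" "aa t" \<epsilon>] by (simp add: algebra_simps)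
      have tI: "t \<in> {T..}" using t by simp
      have e: "d0 * (1 / 2) ^ n * \<theta> = E * (1 / 2) ^ n" using d0(3) by (simp add: mult.commute mult.left_commute)
      have B': "d0 * 2 * (1 / 2) ^ Suc n * bb t \<le> d0 * \<epsilon> * (1 / 2) ^ n" "d0 * 2 * (1 / 2) ^ n / 2 * bb t \<le> d0 * \<epsilon> * (1 / 2) ^ n"
        using B by simp_all
      have e2: "d0 * 2 * (1 / 2) ^ n / 2 * \<theta> = E * (1 / 2) ^ n" using e by simp
      have A': "E * 2 * (1 / 2) ^ Suc n * aa t \<le> d0 * \<epsilon> * (1 / 2) ^ n" "d0 * 2 * (1 / 2) ^ n / 2 * \<theta> * aa t \<le> d0 * \<epsilon> * (1 / 2) ^ n"
        unfolding e2 using A by simp_all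
      show "norm (u t q - un (Suc n) t q) \<le> d0 * \<epsilon> * (1 / 2) ^ n"
        by (rule order_trans[OF hfam_bound[OF lu[of "Suc n", unfolded reg_def] tI UNIV_I] B'(1)])
      show "norm (v t q - vn (Suc n) t q) \<le> d0 * \<epsilon> * (1 / 2) ^ n"
        by (rule order_trans[OF hfam_bound[OF lv[of "Suc n", unfolded reg_def] tI UNIV_I] A'(1)])
      show "norm (TU u v t q - un (Suc n) t q) \<le> d0 * \<epsilon> * (1 / 2) ^ n"
        unfolding XS by (rule order_trans[OF hfam_bound[OF conjunct1[OF c[of n], unfolded reg_def] tI UNIV_I] B'(2)])
      show "norm (TV u v t q - vn (Suc n) t q) \<le> d0 * \<epsilon> * (1 / 2) ^ n"
        unfolding XS by (rule order_trans[OF hfam_bound[OF conjunct2[OF c[of n], unfolded reg_def] tI UNIV_I] A'(2)])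
    qed
    then show ?thesis using lim[of "u t q" "\<lambda>n. un (Suc n) t q" "d0 * \<epsilon>" "TU u v t q"]
      lim[of "v t q" "\<lambda>n. vn (Suc n) t q" "d0 * \<epsilon>" "TV u v t q"] by blast
  qed
  have pern: "\<forall>t\<ge>T. \<forall>q. \<forall>m\<in>int_lattice. un n t (q + m) = un n t q \<and> vn n t (q + m) = vn n t q" for n
  proof (induction n)
    case 0
    show ?case by (simp add: X0)
  next
    case (Suc n)
    show ?case
    proof (intro allI impI ballI)
      fix t q m assume t: "T \<le> t" and m: "m \<in> (int_lattice :: (real ^ 'n) set)"
      have "GU s (psi (un n) (vn n) s (q + m)) = GU s (psi (un n) (vn n) s q)"
        "GV s (psi (un n) (vn n) s (q + m)) = GV s (psi (un n) (vn n) s q)" if s: "s \<in> {t..}" for s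
      proof -
        have "un n s (q + m) = un n s q" "vn n s (q + m) = vn n s q" using Suc.IH m s t by simp_all
        then have shift: "psi (un n) (vn n) s (q + m) = (fst (psi (un n) (vn n) s q) + m, vn n s q)" by (simp add: psi_def)
        have split: "psi (un n) (vn n) s q = (fst (psi (un n) (vn n) s q), vn n s q)" by (simp add: psi_def)
        have "0 \<le> s" "norm (vn n s q) < r" using vr[OF ball_n(2)] s t T0 by simp_all
        from per[OF this m, of "fst (psi (un n) (vn n) s q)"]
        show "GU s (psi (un n) (vn n) s (q + m)) = GU s (psi (un n) (vn n) s q)"
          "GV s (psi (un n) (vn n) s (q + m)) = GV s (psi (un n) (vn n) s q)"
          unfolding shift using split by metis+
      qed
      then show "un (Suc n) t (q + m) = un (Suc n) t q \<and> vn (Suc n) t (q + m) = vn (Suc n) t q"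
        unfolding XS TU_def TV_def by (auto intro!: integral_cong)
    qed
  qed
  have peru: "\<forall>t\<ge>T. \<forall>q. \<forall>m\<in>int_lattice. u t (q + m) = u t q \<and> v t (q + m) = v t q"
    using pern unfolding u_def v_def by simp
  have "\<forall>t\<ge>T. c1 * bb t \<le> 1 / (2 * real CARD('n))"
  proof (intro allI impI)
    fix t assume "T \<le> t"
    then have "c1 * bb t \<le> c1 * \<epsilon>" using d0 AB by (intro mult_left_mono) auto
    then show "c1 * bb t \<le> 1 / (2 * real CARD('n))" using \<epsilon>(5) by (simp add: N_def)
  qed
  then show ?thesis using T(3) d0(4,5) u v w1 vr[OF v] fieldb[OF u v] fix1 peru by blast
qed

end


section \<open>The asymptotic torus\<close>

lemma hfam_translate:
  fixes f :: "real \<Rightarrow> 'a::euclidean_space \<Rightarrow> 'b::real_normed_vector"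
  assumes "hfam k \<mu> I UNIV M f"
  shows "hfam k \<mu> I UNIV M (\<lambda>t q. f t (q + c))"
proof -
  have base: "hfam0 \<mu> I UNIV M (\<lambda>t q. f t (q + c))" if "hfam0 \<mu> I UNIV M f" for f :: "real \<Rightarrow> 'a \<Rightarrow> 'b"
  proof -
    have "continuous_on (I \<times> UNIV) (\<lambda>z. (\<lambda>(t, q). f t q) (fst z, snd z + c))"
      by (rule continuous_on_compose2[of "I \<times> UNIV" "\<lambda>(t, q). f t q"])
        (use that in \<open>auto simp: hfam0_def intro!: continuous_intros\<close>)
    moreover have "norm (f t (x + c) - f t (y + c)) \<le> M t * norm (x - y) powr \<mu>" if "t \<in> I" for t x y
      using \<open>hfam0 \<mu> I UNIV M f\<close> that unfolding hfam0_def by (metis UNIV_I add_diff_cancel_right)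
    ultimately show ?thesis using that by (simp add: hfam0_def split_beta)
  qed
  show ?thesis using assms
  proof (induction k arbitrary: f)
  case 0
  then show ?case by (simp add: base)
next
  case (Suc k)
  have "(\<lambda>q. f t (q + c)) differentiable (at q)" if "t \<in> I" for t q
  proof -
    have "f t differentiable (at (q + c))" using hfam_differentiable[OF Suc.prems that] by simp
    then show ?thesis using differentiable_chain_at[of "\<lambda>q. q + c" q "f t"] by (simp add: o_def)
  qed
  moreover have "hfam k \<mu> I UNIV M (\<lambda>t. partial b (\<lambda>q. f t (q + c)))" if b: "b \<in> Basis" for b
    by (rule hfam_cong[OF open_UNIV Suc.IH[OF hfam_partial[OF Suc.prems b]]]) (simp add: partial_translate)
  ultimately show ?case using Suc.prems by (simp add: base)
  qed
qed

lemma hfam_bounded_linear: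
  fixes L :: "'a::euclidean_space \<Rightarrow> 'b::real_normed_vector"
  assumes U: "open U" and \<mu>: "0 \<le> \<mu>" "\<mu> \<le> 1" and L: "bounded_linear L" and R: "\<And>x. x \<in> U \<Longrightarrow> norm (L x) \<le> R"
  shows "\<exists>M\<ge>0. hfam k \<mu> I U (\<lambda>_. M) (\<lambda>_. L)"
proof -
  interpret bounded_linear L by fact
  obtain K where K: "\<And>x. norm (L x) \<le> norm x * K" "0 \<le> K" using nonneg_bounded by blast
  define M where "M = 2 * \<bar>R\<bar> + K"
  have M: "0 \<le> M" "K \<le> M" "2 * \<bar>R\<bar> \<le> M" using K by (auto simp: M_def)
  have hold: "norm (L x - L y) \<le> M * norm (x - y) powr \<mu>" if "x \<in> U" "y \<in> U" for x y
  proof (cases "norm (x - y) \<le> 1")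
    case True
    have "norm (L x - L y) \<le> K * norm (x - y)" using K(1)[of "x - y"] by (simp add: diff mult.commute)
    also have "\<dots> \<le> M * norm (x - y) powr \<mu>"
    proof (rule mult_mono)
      show "norm (x - y) \<le> norm (x - y) powr \<mu>"
        using True \<mu> powr_mono'[of \<mu> 1 "norm (x - y)"] by (cases "x = y") auto
    qed (use M in auto)
    finally show ?thesis .
  next
    case False
    have "norm (L x - L y) \<le> M * 1" using norm_triangle_ineq4[of "L x" "L y"] R[OF that(1)] R[OF that(2)] M by linarith
    also have "\<dots> \<le> M * norm (x - y) powr \<mu>"
      using False \<mu> M by (intro mult_left_mono) (auto simp: ge_one_powr_ge_zero)
    finally show ?thesis .
  qed
  have bd: "norm (L x) \<le> M" if "x \<in> U" for x using R[OF that] M K by (simp add: M_def)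
  have cont: "continuous_on (I \<times> U) (\<lambda>z. L (snd z))" by (intro continuous_on continuous_intros)
  have p: "partial b L x = L b" for b x using has_partial_of_derivative(2)[OF has_derivative_ident] has_derivative[OF has_derivative_ident]
    by (metis has_partial_of_derivative(2))
  have h0: "hfam0 \<mu> I U (\<lambda>_. M) (\<lambda>_. L)" using hold bd cont by (simp add: hfam0_def split_beta)
  have "hfam k \<mu> I U (\<lambda>_. M) (\<lambda>_. L)"
  proof (cases k)
    case (Suc j)
    have "L differentiable (at x)" for x by (rule differentiableI[OF has_derivative[OF has_derivative_ident]])
    moreover have "hfam j \<mu> I U (\<lambda>_. M) (\<lambda>_. partial b L)" if b: "b \<in> Basis" for b
    proof -
      have "norm (L b) \<le> M" using K(1)[of b] b M by simp
      then have "hfam j \<mu> I U (\<lambda>_. M) (\<lambda>_ _. L b)" by (rule hfam_const)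
      moreover have "partial b L = (\<lambda>_. L b)" using p by auto
      ultimately show ?thesis by simp
    qed
    ultimately show ?thesis using h0 by (simp add: Suc)
  qed (use h0 in simp)
  then show ?thesis using M by blast
qed

text \<open>The full derivative in \<open>q\<close> at time \<open>t\<close>, in the direction \<open>h\<close>.\<close>

definition dq :: "(real \<Rightarrow> 'a::euclidean_space \<Rightarrow> 'b::real_normed_vector) \<Rightarrow> real \<Rightarrow> 'a \<Rightarrow> 'a \<Rightarrow> 'b" where
  "dq f t y h = (\<Sum>b\<in>Basis. (h \<bullet> b) *\<^sub>R partial b (f t) y)"

lemma dq_has_derivative: "f t differentiable (at y) \<Longrightarrow> (f t has_derivative dq f t y) (at y)"
  unfolding dq_def[abs_def] by (rule has_derivative_partials)

text \<open>
  A solution as provided by \<open>asymptotic_solution\<close>; the bound on \<open>c1 * bb t\<close> makes \<open>u\<close> a contraction.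
\<close>

locale kam_solution = kam_field \<omega> r \<mu> K k a b \<alpha> \<beta> A B C
  for \<omega> :: "real ^ 'n" and r \<mu> K k a b \<alpha> \<beta> A B C +
  fixes T c1 c2 m1 m2 :: real and u v :: "real \<Rightarrow> real ^ 'n \<Rightarrow> real ^ 'n"
  assumes T: "0 \<le> T" and c: "0 \<le> c1" "0 \<le> c2"
    and u: "reg T (\<lambda>t. c1 * bb t) u" and v: "reg T (\<lambda>t. c2 * aa t) v"
    and small: "\<And>t. T \<le> t \<Longrightarrow> c1 * bb t \<le> 1 / (2 * real CARD('n))" "\<And>t. T \<le> t \<Longrightarrow> c2 * aa t \<le> 1"
    and ball: "\<And>t q. T \<le> t \<Longrightarrow> norm (v t q) < r"
    and regU: "reg T (\<lambda>t. m1 * b t) (\<lambda>t q. GU t (psi u v t q))"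
    and regV: "reg T (\<lambda>t. m2 * a t) (\<lambda>t q. GV t (psi u v t q))"
    and sol: "\<And>t q. T \<le> t \<Longrightarrow> u t q = TU u v t q" "\<And>t q. T \<le> t \<Longrightarrow> v t q = TV u v t q"
    and per: "\<And>t q m. T \<le> t \<Longrightarrow> m \<in> int_lattice \<Longrightarrow> u t (q + m) = u t q"
      "\<And>t q m. T \<le> t \<Longrightarrow> m \<in> int_lattice \<Longrightarrow> v t (q + m) = v t q"
begin

text \<open>
  At time \<open>t\<close> the trajectory labelled \<open>q - t \<omega>\<close> is close to the point \<open>(q, 0)\<close>.
\<close>

definition phi :: "real \<Rightarrow> real ^ 'n \<Rightarrow> (real ^ 'n) \<times> (real ^ 'n)" where
  "phi t q = (q + u t (q - t *\<^sub>R \<omega>), v t (q - t *\<^sub>R \<omega>))"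

lemma phi_psi: "phi t q = psi u v t (q - t *\<^sub>R \<omega>)"
  by (simp add: phi_def psi_def)

lemma u_has_derivative: "T \<le> t \<Longrightarrow> (u t has_derivative dq u t y) (at y)"
  and v_has_derivative: "T \<le> t \<Longrightarrow> (v t has_derivative dq v t y) (at y)"
  using hfam_differentiable[OF u[unfolded reg_def]] hfam_differentiable[OF v[unfolded reg_def]]
  by (simp_all add: dq_has_derivative)

lemma psi_has_derivative:
  assumes "T \<le> t"
  shows "(psi u v t has_derivative (\<lambda>h. (h + dq u t y h, dq v t y h))) (at y)"
  unfolding psi_def[abs_def]
  using u_has_derivative[OF assms] v_has_derivative[OF assms] by (auto intro!: derivative_eq_intros)

lemma phi_has_derivative:
  assumes "T \<le> t"
  shows "(phi t has_derivative (\<lambda>h. (h + dq u t (q - t *\<^sub>R \<omega>) h, dq v t (q - t *\<^sub>R \<omega>) h))) (at q)"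
proof -
  have "((\<lambda>q. q - t *\<^sub>R \<omega>) has_derivative (\<lambda>h. h)) (at q)" by (auto intro!: derivative_eq_intros)
  from diff_chain_at[OF this psi_has_derivative[OF assms]]
  show ?thesis by (simp add: o_def phi_psi[abs_def])
qed

lemma dq_bound:
  fixes f :: "real \<Rightarrow> real ^ 'n \<Rightarrow> real ^ 'n"
  assumes "reg T M f" "T \<le> t"
  shows "norm (dq f t y h) \<le> real CARD('n) * M t * norm h"
proof -
  have "norm (dq f t y h) \<le> (\<Sum>b\<in>(Basis::(real^'n) set). norm h * M t)"
    unfolding dq_def
  proof (rule sum_norm_le)
    fix b :: "real ^ 'n" assume b: "b \<in> Basis"
    have "norm (partial b (f t) y) \<le> M t"
      using hfam_bound[OF hfam_partial[OF assms(1)[unfolded reg_def] b], of t y] assms(2) by simp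
    then show "norm ((h \<bullet> b) *\<^sub>R partial b (f t) y) \<le> norm h * M t"
      using Basis_le_norm[OF b, of h] by (simp add: mult_mono)
  qed
  then show ?thesis by (simp add: algebra_simps)
qed

lemma dq_u_half: "T \<le> t \<Longrightarrow> norm (dq u t y h) \<le> 1 / 2 * norm h"
proof -
  assume t: "T \<le> t"
  have N: "0 < real CARD('n)" by simp
  have "real CARD('n) * (c1 * bb t) \<le> real CARD('n) * (1 / (2 * real CARD('n)))"
    by (rule mult_left_mono[OF small(1)[OF t]]) simp
  then have "real CARD('n) * (c1 * bb t) \<le> 1 / 2" using N by simp
  from mult_right_mono[OF this norm_ge_zero[of h]] dq_bound[OF u t, of y h] show ?thesis by linarith
qed

text \<open>
  As \<open>u\<close> has Lipschitz constant \<open>1/2\<close>, the first component \<open>q + u\<close> is already injective modulo the lattice and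
  has an injective derivative.
\<close>

lemma phi_embedding:
  assumes \<sigma>: "nat \<lfloor>\<sigma>\<rfloor> = Suc k" "frac \<sigma> = \<mu>" and t: "T \<le> t"
  shows "torus_embedding r \<sigma> (phi t)"
  unfolding torus_embedding_def
proof (intro conjI allI ballI impI)
  show "range (phi t) \<subseteq> phase_space r" using ball[OF t] by (auto simp: phi_def phase_space_def)
next
  fix q m assume m: "m \<in> (int_lattice :: (real ^ 'n) set)"
  have eq: "(q - t *\<^sub>R \<omega>) + m = q + m - t *\<^sub>R \<omega>" by simp
  show "phi t (q + m) - phi t q \<in> phase_lattice"
    using per[OF t m, of "q - t *\<^sub>R \<omega>"] m unfolding eq by (simp add: phi_def phase_lattice_def)
next
  fix R
  have L: "bounded_linear (\<lambda>q :: real ^ 'n. (q, 0 :: real ^ 'n))"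
    by (intro bounded_linear_Pair bounded_linear_ident bounded_linear_zero)
  have "\<exists>M\<ge>0. hfam (Suc k) \<mu> {t} (ball 0 R) (\<lambda>_. M) (\<lambda>_ q :: real ^ 'n. (q, 0 :: real ^ 'n))"
    by (rule hfam_bounded_linear[OF open_ball \<mu> L, where R="max R 0"]) auto
  then obtain M where M: "0 \<le> M" "hfam (Suc k) \<mu> {t} (ball 0 R) (\<lambda>_. M) (\<lambda>_ q :: real ^ 'n. (q, 0 :: real ^ 'n))"
    by blast
  have x: "hfam (Suc k) \<mu> {t} UNIV (\<lambda>t. c1 * bb t + c2 * aa t) (\<lambda>t q. (u t q, v t q))"
    by (rule hfam_at[OF hfam_Pair[OF open_UNIV u[unfolded reg_def] v[unfolded reg_def]]]) (use t in simp)
  have x': "hfam (Suc k) \<mu> {t} (ball 0 R) (\<lambda>t. c1 * bb t + c2 * aa t) (\<lambda>s q. (u s (q + - (t *\<^sub>R \<omega>)), v s (q + - (t *\<^sub>R \<omega>))))"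
    by (rule hfam_subset_mono[OF hfam_translate[OF x, of "- (t *\<^sub>R \<omega>)"]]) auto
  have "hfam (Suc k) \<mu> {t} (ball 0 R) (\<lambda>s. M + (c1 * bb s + c2 * aa s)) (\<lambda>s q. (q, 0) + (u s (q + - (t *\<^sub>R \<omega>)), v s (q + - (t *\<^sub>R \<omega>))))"
    by (rule hfam_add[OF open_ball M(2) x'])
  then have "hfam (Suc k) \<mu> {t} (ball 0 R) (\<lambda>s. M + (c1 * bb s + c2 * aa s)) phi"
    by (rule hfam_cong[OF open_ball]) (simp add: phi_def)
  moreover have "0 \<le> M + (c1 * bb t + c2 * aa t)"
    using M(1) hfam_nonneg[OF u[unfolded reg_def], of t 0] hfam_nonneg[OF v[unfolded reg_def], of t 0] t by simp
  ultimately show "holder_on \<sigma> (ball 0 R) (phi t)"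
    using holder_on_of_hfam[of \<sigma> "{t}" "ball 0 R" "\<lambda>s. M + (c1 * bb s + c2 * aa s)" phi t]
    unfolding \<sigma> by (simp del: hfam.simps)
next
  fix q q' assume "phi t q - phi t q' \<in> phase_lattice"
  then have m: "q + u t (q - t *\<^sub>R \<omega>) - (q' + u t (q' - t *\<^sub>R \<omega>)) \<in> int_lattice" (is "?m \<in> _")
    by (simp add: phi_def phase_lattice_def)
  define p where "p = q' + ?m"
  have eq: "u t (p - t *\<^sub>R \<omega>) = u t (q' - t *\<^sub>R \<omega>)"
    using per(1)[OF t m, of "q' - t *\<^sub>R \<omega>"] by (simp add: p_def algebra_simps)
  have pq: "p - q = u t (q - t *\<^sub>R \<omega>) - u t (p - t *\<^sub>R \<omega>)" unfolding eq by (simp add: p_def)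
  have "norm (u t (q - t *\<^sub>R \<omega>) - u t (p - t *\<^sub>R \<omega>)) \<le> (1 / 2) * norm ((q - t *\<^sub>R \<omega>) - (p - t *\<^sub>R \<omega>))"
    by (rule differentiable_bound[OF convex_UNIV u_has_derivative[OF t] onorm_le[OF dq_u_half[OF t]]]) auto
  then have "norm (p - q) \<le> 1 / 2 * norm (p - q)" unfolding pq[symmetric] by (simp add: norm_minus_commute)
  then have "p = q" by simp
  then have "q - q' = ?m" by (simp add: p_def algebra_simps)
  with m show "q - q' \<in> int_lattice" by simp
next
  fix q
  have "inj (\<lambda>h. (h + dq u t (q - t *\<^sub>R \<omega>) h, dq v t (q - t *\<^sub>R \<omega>) h))"
  proof (subst linear_injective_0[OF bounded_linear.linear[OF has_derivative_bounded_linear[OF phi_has_derivative[OF t]]]], intro allI impI)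
    fix h assume "(h + dq u t (q - t *\<^sub>R \<omega>) h, dq v t (q - t *\<^sub>R \<omega>) h) = 0"
    then have "h = - dq u t (q - t *\<^sub>R \<omega>) h" by (simp add: eq_neg_iff_add_eq_0 prod_eq_iff)
    then have "norm h = norm (dq u t (q - t *\<^sub>R \<omega>) h)" by (metis norm_minus_cancel)
    then show "h = 0" using dq_u_half[OF t, of "q - t *\<^sub>R \<omega>" h] by simp
  qed
  then show "\<exists>D. (phi t has_derivative D) (at q) \<and> inj D" using phi_has_derivative[OF t] by blast
qed

lemma phi_tendsto:
  assumes \<sigma>: "nat \<lfloor>\<sigma>\<rfloor> = Suc k" "frac \<sigma> = \<mu>"
  shows "((\<lambda>t. holder_norm \<sigma> UNIV (\<lambda>q. phi t q - (q, 0))) \<longlongrightarrow> 0) at_top"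
proof (rule tendsto_sandwich[OF _ _ tendsto_const])
  show "\<forall>\<^sub>F t in at_top. holder_norm \<sigma> UNIV (\<lambda>q. phi t q - (q, 0)) \<le> ennreal (2 * (c1 * bb t + c2 * aa t))"
    using eventually_ge_at_top[of T]
  proof eventually_elim
    fix t assume t: "T \<le> t"
    have x: "hfam (Suc k) \<mu> {t} UNIV (\<lambda>t. c1 * bb t + c2 * aa t) (\<lambda>t q. (u t q, v t q))"
      by (rule hfam_at[OF hfam_Pair[OF open_UNIV u[unfolded reg_def] v[unfolded reg_def]]]) (use t in simp)
    have "hfam (Suc k) \<mu> {t} UNIV (\<lambda>t. c1 * bb t + c2 * aa t) (\<lambda>s q. phi s q - (q, 0))"
      by (rule hfam_cong[OF open_UNIV hfam_translate[OF x, of "- (t *\<^sub>R \<omega>)"]]) (simp add: phi_def)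
    moreover have "0 \<le> c1 * bb t + c2 * aa t"
      using hfam_nonneg[OF u[unfolded reg_def], of t 0] hfam_nonneg[OF v[unfolded reg_def], of t 0] t by simp
    ultimately show "holder_norm \<sigma> UNIV (\<lambda>q. phi t q - (q, 0)) \<le> ennreal (2 * (c1 * bb t + c2 * aa t))"
      using holder_norm_le_of_hfam[of \<sigma> "{t}" UNIV "\<lambda>t. c1 * bb t + c2 * aa t" "\<lambda>s q. phi s q - (q, 0)" t]
      unfolding \<sigma> by (simp del: hfam.simps)
  qed
  have "((\<lambda>t. 2 * (c1 * bb t + c2 * aa t)) \<longlongrightarrow> 2 * (c1 * 0 + c2 * 0)) at_top"
    by (intro tendsto_intros tail_integral_tendsto_0[OF a(3)] tail_integral_tendsto_0[OF b(3)])
  then show "((\<lambda>t. ennreal (2 * (c1 * bb t + c2 * aa t))) \<longlongrightarrow> 0) at_top"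
    using tendsto_ennrealI by fastforce
qed simp

text \<open>
  Since differentiation in \<open>q\<close> commutes with the tail integral, the full derivative of the solution
  satisfies the linearised equation of motion.
\<close>

lemma tail_solution:
  fixes f g :: "real \<Rightarrow> real ^ 'n \<Rightarrow> real ^ 'n"
  assumes w: "w absolutely_integrable_on {0..}" and g: "reg T (\<lambda>t. m * w t) g"
    and f: "\<And>t q. T \<le> t \<Longrightarrow> f t q = - integral {t..} (\<lambda>s. g s q)" and t: "T \<le> t"
  shows "((\<lambda>s. f s y) has_vector_derivative g t y) (at t within {T..})"
    and "((\<lambda>s. dq f s y h) has_vector_derivative dq g t y h) (at t within {T..})"
proof -
  note g' = g[unfolded reg_def]
  have wT: "(\<lambda>t. m * w t) absolutely_integrable_on {T..}"
    using absolutely_integrable_tail[OF w T] by (rule set_integrable_mult_right)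
  have tail: "((\<lambda>s. - integral {s..} (\<lambda>\<tau>. F \<tau> y)) has_vector_derivative F t y) (at t within {T..})"
    if F: "hfam j \<mu> {T..} UNIV (\<lambda>t. m * w t) F" for j and F :: "real \<Rightarrow> real ^ 'n \<Rightarrow> real ^ 'n"
    using has_vector_derivative_minus[OF tail_has_vector_derivative[OF hfam_tail_integrable(2)[OF F wT order_refl]
          hfam_tail_integrable(1)[OF F wT order_refl] t]] by simp
  show "((\<lambda>s. f s y) has_vector_derivative g t y) (at t within {T..})"
    by (rule has_vector_derivative_transform[OF _ _ tail[OF g']]) (use t f in auto)
  have pf: "partial b (f s) y = - integral {s..} (\<lambda>\<tau>. partial b (g \<tau>) y)" if s: "s \<in> {T..}" and b: "b \<in> Basis" for s b
  proof -
    have s': "T \<le> s" using s by simp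
    have "f s = (\<lambda>q. - integral {s..} (\<lambda>\<tau>. g \<tau> q))" using f[OF s'] by auto
    then have "partial b (f s) y = - partial b (\<lambda>q. integral {s..} (\<lambda>\<tau>. g \<tau> q)) y"
      using partial_linear[of uminus, OF _ differentiableI[OF tail_integral_has_derivative[OF g' wT s']]]
      by (simp add: bounded_linear_minus bounded_linear_ident)
    then show ?thesis using tail_integral_partial[OF g' wT s' b] by simp
  qed
  have "((\<lambda>s. \<Sum>b\<in>Basis. (h \<bullet> b) *\<^sub>R (- integral {s..} (\<lambda>\<tau>. partial b (g \<tau>) y))) has_vector_derivative dq g t y h) (at t within {T..})"
    unfolding dq_def
  proof (rule has_vector_derivative_sum)
    fix b :: "real ^ 'n" assume "b \<in> Basis"
    then show "((\<lambda>s. (h \<bullet> b) *\<^sub>R (- integral {s..} (\<lambda>\<tau>. partial b (g \<tau>) y))) has_vector_derivative (h \<bullet> b) *\<^sub>R partial b (g t) y) (at t within {T..})"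
      by (rule bounded_linear.has_vector_derivative[OF bounded_linear_scaleR_right tail[OF hfam_partial[OF g']]])
  qed
  then show "((\<lambda>s. dq f s y h) has_vector_derivative dq g t y h) (at t within {T..})"
    by (rule has_vector_derivative_transform[rotated 2]) (use t pf in \<open>auto simp: dq_def\<close>)
qed

lemmas u_evolution = tail_solution[OF b(3) regU sol(1)[unfolded TU_def]]
lemmas v_evolution = tail_solution[OF a(3) regV sol(2)[unfolded TV_def]]

text \<open>
  The chain rule along \<open>s \<mapsto> (s, q - s \<omega>)\<close> needs differentiability in both variables together, which follows from
  the continuity of the time derivative.
\<close>

lemma moving_derivative:
  fixes f g :: "real \<Rightarrow> real ^ 'n \<Rightarrow> real ^ 'n"
  assumes f: "\<And>t y. T \<le> t \<Longrightarrow> ((\<lambda>s. f s y) has_vector_derivative g t y) (at t within {T..})"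
    and df: "\<And>t y. T \<le> t \<Longrightarrow> (f t has_derivative dq f t y) (at y)"
    and g: "continuous_on ({T..} \<times> UNIV) (\<lambda>(t, y). g t y)" and t: "T \<le> t"
  shows "((\<lambda>s. f s (q - s *\<^sub>R \<omega>)) has_vector_derivative g t (q - t *\<^sub>R \<omega>) - dq f t (q - t *\<^sub>R \<omega>) \<omega>) (at t within {T..})"
proof -
  let ?y = "q - t *\<^sub>R \<omega>"
  interpret D: bounded_linear "dq f t ?y" by (rule has_derivative_bounded_linear[OF df[OF t]])
  have "continuous_on (UNIV \<times> {T..}) (\<lambda>z. (\<lambda>(t, y). g t y) (snd z, fst z))"
    by (rule continuous_on_compose2[OF g]) (auto intro!: continuous_intros)
  then have "continuous_on (UNIV \<times> {T..}) (\<lambda>z. blinfun_scaleR_left (g (snd z) (fst z)))"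
    by (intro bounded_linear.continuous_on[OF bounded_linear_blinfun_scaleR_left]) simp
  then have "continuous (at (?y, t) within UNIV \<times> {T..}) (\<lambda>z. blinfun_scaleR_left (g (snd z) (fst z)))"
    unfolding continuous_on_eq_continuous_within by (rule bspec) (use t in simp)
  then have "continuous (at (?y, t) within UNIV \<times> {T..}) (\<lambda>(y, s). blinfun_scaleR_left (g s y))"
    by (simp only: case_prod_unfold)
  from has_derivative_partialsI[where f="\<lambda>y s. f s y" and fy="\<lambda>y s. blinfun_scaleR_left (g s y)" and X=UNIV and Y="{T..}",
      OF has_derivative_at_withinI[OF df[OF t]] _ this]
  have F: "((\<lambda>(y, s). f s y) has_derivative (\<lambda>(ty, ts). dq f t ?y ty + ts *\<^sub>R g t ?y)) (at (?y, t) within UNIV \<times> {T..})"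
    using f t by (simp add: has_vector_derivative_def)
  have path: "((\<lambda>s. (q - s *\<^sub>R \<omega>, s)) has_derivative (\<lambda>d. (- (d *\<^sub>R \<omega>), d))) (at t within {T..})"
    by (auto intro!: derivative_eq_intros)
  have "((\<lambda>s. (\<lambda>(y, s). f s y) (q - s *\<^sub>R \<omega>, s)) has_derivative (\<lambda>d. (\<lambda>(ty, ts). dq f t ?y ty + ts *\<^sub>R g t ?y) (- (d *\<^sub>R \<omega>), d))) (at t within {T..})"
    by (rule has_derivative_in_compose[OF path has_derivative_subset[OF F]]) auto
  then show ?thesis
    by (simp add: has_vector_derivative_def D.neg D.scaleR scaleR_diff_right algebra_simps)
qed

text \<open>
  The label \<open>q - t \<omega>\<close> moves with velocity \<open>- \<omega>\<close>, and the corresponding transport term in the time derivative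
  is cancelled by the derivative of \<open>phi t\<close> along \<open>\<omega>\<close>.
\<close>

lemma phi_evolution:
  assumes t: "T \<le> t"
  shows "\<exists>d. ((\<lambda>s. phi s q) has_vector_derivative d) (at t within {T..}) \<and>
     (\<omega>, 0) + (GU t (phi t q), GV t (phi t q)) = frechet_derivative (phi t) (at q) \<omega> + d"
proof -
  let ?y = "q - t *\<^sub>R \<omega>"
  let ?d = "(GU t (psi u v t ?y) - dq u t ?y \<omega>, GV t (psi u v t ?y) - dq v t ?y \<omega>)"
  have "((\<lambda>s. (q + u s (q - s *\<^sub>R \<omega>), v s (q - s *\<^sub>R \<omega>))) has_vector_derivative (0 + (GU t (psi u v t ?y) - dq u t ?y \<omega>), GV t (psi u v t ?y) - dq v t ?y \<omega>)) (at t within {T..})"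
    by (intro has_vector_derivative_Pair has_vector_derivative_add has_vector_derivative_const
        moving_derivative u_evolution(1) v_evolution(1) u_has_derivative v_has_derivative
        hfam_continuous[OF regU[unfolded reg_def]] hfam_continuous[OF regV[unfolded reg_def]] t)
  then have "((\<lambda>s. phi s q) has_vector_derivative ?d) (at t within {T..})" by (simp add: phi_def)
  moreover have "frechet_derivative (phi t) (at q) \<omega> = (\<omega> + dq u t ?y \<omega>, dq v t ?y \<omega>)"
    using frechet_derivative_at[OF phi_has_derivative[OF t]] by (metis (no_types, lifting))
  ultimately show ?thesis by (intro exI[of _ ?d]) (simp add: phi_psi)
qed

text \<open>
  The linearised flow preserves the symplectic form because the derivative of the field is a
  Hamiltonian matrix, and the torus is asymptotic to the Lagrangian torus \<open>p = 0\<close>.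
\<close>

lemma phi_lagrangian:
  assumes sym: "\<And>t z. 0 \<le> t \<Longrightarrow> z \<in> phase_space r \<Longrightarrow> \<exists>DU DV. (GU t has_derivative DU) (at z) \<and> (GV t has_derivative DV) (at z) \<and>
      (\<forall>x y. DU x \<bullet> snd y - DV x \<bullet> fst y = DU y \<bullet> snd x - DV y \<bullet> fst x)"
    and t: "T \<le> t"
  shows "lagrangian_torus (phi t)"
proof -
  \<comment> \<open>the tangent vector of the torus at the trajectory labelled \<open>y\<close> that belongs to the direction \<open>h\<close>\<close>
  define E where "E = (\<lambda>h s y. (h + dq u s y h, dq v s y h))"
  have E': "((\<lambda>s. E h s y) has_vector_derivative (DU (E h s y), DV (E h s y))) (at s within {T..})"
    if s: "T \<le> s" and D: "(GU s has_derivative DU) (at (psi u v s y))" "(GV s has_derivative DV) (at (psi u v s y))"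
    for h s y DU DV
  proof -
    have chain: "dq (\<lambda>s q. F s (psi u v s q)) s y h = DF (E h s y)"
      if "(F s has_derivative DF) (at (psi u v s y))" for F :: "real \<Rightarrow> (real ^ 'n) \<times> (real ^ 'n) \<Rightarrow> real ^ 'n" and DF
    proof -
      have F: "((\<lambda>q. F s (psi u v s q)) has_derivative (\<lambda>h. DF (h + dq u s y h, dq v s y h))) (at y)"
        using diff_chain_at[OF psi_has_derivative[OF s] that] by (simp add: o_def)
      have "((\<lambda>q. F s (psi u v s q)) has_derivative dq (\<lambda>s q. F s (psi u v s q)) s y) (at y)"
        by (rule dq_has_derivative[where f="\<lambda>s q. F s (psi u v s q)" and t=s, OF differentiableI[OF F]])
      from has_derivative_unique[OF this F] show ?thesis by (simp add: E_def)
    qed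
    have "((\<lambda>s. (h + dq u s y h, dq v s y h)) has_vector_derivative
        (0 + dq (\<lambda>t q. GU t (psi u v t q)) s y h, dq (\<lambda>t q. GV t (psi u v t q)) s y h)) (at s within {T..})"
      by (intro has_vector_derivative_Pair has_vector_derivative_add has_vector_derivative_const u_evolution(2) v_evolution(2) s)
    then show ?thesis using chain[of GU, OF D(1)] chain[of GV, OF D(2)] by (simp add: E_def)
  qed
  have symp0: "symp (E h s y) (E h' s y) = 0" if s: "T \<le> s" for h h' s y
  proof -
    have "((\<lambda>s. symp (E h s y) (E h' s y)) has_vector_derivative 0) (at s within {T..})" if s: "T \<le> s" for s
    proof -
      have "psi u v s y \<in> phase_space r" using ball[OF s] by (simp add: psi_def phase_space_def)
      with sym[of s "psi u v s y"] s T obtain DU DV where D: "(GU s has_derivative DU) (at (psi u v s y))"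
        "(GV s has_derivative DV) (at (psi u v s y))" and S: "\<And>x y. DU x \<bullet> snd y - DV x \<bullet> fst y = DU y \<bullet> snd x - DV y \<bullet> fst x"
        by auto
      note d = E'[OF s D, unfolded has_vector_derivative_def]
      note inner = bounded_bilinear.FDERIV[OF bounded_bilinear_inner]
      have "((\<lambda>s. snd (E h s y) \<bullet> fst (E h' s y) - snd (E h' s y) \<bullet> fst (E h s y)) has_derivative
         (\<lambda>x. (snd (E h s y) \<bullet> fst (x *\<^sub>R (DU (E h' s y), DV (E h' s y))) + snd (x *\<^sub>R (DU (E h s y), DV (E h s y))) \<bullet> fst (E h' s y)) -
           (snd (E h' s y) \<bullet> fst (x *\<^sub>R (DU (E h s y), DV (E h s y))) + snd (x *\<^sub>R (DU (E h' s y), DV (E h' s y))) \<bullet> fst (E h s y)))) (at s within {T..})"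
        by (intro has_derivative_diff inner has_derivative_fst has_derivative_snd d)
      moreover have "(snd (E h s y) \<bullet> fst (x *\<^sub>R (DU (E h' s y), DV (E h' s y))) + snd (x *\<^sub>R (DU (E h s y), DV (E h s y))) \<bullet> fst (E h' s y)) -
           (snd (E h' s y) \<bullet> fst (x *\<^sub>R (DU (E h s y), DV (E h s y))) + snd (x *\<^sub>R (DU (E h' s y), DV (E h' s y))) \<bullet> fst (E h s y)) = 0" for x
      proof -
        have "(snd (E h s y) \<bullet> DU (E h' s y) + DV (E h s y) \<bullet> fst (E h' s y)) - (snd (E h' s y) \<bullet> DU (E h s y) + DV (E h' s y) \<bullet> fst (E h s y)) = 0"
          using S[of "E h s y" "E h' s y"] by (simp add: inner_commute)
        from arg_cong[OF this, of "\<lambda>z. x * z"] show ?thesis by (simp add: algebra_simps)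
      qed
      ultimately show ?thesis by (simp add: has_vector_derivative_def symp_def)
    qed
    then obtain \<kappa> where \<kappa>: "\<And>s. s \<in> {T..} \<Longrightarrow> symp (E h s y) (E h' s y) = \<kappa>"
      using has_vector_derivative_zero_constant[of "{T..}" "\<lambda>s. symp (E h s y) (E h' s y)"] by (auto simp: convex_real_interval)
    define P where "P = real CARD('n) * norm h * (2 * norm h') + real CARD('n) * norm h' * (2 * norm h)"
    have "\<bar>\<kappa>\<bar> \<le> c2 * aa s * P" if s: "T \<le> s" for s
    proof -
      have 1: "norm (h + dq u s y h) \<le> 2 * norm h" for h
        using norm_triangle_ineq[of h "dq u s y h"] dq_u_half[OF s, of y h] norm_ge_zero[of h] by linarith
      have 2: "norm (dq v s y h) \<le> real CARD('n) * (c2 * aa s) * norm h" for h using dq_bound[OF v s] .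
      have pos: "0 \<le> c2 * aa s" using hfam_nonneg[OF v[unfolded reg_def], of s 0] s by simp
      have 3: "\<bar>dq v s y h \<bullet> (h' + dq u s y h')\<bar> \<le> (real CARD('n) * (c2 * aa s) * norm h) * (2 * norm h')" for h h'
        by (rule order_trans[OF Cauchy_Schwarz_ineq2 mult_mono[OF 2 1]]) (use pos in auto)
      have "\<kappa> = dq v s y h \<bullet> (h' + dq u s y h') - dq v s y h' \<bullet> (h + dq u s y h)"
        using \<kappa>[of s] s by (simp add: symp_def E_def)
      then have "\<bar>\<kappa>\<bar> \<le> (real CARD('n) * (c2 * aa s) * norm h) * (2 * norm h') + (real CARD('n) * (c2 * aa s) * norm h') * (2 * norm h)"
        using 3[of h h'] 3[of h' h] by linarith
      also have "\<dots> = c2 * aa s * P" by (simp add: P_def algebra_simps)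
      finally show ?thesis .
    qed
    then have "\<forall>\<^sub>F s in at_top. \<bar>\<kappa>\<bar> \<le> c2 * aa s * P"
      by (rule eventually_mono[OF eventually_ge_at_top[of T]])
    moreover have "((\<lambda>s. c2 * aa s * P) \<longlongrightarrow> c2 * 0 * P) at_top"
      by (intro tendsto_intros tail_integral_tendsto_0[OF a(3)])
    ultimately have "\<bar>\<kappa>\<bar> \<le> c2 * 0 * P" by (intro tendsto_lowerbound[where F=at_top]) auto
    then show ?thesis using \<kappa>[of s] s by simp
  qed
  show ?thesis unfolding lagrangian_torus_def lagrangian_subspace_def
  proof (intro allI)
    fix q
    let ?D = "frechet_derivative (phi t) (at q)"
    have D: "?D = (\<lambda>h. E h t (q - t *\<^sub>R \<omega>))"
      using frechet_derivative_at[OF phi_has_derivative[OF t], of q] by (simp add: E_def)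
    have lin: "linear ?D"
      unfolding D E_def by (rule bounded_linear.linear[OF has_derivative_bounded_linear[OF phi_has_derivative[OF t]]])
    have inj: "inj ?D"
    proof (subst linear_injective_0[OF lin], intro allI impI)
      fix h assume "?D h = 0"
      then have "h = - dq u t (q - t *\<^sub>R \<omega>) h" by (simp add: D E_def eq_neg_iff_add_eq_0 prod_eq_iff)
      then have "norm h = norm (dq u t (q - t *\<^sub>R \<omega>) h)" by (metis norm_minus_cancel)
      then show "h = 0" using dq_u_half[OF t, of "q - t *\<^sub>R \<omega>" h] by simp
    qed
    have "dim (range ?D) = dim (UNIV :: (real ^ 'n) set)"
      by (rule dim_image_eq[OF lin]) (use inj in \<open>auto intro: inj_on_subset\<close>)
    moreover have "subspace (range ?D)" by (rule linear_subspace_image[OF lin subspace_UNIV])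
    ultimately show "subspace (range ?D) \<and> dim (range ?D) = CARD('n) \<and> (\<forall>v\<in>range ?D. \<forall>w\<in>range ?D. symp v w = 0)"
      using symp0[OF t] by (auto simp: D)
  qed
qed

end


section \<open>Taylor expansion along the fibres\<close>

lemma partial_fibre:
  "partial e (\<lambda>p. F (q, p)) p = partial (0, e) F (q, p)"
  "has_partial e (\<lambda>p. F (q, p)) p \<longleftrightarrow> has_partial (0, e) F (q, p)"
  by (simp_all add: partial_def has_partial_def)

lemma partial_base:
  "partial e (\<lambda>q. F (q, p)) q = partial (e, 0) F (q, p)"
  "has_partial e (\<lambda>q. F (q, p)) q \<longleftrightarrow> has_partial (e, 0) F (q, p)"
  by (simp_all add: partial_def has_partial_def)

lemma sum_Basis_vec:
  fixes g :: "real ^ 'n \<Rightarrow> 'b::comm_monoid_add"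
  shows "(\<Sum>b\<in>Basis. g b) = (\<Sum>i\<in>UNIV. g (axis i 1))"
proof -
  let ?A = "\<lambda>i :: 'n. axis i (1 :: real)"
  have "(Basis :: (real ^ 'n) set) = range ?A" by (auto simp: Basis_vec_def)
  moreover have "inj ?A" by (auto simp: inj_def axis_eq_axis)
  ultimately show ?thesis using sum.reindex[of ?A UNIV g] by (simp only: o_def)
qed

lemma radial_derivative:
  fixes G :: "real ^ 'n \<Rightarrow> real"
  assumes part: "\<forall>p\<in>ball 0 r. \<forall>i. has_partial (axis i 1) G p"
    and cont: "\<forall>i. continuous_on (ball 0 r) (partial (axis i 1) G)"
    and p: "p \<in> ball 0 r" and s: "s \<in> {0..1}"
  shows "((\<lambda>s. G (s *\<^sub>R p)) has_vector_derivative (\<Sum>i\<in>UNIV. p $ i * partial (axis i 1) G (s *\<^sub>R p))) (at s within {0..1})"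
    and "G differentiable (at p)"
proof -
  have diff: "G differentiable (at p)" if "p \<in> ball 0 r" for p
  proof (rule differentiable_if_continuous_partials[OF open_ball that])
    fix b :: "real ^ 'n" assume "b \<in> Basis"
    then obtain i where b: "b = axis i 1" by (auto simp: Basis_vec_def)
    show "has_partial b G y" if "y \<in> ball 0 r" for y using part that by (simp add: b)
    show "continuous_on (ball 0 r) (partial b G)" using cont by (simp add: b)
  qed
  then show "G differentiable (at p)" using p by blast
  have "norm (s *\<^sub>R p) \<le> norm p" using s by (simp add: mult_left_le_one_le)
  then have "s *\<^sub>R p \<in> ball 0 r" using p by simp
  note D = has_derivative_partials[OF diff[OF this]]
  have "((\<lambda>s. s *\<^sub>R p) has_derivative (\<lambda>d. d *\<^sub>R p)) (at s within {0..1})" by (auto intro!: derivative_eq_intros)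
  from has_derivative_compose[OF this D]
  have "((\<lambda>s. G (s *\<^sub>R p)) has_derivative (\<lambda>d. \<Sum>b\<in>Basis. (d *\<^sub>R p \<bullet> b) *\<^sub>R partial b G (s *\<^sub>R p))) (at s within {0..1})" .
  then show "((\<lambda>s. G (s *\<^sub>R p)) has_vector_derivative (\<Sum>i\<in>UNIV. p $ i * partial (axis i 1) G (s *\<^sub>R p))) (at s within {0..1})"
    by (simp add: has_vector_derivative_def sum_Basis_vec inner_axis sum_distrib_left mult.assoc)
qed

text \<open>
  Both remainders are weighted averages along the fibre, of the second derivatives only.
\<close>

lemma taylor_ball:
  fixes G :: "real ^ 'n \<Rightarrow> real"
  assumes part: "\<forall>p\<in>ball 0 r. \<forall>i. has_partial (axis i 1) G p"
    and part2: "\<And>i. \<forall>p\<in>ball 0 r. \<forall>j. has_partial (axis j 1) (partial (axis i 1) G) p"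
    and cont: "\<And>i. \<forall>j. continuous_on (ball 0 r) (partial (axis j 1) (partial (axis i 1) G))"
    and p: "p \<in> ball 0 r"
  shows "partial (axis l 1) G p = partial (axis l 1) G 0 +
      (\<Sum>i\<in>UNIV. p $ i * integral {0..1} (\<lambda>s. partial (axis i 1) (partial (axis l 1) G) (s *\<^sub>R p)))"
    and "G p = G 0 + (\<Sum>i\<in>UNIV. p $ i * partial (axis i 1) G 0) +
      (\<Sum>i\<in>UNIV. \<Sum>j\<in>UNIV. p $ i * p $ j * integral {0..1} (\<lambda>s. (1 - s) * partial (axis j 1) (partial (axis i 1) G) (s *\<^sub>R p)))"
proof -
  let ?G1 = "\<lambda>i. partial (axis i 1) G" and ?G2 = "\<lambda>i j. partial (axis j 1) (partial (axis i 1) G)"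
  note d1 = radial_derivative[of r "?G1 i" for i, OF part2 cont]
  have cont1: "continuous_on (ball 0 r) (?G1 i)" for i
  proof (rule continuous_at_imp_continuous_on, intro ballI)
    fix q :: "real ^ 'n" assume "q \<in> ball 0 r"
    then show "isCont (?G1 i) q" using d1(2)[of q 0] by (auto dest: differentiable_imp_continuous_within)
  qed
  then have "\<forall>i. continuous_on (ball 0 r) (?G1 i)" by blast
  note d0 = radial_derivative(1)[of r G, OF part this p]
  have in_ball: "s *\<^sub>R p \<in> ball 0 r" if "s \<in> {0..1}" for s
  proof -
    have "norm (s *\<^sub>R p) \<le> norm p" using that by (simp add: mult_left_le_one_le)
    then show ?thesis using p by simp
  qed
  have contG2: "continuous_on {0..1} (\<lambda>s. ?G2 i j (s *\<^sub>R p))" for i j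
    by (rule continuous_on_compose2[OF cont[THEN spec]]) (use in_ball in \<open>auto intro!: continuous_intros\<close>)
  have int2: "(\<lambda>s. c * ?G2 i j (s *\<^sub>R p)) integrable_on {0..1}"
    and int3: "(\<lambda>s. c * ((1 - s) * ?G2 i j (s *\<^sub>R p))) integrable_on {0..1}" for i j c
    by (intro integrable_continuous_real continuous_intros contG2)+
  have "((\<lambda>s. \<Sum>i\<in>UNIV. p $ i * ?G2 l i (s *\<^sub>R p)) has_integral ?G1 l (1 *\<^sub>R p) - ?G1 l (0 *\<^sub>R p)) {0..1}"
    by (rule fundamental_theorem_of_calculus) (use d1(1)[OF p] in auto)
  then have "?G1 l p - ?G1 l 0 = integral {0..1} (\<lambda>s. \<Sum>i\<in>UNIV. p $ i * ?G2 l i (s *\<^sub>R p))"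
    by (simp add: integral_unique)
  also have "\<dots> = (\<Sum>i\<in>UNIV. p $ i * integral {0..1} (\<lambda>s. ?G2 l i (s *\<^sub>R p)))"
    by (subst integral_sum) (use int2 in auto)
  finally show "?G1 l p = ?G1 l 0 + (\<Sum>i\<in>UNIV. p $ i * integral {0..1} (\<lambda>s. ?G2 l i (s *\<^sub>R p)))" by simp
  \<comment> \<open>the primitive \<open>\<phi>(s) + (1 - s) \<phi>'(s)\<close> of \<open>(1 - s) \<phi>''(s)\<close>, where \<open>\<phi>(s) = G(s p)\<close>\<close>
  let ?\<Phi> = "\<lambda>s. G (s *\<^sub>R p) + (1 - s) * (\<Sum>i\<in>UNIV. p $ i * ?G1 i (s *\<^sub>R p))"
  have "(?\<Phi> has_vector_derivative (1 - s) * (\<Sum>i\<in>UNIV. p $ i * (\<Sum>j\<in>UNIV. p $ j * ?G2 i j (s *\<^sub>R p)))) (at s within {0..1})"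
    if s: "s \<in> {0..1}" for s
  proof -
    have 1: "((\<lambda>s. \<Sum>i\<in>UNIV. p $ i * ?G1 i (s *\<^sub>R p)) has_vector_derivative (\<Sum>i\<in>UNIV. p $ i * (\<Sum>j\<in>UNIV. p $ j * ?G2 i j (s *\<^sub>R p)))) (at s within {0..1})"
      by (intro has_vector_derivative_sum has_vector_derivative_mult_right d1(1)[OF p s])
    have 2: "((\<lambda>s. 1 - s) has_vector_derivative -1) (at s within {0..1})"
      by (auto intro!: derivative_eq_intros simp flip: has_real_derivative_iff_has_vector_derivative)
    from has_vector_derivative_add[OF d0[OF s] has_vector_derivative_mult[OF 2 1]]
    show ?thesis by (simp add: algebra_simps)
  qed
  then have "((\<lambda>s. (1 - s) * (\<Sum>i\<in>UNIV. p $ i * (\<Sum>j\<in>UNIV. p $ j * ?G2 i j (s *\<^sub>R p)))) has_integral ?\<Phi> 1 - ?\<Phi> 0) {0..1}"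
    by (intro fundamental_theorem_of_calculus) auto
  then have "G p - G 0 - (\<Sum>i\<in>UNIV. p $ i * ?G1 i 0) = integral {0..1} (\<lambda>s. (1 - s) * (\<Sum>i\<in>UNIV. p $ i * (\<Sum>j\<in>UNIV. p $ j * ?G2 i j (s *\<^sub>R p))))"
    by (simp add: integral_unique algebra_simps)
  also have "\<dots> = integral {0..1} (\<lambda>s. \<Sum>i\<in>UNIV. \<Sum>j\<in>UNIV. p $ i * p $ j * ((1 - s) * ?G2 i j (s *\<^sub>R p)))"
    by (simp only: sum_distrib_left mult.assoc mult.left_commute)
  also have "\<dots> = (\<Sum>i\<in>UNIV. \<Sum>j\<in>UNIV. p $ i * p $ j * integral {0..1} (\<lambda>s. (1 - s) * ?G2 i j (s *\<^sub>R p)))"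
    using int3 by (simp add: integral_sum integrable_sum)
  finally show "G p = G 0 + (\<Sum>i\<in>UNIV. p $ i * ?G1 i 0) +
      (\<Sum>i\<in>UNIV. \<Sum>j\<in>UNIV. p $ i * p $ j * integral {0..1} (\<lambda>s. (1 - s) * ?G2 i j (s *\<^sub>R p)))" by simp
qed


section \<open>Lifting to the phase space\<close>

lemma hfam_fst:
  fixes f :: "real \<Rightarrow> 'a::euclidean_space \<Rightarrow> 'b::real_normed_vector" and V :: "('a \<times> 'c::euclidean_space) set"
  assumes V: "open V" and \<mu>: "0 \<le> \<mu>" and f: "hfam k \<mu> I UNIV M f"
  shows "hfam k \<mu> I V M (\<lambda>t x. f t (fst x))"
  using f
proof (induction k arbitrary: f)
  have base: "hfam0 \<mu> I V M (\<lambda>t x. f t (fst x))" if f: "hfam0 \<mu> I UNIV M f" for f :: "real \<Rightarrow> 'a \<Rightarrow> 'b"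
  proof -
    have "continuous_on (I \<times> V) (\<lambda>z. (\<lambda>(t, q). f t q) (fst z, fst (snd z)))"
      by (rule continuous_on_compose2[of "I \<times> UNIV" "\<lambda>(t, q). f t q"])
        (use f in \<open>auto simp: hfam0_def intro!: continuous_intros\<close>)
    moreover have "norm (f t (fst x) - f t (fst y)) \<le> M t * norm (x - y) powr \<mu>" if t: "t \<in> I" for t and x y :: "'a \<times> 'c"
    proof -
      have M: "0 \<le> M t" using f t unfolding hfam0_def by (meson UNIV_I norm_ge_zero order_trans)
      have "norm (f t (fst x) - f t (fst y)) \<le> M t * norm (fst x - fst y) powr \<mu>" using f t by (auto simp: hfam0_def)
      also have "\<dots> \<le> M t * norm (x - y) powr \<mu>"
      proof -
        have "norm (fst x - fst y) \<le> norm (x - y)" by (metis fst_diff norm_fst_le prod.collapse)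
        then show ?thesis using M \<mu> by (intro mult_left_mono powr_mono2) auto
      qed
      finally show ?thesis .
    qed
    ultimately show ?thesis using f by (simp add: hfam0_def split_beta)
  qed
  {
    case 0
    then show ?case by (simp add: base)
  next
    case (Suc k)
    have d: "((\<lambda>x. f t (fst x)) has_derivative (\<lambda>h. D (fst h))) (at x)" if "(f t has_derivative D) (at (fst x))" for t and x :: "'a \<times> 'c" and D
      using has_derivative_compose[OF has_derivative_fst[OF has_derivative_ident] that] .
    have fd: "\<exists>D. (f t has_derivative D) (at q)" if "t \<in> I" for t q
      using hfam_differentiable[OF Suc.prems that UNIV_I] by (simp add: differentiable_def)
    have "(\<lambda>x. f t (fst x)) differentiable (at x)" if "t \<in> I" for t and x :: "'a \<times> 'c"
      using fd[OF that, of "fst x"] d differentiableI by blast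
    moreover have "hfam k \<mu> I V M (\<lambda>t. partial b (\<lambda>x. f t (fst x)))" if b: "b \<in> Basis" for b :: "'a \<times> 'c"
    proof -
      have p: "partial b (\<lambda>x. f t (fst x)) x = partial (fst b) (f t) (fst x)" if "t \<in> I" for t and x :: "'a \<times> 'c"
      proof -
        obtain D where D: "(f t has_derivative D) (at (fst x))" using fd[OF \<open>t \<in> I\<close>] by blast
        show ?thesis using has_partial_of_derivative(2)[OF d[OF D]] has_partial_of_derivative(2)[OF D] by metis
      qed
      show ?thesis
      proof (cases "fst b = 0")
        case True
        have "hfam k \<mu> I V M (\<lambda>t (x :: 'a \<times> 'c). 0 :: 'b)"
          by (rule hfam_mono[OF hfam_const[of 0 0]]) (use hfam_nonneg[OF Suc.prems _ UNIV_I] in auto)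
        then show ?thesis
        proof (rule hfam_cong[OF V])
          fix t x assume "t \<in> I" "x \<in> V"
          moreover have "partial 0 (f t) (fst x) = 0" by (simp add: partial_def)
          ultimately show "0 = partial b (\<lambda>x. f t (fst x)) x" using p True by simp
        qed
      next
        case False
        then have "fst b \<in> Basis" using b by (auto simp: Basis_prod_def)
        from Suc.IH[OF hfam_partial[OF Suc.prems this]] show ?thesis
          by (rule hfam_cong[OF V]) (simp add: p)
      qed
    qed
    ultimately show ?case using Suc.prems by (simp add: base)
  }
qed

lemma hfam_vec:
  fixes f :: "'n::finite \<Rightarrow> real \<Rightarrow> 'a::euclidean_space \<Rightarrow> real"
  assumes U: "open U" and f: "\<And>l. hfam k \<mu> I U M (f l)"
  shows "hfam k \<mu> I U (\<lambda>t. real CARD('n) * M t) (\<lambda>t x. \<chi> l. f l t x)"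
proof -
  have 1: "hfam k \<mu> I U (\<lambda>t. 1 * M t) (\<lambda>t x. f l t x *\<^sub>R axis l 1 :: real ^ 'n)" for l
    by (rule hfam_linear[OF U bounded_linear_scaleR_left _ _ f]) (simp_all add: norm_axis_1)
  have "hfam k \<mu> I U (\<lambda>t. \<Sum>l\<in>(UNIV::'n set). 1 * M t) (\<lambda>t x. \<Sum>l\<in>(UNIV::'n set). f l t x *\<^sub>R axis l 1 :: real ^ 'n)"
    by (rule hfam_sum[OF U finite 1])
  moreover have "(\<Sum>l\<in>(UNIV::'n set). f l t x *\<^sub>R axis l 1 :: real ^ 'n) = (\<chi> l. f l t x)" for t x
    by (simp add: vec_eq_iff axis_def if_distrib[of "\<lambda>z. _ * z"] cong: if_cong)
  ultimately show ?thesis by simp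
qed

lemma hfam_vec_nth:
  fixes f :: "real \<Rightarrow> 'a::euclidean_space \<Rightarrow> 'b::real_normed_vector ^ 'n"
  assumes "open U" "hfam k \<mu> I U M f"
  shows "hfam k \<mu> I U M (\<lambda>t x. f t x $ i)"
proof -
  have "norm (y $ i) \<le> 1 * norm y" for y :: "'b ^ 'n" by (simp add: Finite_Cartesian_Product.norm_nth_le)
  from hfam_linear[OF assms(1) bounded_linear_vec_nth[of i] this _ assms(2)] show ?thesis by simp
qed

lemma partial_diff_of_has_partial:
  fixes f g :: "'a::real_normed_vector \<Rightarrow> 'b::real_normed_vector"
  assumes "has_partial b f x" "has_partial b g x"
  shows "partial b (\<lambda>x. f x - g x) x = partial b f x - partial b g x" and "has_partial b (\<lambda>x. f x - g x) x"
proof -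
  have "((\<lambda>s. f (x + s *\<^sub>R b)) has_vector_derivative partial b f x) (at 0)"
    "((\<lambda>s. g (x + s *\<^sub>R b)) has_vector_derivative partial b g x) (at 0)"
    using assms unfolding has_partial_def partial_def by (simp_all add: vector_derivative_works)
  from has_vector_derivative_diff[OF this]
  show "partial b (\<lambda>x. f x - g x) x = partial b f x - partial b g x" and "has_partial b (\<lambda>x. f x - g x) x"
    unfolding has_partial_def by (auto intro: differentiableI_vector simp: partial_def[of b "\<lambda>x. f x - g x"] vector_derivative_at)
qed

lemma partial_periodic:
  fixes f :: "'a::real_normed_vector \<Rightarrow> 'b::real_normed_vector"
  assumes U: "open U" "x \<in> U" and per: "periodic_on L U f" "m \<in> L"
  shows "partial b f (x + m) = partial b f x" and "has_partial b f (x + m) \<longleftrightarrow> has_partial b f x"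
  using partial_cong[OF U, of "\<lambda>y. f (y + m)" f b] per by (simp_all add: partial_translate periodic_on_def)

text \<open>
  By monotonicity \<open>g t\<close> is at most the integral of \<open>g\<close> over \<open>[t - 1, t]\<close>.
\<close>

lemma antimono_integrable_tendsto_0:
  fixes g :: "real \<Rightarrow> real"
  assumes g: "\<forall>t\<ge>0. 0 < g t" "antimono_on {0..} g" "g absolutely_integrable_on {0..}"
  shows "(g \<longlongrightarrow> 0) at_top"
proof (rule tendsto_sandwich[OF _ _ tendsto_const])
  show "\<forall>\<^sub>F t in at_top. 0 \<le> g t"
    using eventually_ge_at_top[of 0] by eventually_elim (use g(1) in \<open>auto intro: less_imp_le\<close>)
  show "\<forall>\<^sub>F t in at_top. g t \<le> integral {t - 1..} g"
    using eventually_ge_at_top[of 1]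
  proof eventually_elim
    fix t :: real assume t: "1 \<le> t"
    have "g absolutely_integrable_on {t - 1..t}" by (rule set_integrable_subset[OF g(3)]) (use t in auto)
    then have int: "g integrable_on {t - 1..t}" by (rule set_lebesgue_integral_eq_integral(1))
    have "integral {t - 1..t} (\<lambda>_. g t) \<le> integral {t - 1..t} g"
      by (rule integral_le[OF integrable_const_ivl int]) (use t in \<open>auto intro!: monotone_onD[OF g(2)]\<close>)
    then have "g t \<le> integral {t - 1..t} g" by simp
    moreover have "0 \<le> integral {t..} g" using tail_antimono(2)[OF g(3,1), of t t] t by simp
    ultimately show "g t \<le> integral {t - 1..} g" using integral_tail_split[OF g(3), of "t - 1" t] t by simp
  qed
  have "filterlim (\<lambda>t::real. -1 + t) at_top at_top" by (rule filterlim_tendsto_add_at_top[OF tendsto_const filterlim_ident])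
  from filterlim_compose[OF tail_integral_tendsto_0[OF g(3)] this]
  show "((\<lambda>t. integral {t - 1..} g) \<longlongrightarrow> 0) at_top" by simp
qed

lemma continuous_on_swap:
  assumes "continuous_on (U \<times> J) (\<lambda>(x, t). f t x)"
  shows "continuous_on (J \<times> U) (\<lambda>(t, x). f t x)"
proof -
  have "continuous_on (J \<times> U) (\<lambda>z. (\<lambda>(x, t). f t x) (snd z, fst z))"
    by (rule continuous_on_compose2[OF assms]) (auto intro!: continuous_intros)
  then show ?thesis by (simp add: split_beta)
qed


section \<open>Regularity of the vector fields\<close>

text \<open>
  From here on \<^const>\<open>hfam\<close> is handled through the rules of its calculus only.
\<close>

declare hfam.simps [simp del]

context kam_field
begin

abbreviation "V \<equiv> phase_space r"

lemma momentum_hfam: "\<exists>M\<ge>0. hfam (Suc k) \<mu> I V (\<lambda>_. M) (\<lambda>_ x :: (real ^ 'n) \<times> (real ^ 'n). snd x $ i)"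
proof (rule hfam_bounded_linear[OF open_phase_space \<mu>])
  show "bounded_linear (\<lambda>x :: (real ^ 'n) \<times> (real ^ 'n). snd x $ i)"
    by (rule bounded_linear_compose[OF bounded_linear_vec_nth bounded_linear_snd])
  show "norm (snd x $ i) \<le> r" if "x \<in> V" for x :: "(real ^ 'n) \<times> (real ^ 'n)"
    using that Finite_Cartesian_Product.norm_nth_le[of "snd x" i] by (auto simp: phase_space_def)
qed

lemma coeff_fam_at: "coeff_fam (Suc k) \<mu> V M F \<Longrightarrow> I \<subseteq> {0..} \<Longrightarrow> hfam (Suc k) \<mu> I V M F"
  unfolding coeff_fam_def by (rule hfam_subset_mono[of _ _ "{0..}" V M]) auto

lemma linear_term_hfam:
  assumes p: "\<And>i. hfam (Suc k) \<mu> {0..} V (\<lambda>_. Mp i) (\<lambda>_ x :: (real ^ 'n) \<times> (real ^ 'n). snd x $ i)"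
    and F: "\<And>i. coeff_fam (Suc k) \<mu> V M (F i)"
  shows "hfam (Suc k) \<mu> {0..} V (\<lambda>t. \<Sum>i\<in>UNIV. 2 ^ Suc (Suc k) * (Mp i * M t)) (\<lambda>t x :: (real ^ 'n) \<times> (real ^ 'n). \<Sum>i\<in>UNIV. (snd x $ i) *\<^sub>R F i t x)"
proof (rule hfam_sum[OF open_phase_space finite_class.finite_UNIV])
  fix i
  show "hfam (Suc k) \<mu> {0..} V (\<lambda>t. 2 ^ Suc (Suc k) * (Mp i * M t)) (\<lambda>t x. (snd x $ i) *\<^sub>R F i t x)"
    by (rule hfam_scaleR[OF open_phase_space p coeff_fam_at[OF F order_refl]])
qed

lemma field_hfam:
  shows "\<exists>M. hfam (Suc k) \<mu> {0..} V M GU" and "\<exists>M. hfam (Suc k) \<mu> {0..} V M GV"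
proof -
  obtain Mp where p: "\<And>i. hfam (Suc k) \<mu> {0..} V (\<lambda>_. Mp i) (\<lambda>_ x :: (real ^ 'n) \<times> (real ^ 'n). snd x $ i)"
    using momentum_hfam by metis
  show "\<exists>M. hfam (Suc k) \<mu> {0..} V M GU"
    unfolding GU_def[abs_def]
    by (rule exI, rule hfam_add[OF open_phase_space coeff_fam_at[OF \<beta> order_refl] linear_term_hfam[OF p A]])
  have quad: "hfam (Suc k) \<mu> {0..} V (\<lambda>t. \<Sum>i\<in>UNIV. \<Sum>j\<in>UNIV. 2 ^ Suc (Suc k) * (2 ^ Suc (Suc k) * (Mp i * Mp j) * K))
      (\<lambda>t x. \<Sum>i\<in>UNIV. \<Sum>j\<in>UNIV. (snd x $ i * snd x $ j) *\<^sub>R C i j t x)"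
  proof (rule hfam_sum[OF open_phase_space finite_class.finite_UNIV], rule hfam_sum[OF open_phase_space finite_class.finite_UNIV])
    fix i j
    have "hfam (Suc k) \<mu> {0..} V (\<lambda>_. 2 ^ Suc (Suc k) * (Mp i * Mp j)) (\<lambda>_ x :: (real ^ 'n) \<times> (real ^ 'n). snd x $ i *\<^sub>R snd x $ j)"
      by (rule hfam_scaleR[OF open_phase_space p p])
    then have pp: "hfam (Suc k) \<mu> {0..} V (\<lambda>_. 2 ^ Suc (Suc k) * (Mp i * Mp j)) (\<lambda>_ x :: (real ^ 'n) \<times> (real ^ 'n). snd x $ i * snd x $ j)"
      by simp
    show "hfam (Suc k) \<mu> {0..} V (\<lambda>t. 2 ^ Suc (Suc k) * (2 ^ Suc (Suc k) * (Mp i * Mp j) * K))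
      (\<lambda>t x. (snd x $ i * snd x $ j) *\<^sub>R C i j t x)"
      by (rule hfam_scaleR[OF open_phase_space pp coeff_fam_at[OF C order_refl]])
  qed
  show "\<exists>M. hfam (Suc k) \<mu> {0..} V M GV"
    unfolding GV_def[abs_def]
    by (rule exI, rule hfam_add[OF open_phase_space hfam_add[OF open_phase_space coeff_fam_at[OF \<alpha> order_refl] linear_term_hfam[OF p B]] quad])
qed

text \<open>
  This is the difference of the fields of the perturbed and the unperturbed Hamiltonian; each term
  carries a coefficient of size \<open>a\<close> or \<open>b\<close>, and both functions tend to 0.
\<close>

lemma perturbation_hfam:
  "\<exists>M. (M \<longlongrightarrow> 0) at_top \<and> hfam (Suc k) \<mu> {0..} V M (\<lambda>t x. (\<beta> t x, \<alpha> t x + (\<Sum>i\<in>UNIV. (snd x $ i) *\<^sub>R B i t x)))"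
proof -
  obtain Mp where p: "\<And>i. hfam (Suc k) \<mu> {0..} V (\<lambda>_. Mp i) (\<lambda>_ x :: (real ^ 'n) \<times> (real ^ 'n). snd x $ i)"
    using momentum_hfam by metis
  let ?M = "\<lambda>t. b t + (a t + (\<Sum>i\<in>(UNIV :: 'n set). 2 ^ Suc (Suc k) * (Mp i * b t)))"
  have "hfam (Suc k) \<mu> {0..} V ?M (\<lambda>t x. (\<beta> t x, \<alpha> t x + (\<Sum>i\<in>UNIV. (snd x $ i) *\<^sub>R B i t x)))"
    by (rule hfam_Pair[OF open_phase_space coeff_fam_at[OF \<beta> order_refl]
          hfam_add[OF open_phase_space coeff_fam_at[OF \<alpha> order_refl] linear_term_hfam[OF p B]]])
  moreover have "(?M \<longlongrightarrow> 0 + (0 + (\<Sum>i\<in>(UNIV :: 'n set). 2 ^ Suc (Suc k) * (Mp i * 0)))) at_top"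
    by (intro tendsto_intros antimono_integrable_tendsto_0[OF a_pos a_anti a(3)] antimono_integrable_tendsto_0[OF b_pos b_anti b(3)])
  ultimately show ?thesis by auto
qed

end


section \<open>The Hamiltonian\<close>

lemma hfam_single:
  assumes "open U" "hfam k \<mu> {t} U M (\<lambda>_. g t)"
  shows "hfam k \<mu> {t} U M g"
  by (rule hfam_cong[OF assms]) simp

locale kam_hamiltonian =
  fixes \<omega> :: "real ^ 'n" and \<sigma> r :: real
    and a b :: "real \<Rightarrow> real"
    and H h f :: "real \<Rightarrow> (real ^ 'n) \<times> (real ^ 'n) \<Rightarrow> real"
  assumes r: "r > 0"
    and \<sigma>: "\<sigma> \<ge> 1"
    and a: "\<forall>t\<ge>0. a t > 0" "antimono_on {0..} a" "a absolutely_integrable_on {0..}"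
    and b: "\<forall>t\<ge>0. b t > 0" "antimono_on {0..} b" "b absolutely_integrable_on {0..}"
    and H: "hamiltonian r H" "\<forall>t\<ge>0. \<forall>x\<in>phase_space r. has_hess_p (H t) x"
    and H_eq: "\<forall>t\<ge>0. \<forall>x\<in>phase_space r. H t x = h t x + f t x"
    and h: "h \<in> kolmogorov_nf r \<omega>"
    and f0_space: "(\<lambda>t q. f t (q, 0)) \<in> Sbar_space 0 \<sigma> 2 int_lattice UNIV"
    and fp0: "(\<lambda>t q. grad_p (f t) (q, 0)) \<in> Sbar_space 0 \<sigma> 2 int_lattice UNIV"
    and Hpp: "(\<lambda>t. hess_p (H t)) \<in> Sbar_space 0 \<sigma> 2 phase_lattice (phase_space r)"
    and Hpp_bound: "(SUP t\<in>{0..}. holder_norm (\<sigma> + 2) (phase_space r) (hess_p (H t))) < \<infinity>"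
    and fq0_bound: "\<forall>t\<ge>0. holder_norm (\<sigma> + 1) UNIV (\<lambda>q. grad_q (f t) (q, 0)) \<le> ennreal (a t)"
    and fp0_bound: "\<forall>t\<ge>0. holder_norm (\<sigma> + 2) UNIV (\<lambda>q. grad_p (f t) (q, 0)) \<le> ennreal (b t)"
begin

abbreviation "V \<equiv> phase_space r"

text \<open>So that \<open>\<sigma> = k + 1 + \<mu>\<close>.\<close>

definition "k = nat \<lfloor>\<sigma>\<rfloor> - 1"
definition "\<mu> = frac \<sigma>"

lemma orders: "nat \<lfloor>\<sigma>\<rfloor> = Suc k" "nat \<lfloor>\<sigma> + 1\<rfloor> = Suc (Suc k)" "nat \<lfloor>\<sigma> + 2\<rfloor> = Suc (Suc (Suc k))"
  and fracs: "frac (\<sigma> + 1) = \<mu>" "frac (\<sigma> + 2) = \<mu>"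
  and \<mu>: "0 \<le> \<mu>" "\<mu> \<le> 1"
proof -
  have "1 \<le> \<lfloor>\<sigma>\<rfloor>" using \<sigma> by (simp add: le_floor_iff)
  moreover have "\<lfloor>\<sigma> + 1\<rfloor> = \<lfloor>\<sigma>\<rfloor> + 1" "\<lfloor>\<sigma> + 2\<rfloor> = \<lfloor>\<sigma>\<rfloor> + 2" by simp_all
  ultimately show "nat \<lfloor>\<sigma>\<rfloor> = Suc k" "nat \<lfloor>\<sigma> + 1\<rfloor> = Suc (Suc k)" "nat \<lfloor>\<sigma> + 2\<rfloor> = Suc (Suc (Suc k))"
    unfolding k_def by linarith+
  show "frac (\<sigma> + 1) = \<mu>" "frac (\<sigma> + 2) = \<mu>" by (auto simp: \<mu>_def frac_def)
  show "0 \<le> \<mu>" "\<mu> \<le> 1" by (auto simp: \<mu>_def frac_lt_1 less_imp_le)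
qed

definition "f0 t q = f t (q, 0)"
definition "\<alpha>0 t q = grad_q (f t) (q, 0)"
definition "\<beta>0 t q = grad_p (f t) (q, 0)"

lemma \<alpha>0_eq: "\<alpha>0 t q = (\<chi> l. partial (axis l 1) (f0 t) q)"
  unfolding \<alpha>0_def grad_q_def f0_def[abs_def] partial_base[symmetric] ..

lemma holder_family:
  fixes g :: "real \<Rightarrow> 'a::euclidean_space \<Rightarrow> 'b::euclidean_space"
  assumes "open U" "convex U" "0 \<le> M" "Ck_on (nat \<lfloor>s\<rfloor>) U (g t)" "holder_norm s U (g t) \<le> ennreal M"
  shows "hfam (nat \<lfloor>s\<rfloor>) (frac s) {t} U (\<lambda>_. (real DIM('a) + 2) * (2 * real DIM('b) * M)) g"
  by (rule hfam_single[where g=g and t=t, OF assms(1) hfam_of_holder_norm[OF assms]])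

lemma S_space_of_Sbar: "g \<in> Sbar_space \<upsilon> s m L U \<Longrightarrow> g \<in> S_space \<upsilon> (s + real m) L U"
  by (simp add: Sbar_space_def)

lemma f0_static:
  assumes "0 \<le> t"
  shows "\<exists>M. hfam (Suc (Suc (Suc k))) \<mu> {t} UNIV (\<lambda>_. M) f0"
proof -
  have "holder_on (\<sigma> + 2) UNIV (f0 t)"
    using S_space_of_Sbar[OF f0_space] assms by (simp add: S_space_def f0_def[abs_def])
  then have ck: "Ck_on (nat \<lfloor>\<sigma> + 2\<rfloor>) UNIV (f0 t)" and fin: "holder_norm (\<sigma> + 2) UNIV (f0 t) < \<infinity>" by (auto simp: holder_on_def)
  have "holder_norm (\<sigma> + 2) UNIV (f0 t) \<le> ennreal (enn2real (holder_norm (\<sigma> + 2) UNIV (f0 t)))"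
    using fin by (simp add: ennreal_enn2real_if)
  from holder_family[where g=f0, OF open_UNIV convex_UNIV enn2real_nonneg ck this]
  show ?thesis unfolding orders fracs by blast
qed

text \<open>
  A common factor for passing from the norms of the hypotheses to \<^const>\<open>hfam\<close>; the first \<open>CARD('n)\<close>
  accounts for the assembly of the components of \<open>B\<close> below.
\<close>

definition "Q = real CARD('n) * ((real CARD('n) + 2) * (2 * real CARD('n)))"

lemma Q: "(real CARD('n) + 2) * (2 * real CARD('n)) \<le> Q" "1 \<le> Q"
proof -
  have N: "1 \<le> real CARD('n)" by (simp add: Suc_leI)
  have "1 * ((real CARD('n) + 2) * (2 * real CARD('n))) \<le> Q"
    unfolding Q_def by (rule mult_right_mono[OF N]) simp
  then show le: "(real CARD('n) + 2) * (2 * real CARD('n)) \<le> Q" by simp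
  have "1 \<le> 2 * real CARD('n)" using N by linarith
  then have "1 * 1 \<le> (real CARD('n) + 2) * (2 * real CARD('n))" by (intro mult_mono) auto
  with le show "1 \<le> Q" by simp
qed

text \<open>
  The smoothness is inherited from \<open>f0\<close>, the size is the one prescribed for the gradient.
\<close>

lemma \<alpha>0_static:
  assumes t: "0 \<le> t"
  shows "hfam (Suc (Suc k)) \<mu> {t} UNIV (\<lambda>t. Q * a t) \<alpha>0"
proof -
  obtain M where M: "hfam (Suc (Suc (Suc k))) \<mu> {t} UNIV (\<lambda>_. M) f0" using f0_static[OF t] by blast
  have p: "hfam (Suc (Suc k)) \<mu> {t} UNIV (\<lambda>_. M) (\<lambda>t. partial (axis l 1) (f0 t))" for l
    by (rule hfam_partial[OF M]) (simp add: axis_in_Basis_iff)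
  have "hfam (Suc (Suc k)) \<mu> {t} UNIV (\<lambda>_. real CARD('n) * M) \<alpha>0"
    unfolding \<alpha>0_eq[abs_def] by (rule hfam_vec[OF open_UNIV]) (rule p)
  then have ck: "Ck_on (nat \<lfloor>\<sigma> + 1\<rfloor>) UNIV (\<alpha>0 t)" unfolding orders by (rule Ck_on_of_hfam) simp
  have "holder_norm (\<sigma> + 1) UNIV (\<alpha>0 t) \<le> ennreal (a t)" using fq0_bound t by (simp add: \<alpha>0_def[abs_def])
  from holder_family[where g=\<alpha>0, OF open_UNIV convex_UNIV _ ck this] a(1) t
  have "hfam (Suc (Suc k)) \<mu> {t} UNIV (\<lambda>_. (real CARD('n) + 2) * (2 * real CARD('n) * a t)) \<alpha>0"
    unfolding orders fracs by (simp add: less_imp_le)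
  then show ?thesis
  proof (rule hfam_mono)
    fix s assume "s \<in> {t}"
    then show "(real CARD('n) + 2) * (2 * real CARD('n) * a t) \<le> Q * a s"
      using mult_right_mono[OF Q(1), of "a t"] a(1) t by (simp add: mult.assoc less_imp_le)
  qed
qed

lemma \<beta>0_static:
  assumes t: "0 \<le> t"
  shows "hfam (Suc (Suc (Suc k))) \<mu> {t} UNIV (\<lambda>t. (real CARD('n) + 2) * (2 * real CARD('n)) * b t) \<beta>0"
proof -
  have "holder_on (\<sigma> + 2) UNIV (\<beta>0 t)"
    using S_space_of_Sbar[OF fp0] t by (simp add: S_space_def \<beta>0_def[abs_def])
  then have ck: "Ck_on (nat \<lfloor>\<sigma> + 2\<rfloor>) UNIV (\<beta>0 t)" by (auto simp: holder_on_def)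
  have "holder_norm (\<sigma> + 2) UNIV (\<beta>0 t) \<le> ennreal (b t)" using fp0_bound t by (simp add: \<beta>0_def[abs_def])
  from holder_family[where g=\<beta>0, OF open_UNIV convex_UNIV _ ck this] b(1) t
  have "hfam (Suc (Suc (Suc k))) \<mu> {t} UNIV (\<lambda>_. (real CARD('n) + 2) * (2 * real CARD('n) * b t)) \<beta>0"
    unfolding orders fracs by (simp add: less_imp_le)
  then show ?thesis by (rule hfam_mono) (simp add: mult.assoc)
qed

text \<open>
  The joint continuity of the gradient is part of the membership of \<open>f0\<close> in \<^const>\<open>Sbar_space\<close>; higher
  derivatives follow from \<open>hfam_joint\<close> at the cost of one order.
\<close>

lemma \<alpha>0_joint: "hfam (Suc k) \<mu> {0..} UNIV (\<lambda>t. Q * a t) \<alpha>0"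
proof (rule hfam_joint[OF open_UNIV convex_UNIV, where ?M0.0="Q * a 0"])
  show "Q * a t \<le> Q * a 0" if "t \<in> {0..}" for t
    by (rule mult_left_mono[OF monotone_onD[OF a(2)]]) (use that Q(2) in auto)
  have "continuous_on ({0..} \<times> UNIV) (\<lambda>(t, q). partial (axis l 1) (f0 t) q)" for l
  proof -
    have "\<forall>i\<le>2. \<forall>bs\<in>dirs_eq i. (\<lambda>t. partials bs (f0 t)) \<in> S_space 0 (\<sigma> + real (2 - i)) int_lattice UNIV"
      using f0_space by (simp add: Sbar_space_def f0_def[abs_def])
    from this[rule_format, of 1 "[axis l 1]"]
    have "(\<lambda>t. partials [axis l 1] (f0 t)) \<in> S_space 0 (\<sigma> + real (2 - 1)) int_lattice UNIV"
      by (simp add: dirs_eq_def axis_in_Basis_iff)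
    then have "continuous_on (UNIV \<times> {0..}) (\<lambda>(q, t). partials [axis l 1] (f0 t) q)" unfolding S_space_def by blast
    from continuous_on_swap[OF this] show ?thesis by (simp add: partials_simps)
  qed
  then show "continuous_on ({0..} \<times> UNIV) (\<lambda>(t, q). \<alpha>0 t q)"
    unfolding \<alpha>0_eq split_beta by (intro continuous_on_vec_lambda)
  show "\<forall>t\<in>{0..}. hfam (Suc (Suc k)) \<mu> {t} UNIV (\<lambda>t. Q * a t) \<alpha>0" using \<alpha>0_static by blast
qed

lemma \<beta>0_joint: "hfam (Suc (Suc k)) \<mu> {0..} UNIV (\<lambda>t. (real CARD('n) + 2) * (2 * real CARD('n)) * b t) \<beta>0"
proof (rule hfam_joint[OF open_UNIV convex_UNIV, where ?M0.0="(real CARD('n) + 2) * (2 * real CARD('n)) * b 0"])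
  show "(real CARD('n) + 2) * (2 * real CARD('n)) * b t \<le> (real CARD('n) + 2) * (2 * real CARD('n)) * b 0" if "t \<in> {0..}" for t
    by (rule mult_left_mono[OF monotone_onD[OF b(2)]]) (use that in auto)
  have "\<beta>0 \<in> S_space 0 (\<sigma> + real 2) int_lattice UNIV"
    using S_space_of_Sbar[OF fp0] unfolding \<beta>0_def[abs_def] .
  then have "continuous_on (UNIV \<times> {0..}) (\<lambda>(q, t). \<beta>0 t q)" unfolding S_space_def by blast
  then show "continuous_on ({0..} \<times> UNIV) (\<lambda>(t, q). \<beta>0 t q)" by (rule continuous_on_swap)
  show "\<forall>t\<in>{0..}. hfam (Suc (Suc (Suc k))) \<mu> {t} UNIV (\<lambda>t. (real CARD('n) + 2) * (2 * real CARD('n)) * b t) \<beta>0"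
    using \<beta>0_static by blast
qed

lemma hess_hfam:
  "\<exists>K\<ge>1. (\<forall>t\<ge>0. hfam (Suc (Suc (Suc k))) \<mu> {t} V (\<lambda>_. K) (\<lambda>t. hess_p (H t))) \<and>
     hfam (Suc (Suc k)) \<mu> {0..} V (\<lambda>_. K) (\<lambda>t. hess_p (H t))"
proof -
  define S where "S = enn2real (SUP t\<in>{0..}. holder_norm (\<sigma> + 2) V (hess_p (H t)))"
  have S: "0 \<le> S" by (simp add: S_def)
  define K where "K = max 1 ((real DIM((real ^ 'n) \<times> (real ^ 'n)) + 2) * (2 * real DIM(real ^ 'n ^ 'n) * S))"
  have static: "hfam (Suc (Suc (Suc k))) \<mu> {t} V (\<lambda>_. K) (\<lambda>t. hess_p (H t))" if t: "0 \<le> t" for t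
  proof -
    have "holder_on (\<sigma> + 2) V (hess_p (H t))" using S_space_of_Sbar[OF Hpp] t by (simp add: S_space_def)
    then have ck: "Ck_on (nat \<lfloor>\<sigma> + 2\<rfloor>) V (hess_p (H t))" by (auto simp: holder_on_def)
    have "holder_norm (\<sigma> + 2) V (hess_p (H t)) \<le> (SUP t\<in>{0..}. holder_norm (\<sigma> + 2) V (hess_p (H t)))"
      by (rule SUP_upper) (use t in simp)
    also have "\<dots> = ennreal S" unfolding S_def by (rule ennreal_enn2real[symmetric]) (use Hpp_bound in simp)
    finally have le: "holder_norm (\<sigma> + 2) V (hess_p (H t)) \<le> ennreal S" .
    show ?thesis
      using holder_family[where g="\<lambda>t. hess_p (H t)", OF open_phase_space convex_phase_space S ck le]
      unfolding orders fracs by (rule hfam_mono) (simp add: K_def)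
  qed
  have "continuous_on (V \<times> {0..}) (\<lambda>(x, t). hess_p (H t) x)"
    using S_space_of_Sbar[OF Hpp] unfolding S_space_def by blast
  note cont = continuous_on_swap[OF this]
  have "hfam (Suc (Suc k)) \<mu> {0..} V (\<lambda>_. K) (\<lambda>t. hess_p (H t))"
    by (rule hfam_joint[OF open_phase_space convex_phase_space order_refl cont]) (simp add: static)
  moreover have "1 \<le> K" by (simp add: K_def)
  ultimately show ?thesis using static by blast
qed

text \<open>
  In the expansion \<open>H = c + \<omega> \<bullet> p + f0 + \<beta>0 \<bullet> p + \<Sum> p\<^sub>i p\<^sub>j Mc i j\<close> the derivative \<open>- \<partial>\<^sub>q\<close> of the last three
  terms gives \<open>\<alpha>\<close>, \<open>B\<close> and \<open>C\<close>. The derivative \<open>\<partial>\<^sub>p H\<close> is expanded separately to first order, with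
  coefficients \<open>\<beta>\<close> and \<open>A\<close>, which avoids derivatives of \<open>Mc\<close> along the fibre. The weight 1 in \<open>A\<close> matches the
  form of \<open>hfam_fibre_average\<close>.
\<close>

definition "\<alpha> t x = - \<alpha>0 t (fst x)" for x :: "(real ^ 'n) \<times> (real ^ 'n)"
definition "\<beta> t x = \<beta>0 t (fst x)" for x :: "(real ^ 'n) \<times> (real ^ 'n)"
definition "B i t x = - (\<chi> l. partial (axis l 1) (\<beta>0 t) (fst x) $ i)" for x :: "(real ^ 'n) \<times> (real ^ 'n)"
definition "A i t x = (\<chi> l. integral {0..1} (\<lambda>s. 1 *\<^sub>R (hess_p (H t) (fst x, s *\<^sub>R snd x) $ l $ i)))"
definition "Mc i j t x = integral {0..1} (\<lambda>s. (1 - s) *\<^sub>R (hess_p (H t) (fst x, s *\<^sub>R snd x) $ i $ j))"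
definition "C i j t x = - (\<chi> l. partial (axis l 1, 0) (Mc i j t) x)"

lemma star: "x \<in> V \<Longrightarrow> s \<in> {0..1} \<Longrightarrow> (fst x, s *\<^sub>R snd x) \<in> V"
  by (auto simp: phase_space_def intro: le_less_trans[OF mult_left_le_one_le])

lemma Mc_hfam:
  assumes "hfam m \<mu> I V (\<lambda>_. K) (\<lambda>t. hess_p (H t))"
  shows "hfam m \<mu> I V (\<lambda>_. K) (Mc i j)"
  unfolding Mc_def[abs_def]
  by (rule hfam_fibre_average[OF open_phase_space star \<mu>(1), where F="\<lambda>t x. hess_p (H t) x $ i $ j"])
    (auto intro!: continuous_intros hfam_vec_nth open_phase_space assms)

text \<open>
  The hypotheses have order \<open>\<sigma> + 2\<close>, or \<open>\<sigma> + 1\<close> for \<open>\<alpha>0\<close>. One derivative is spent in \<open>B\<close> and \<open>C\<close>, which leaves the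
  order \<open>\<sigma> + 1\<close> at each time that is required of coefficients.
\<close>

lemma field_exists: "\<exists>K. kam_field r \<mu> K k (\<lambda>t. Q * a t) (\<lambda>t. Q * b t) \<alpha> \<beta> A B C"
proof -
  obtain K where K: "1 \<le> K" and hs: "\<And>t. 0 \<le> t \<Longrightarrow> hfam (Suc (Suc (Suc k))) \<mu> {t} V (\<lambda>_. K) (\<lambda>t. hess_p (H t))"
    and hj: "hfam (Suc (Suc k)) \<mu> {0..} V (\<lambda>_. K) (\<lambda>t. hess_p (H t))"
    using hess_hfam by blast
  define N where "N = real CARD('n)"
  define q where "q = (N + 2) * (2 * N)"
  have N: "1 \<le> N" by (simp add: N_def Suc_leI)
  note Qn = Q[folded N_def, folded q_def]
  have Qq: "Q = N * q" by (simp add: Q_def q_def N_def)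
  have bt: "q * b t \<le> Q * b t" if "0 \<le> t" for t using Qn(1) b(1) that by (intro mult_right_mono) (auto intro: less_imp_le)
  have base: "axis l 1 \<in> (Basis :: (real ^ 'n) set)" "(axis l 1, 0) \<in> (Basis :: ((real ^ 'n) \<times> (real ^ 'n)) set)" for l :: 'n
    by (auto simp: axis_in_Basis_iff Basis_prod_def)
  have \<alpha>': "hfam m \<mu> I V (\<lambda>t. Q * a t) \<alpha>" if "hfam m \<mu> I UNIV (\<lambda>t. Q * a t) \<alpha>0" for m I
    unfolding \<alpha>_def[abs_def] by (rule hfam_minus[OF open_phase_space hfam_fst[OF open_phase_space \<mu>(1) that]])
  have \<beta>': "hfam m \<mu> I V (\<lambda>t. Q * b t) \<beta>" if "hfam m \<mu> I UNIV (\<lambda>t. q * b t) \<beta>0" "I \<subseteq> {0..}" for m I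
    unfolding \<beta>_def[abs_def]
    by (rule hfam_mono[OF hfam_fst[OF open_phase_space \<mu>(1) that(1)]]) (use bt that(2) in auto)
  have B': "hfam m \<mu> I V (\<lambda>t. Q * b t) (B i)" if "hfam (Suc m) \<mu> I UNIV (\<lambda>t. q * b t) \<beta>0" for m I i
  proof -
    have "hfam m \<mu> I V (\<lambda>t. q * b t) (\<lambda>t x. partial (axis l 1) (\<beta>0 t) (fst x) $ i)" for l
      by (rule hfam_fst[OF open_phase_space \<mu>(1) hfam_vec_nth[OF open_UNIV hfam_partial[OF that base(1)]]])
    then show ?thesis unfolding B_def[abs_def] Qq N_def mult.assoc
      by (intro hfam_minus[OF open_phase_space] hfam_vec[OF open_phase_space])
  qed
  have A': "hfam m \<mu> I V (\<lambda>_. N * K) (A i)" if "hfam m \<mu> I V (\<lambda>_. K) (\<lambda>t. hess_p (H t))" for m I i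
    unfolding A_def[abs_def] N_def
  proof (rule hfam_vec[OF open_phase_space])
    fix l
    show "hfam m \<mu> I V (\<lambda>_. K) (\<lambda>t x. integral {0..1} (\<lambda>s. 1 *\<^sub>R (hess_p (H t) (fst x, s *\<^sub>R snd x) $ l $ i)))"
      by (rule hfam_fibre_average[OF open_phase_space star \<mu>(1), where w="\<lambda>_. 1" and F="\<lambda>t x. hess_p (H t) x $ l $ i"])
        (auto intro!: hfam_vec_nth open_phase_space that)
  qed
  have C': "hfam m \<mu> I V (\<lambda>_. N * K) (C i j)" if "hfam (Suc m) \<mu> I V (\<lambda>_. K) (\<lambda>t. hess_p (H t))" for m I i j
    unfolding C_def[abs_def] N_def
    by (rule hfam_minus[OF open_phase_space], rule hfam_vec[OF open_phase_space], rule hfam_partial[OF Mc_hfam[OF that] base(2)])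
  have int: "(\<lambda>t. Q * a t) absolutely_integrable_on {0..}" "(\<lambda>t. Q * b t) absolutely_integrable_on {0..}"
    by (rule set_integrable_mult_right[OF a(3)] set_integrable_mult_right[OF b(3)])+
  have "kam_field r \<mu> (N * K) k (\<lambda>t. Q * a t) (\<lambda>t. Q * b t) \<alpha> \<beta> A B C"
  proof (unfold_locales)
    show "0 < r" by (rule r)
    show "0 \<le> \<mu>" "\<mu> \<le> 1" by (rule \<mu>)+
    show "1 \<le> N * K" using mult_mono[of 1 N 1 K] N K by simp
    show "0 < Q * a t" "0 < Q * b t" if "0 \<le> t" for t using Q(2) a(1) b(1) that by auto
    show "Q * a t \<le> Q * a s" "Q * b t \<le> Q * b s" if "0 \<le> s" "s \<le> t" for s t
      by (rule mult_left_mono[OF monotone_onD[OF a(2)]] mult_left_mono[OF monotone_onD[OF b(2)]]; use that Q(2) in auto)+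
    show "coeff_fam (Suc k) \<mu> V (\<lambda>t. Q * a t) \<alpha>"
      unfolding coeff_fam_def using \<alpha>'[OF \<alpha>0_joint] \<alpha>'[OF \<alpha>0_static] by blast
    note \<beta>s = \<beta>0_static[folded N_def, folded q_def] and \<beta>j = \<beta>0_joint[folded N_def, folded q_def]
    show "coeff_fam (Suc k) \<mu> V (\<lambda>t. Q * b t) \<beta>"
      unfolding coeff_fam_def using \<beta>'[OF hfam_Suc_lower[OF \<beta>j]] \<beta>'[OF hfam_Suc_lower[OF \<beta>s]] by simp
    show "coeff_fam (Suc k) \<mu> V (\<lambda>t. Q * b t) (B i)" for i
      unfolding coeff_fam_def using B'[OF \<beta>j] B'[OF \<beta>s] by blast
    show "coeff_fam (Suc k) \<mu> V (\<lambda>_. N * K) (A i)" for i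
      unfolding coeff_fam_def using A'[OF hfam_Suc_lower[OF hj]] A'[OF hfam_Suc_lower[OF hs]] by blast
    show "coeff_fam (Suc k) \<mu> V (\<lambda>_. N * K) (C i j)" for i j
      unfolding coeff_fam_def using C'[OF hj] C'[OF hs] by blast
  qed (rule int)+
  then show ?thesis by blast
qed

end


section \<open>The normal form and the torus\<close>

lemma has_derivative_gradient:
  fixes G :: "(real ^ 'n) \<times> (real ^ 'n) \<Rightarrow> real"
  assumes "G differentiable (at x)"
  shows "(G has_derivative (\<lambda>v. (grad_q G x, grad_p G x) \<bullet> v)) (at x)"
proof -
  have comp: "(grad_q G x, grad_p G x) \<bullet> e = partial e G x" if "e \<in> Basis" for e
    using that by (auto simp: Basis_prod_def Basis_vec_def inner_axis grad_q_def grad_p_def)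
  have "(\<Sum>e\<in>Basis. (v \<bullet> e) *\<^sub>R partial e G x) = (grad_q G x, grad_p G x) \<bullet> v" for v
    unfolding euclidean_inner[of "(grad_q G x, grad_p G x)" v]
    by (rule sum.cong) (simp_all only: comp real_scaleR_def mult.commute)
  with has_derivative_partials[OF assms] show ?thesis by simp
qed

lemma ham_vf_periodic:
  fixes G :: "real \<Rightarrow> (real ^ 'n) \<times> (real ^ 'n) \<Rightarrow> real"
  assumes G: "hamiltonian r G" and t: "0 \<le> t"
  shows "periodic_on phase_lattice (phase_space r) (ham_vf G t)"
  unfolding periodic_on_def
proof (intro ballI)
  fix x m :: "(real ^ 'n) \<times> (real ^ 'n)" assume x: "x \<in> phase_space r" and m: "m \<in> phase_lattice"
  have "periodic_on phase_lattice (phase_space r) (G t)" using G t by (simp add: hamiltonian_def)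
  note p = partial_periodic(1)[OF open_phase_space x this m]
  show "ham_vf G t (x + m) = ham_vf G t x" by (simp add: ham_vf_def grad_p_def grad_q_def p)
qed

context kam_hamiltonian
begin

lemma basis_vectors: "(0, axis i 1) \<in> (Basis :: ((real ^ 'n) \<times> (real ^ 'n)) set)"
  "(axis i 1, 0) \<in> (Basis :: ((real ^ 'n) \<times> (real ^ 'n)) set)" "axis i 1 \<in> (Basis :: (real ^ 'n) set)"
  by (auto simp: axis_in_Basis_iff Basis_prod_def)

lemma taylor_H:
  assumes t: "0 \<le> t" and p: "norm p < r"
  shows "grad_p (H t) (q, p) = grad_p (H t) (q, 0) + (\<Sum>i\<in>UNIV. (p $ i) *\<^sub>R A i t (q, p))"
    and "H t (q, p) = H t (q, 0) + (\<Sum>i\<in>UNIV. p $ i * grad_p (H t) (q, 0) $ i) +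
      (\<Sum>i\<in>UNIV. \<Sum>j\<in>UNIV. p $ i * p $ j * Mc i j t (q, p))"
proof -
  let ?G = "\<lambda>p. H t (q, p)"
  have G1: "partial (axis i 1) ?G = (\<lambda>p. partial (0, axis i 1) (H t) (q, p))" for i
    by (rule ext) (rule partial_fibre(1))
  have G2: "partial (axis j 1) (partial (axis i 1) ?G) = (\<lambda>p. hess_p (H t) (q, p) $ i $ j)" for i j
    unfolding G1 by (rule ext) (simp add: partial_fibre(1) hess_p_def)
  have in_V: "(q, p) \<in> V" if "p \<in> ball 0 r" for p using that by (simp add: phase_space_def)
  obtain K where "hfam (Suc (Suc k)) \<mu> {0..} V (\<lambda>_. K) (\<lambda>t. hess_p (H t))" using hess_hfam by blast
  then have cont: "continuous_on V (hess_p (H t))" by (rule hfam_continuous_at) (use t in simp)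
  have 1: "\<forall>p\<in>ball 0 r. \<forall>i. has_partial (axis i 1) ?G p"
    using H(1) t in_V basis_vectors(1) unfolding partial_fibre(2) hamiltonian_def by blast
  have 2: "\<forall>p\<in>ball 0 r. \<forall>j. has_partial (axis j 1) (partial (axis i 1) ?G) p" for i
    using H(2) t in_V unfolding G1 partial_fibre(2) has_hess_p_def by blast
  have 3: "\<forall>j. continuous_on (ball 0 r) (partial (axis j 1) (partial (axis i 1) ?G))" for i
  proof
    fix j
    have "continuous_on (ball 0 r) (\<lambda>p. hess_p (H t) (q, p))"
      by (rule continuous_on_compose2[OF cont]) (auto intro!: continuous_intros in_V)
    then show "continuous_on (ball 0 r) (partial (axis j 1) (partial (axis i 1) ?G))"
      unfolding G2 by (intro continuous_on_component)
  qed
  have p': "p \<in> ball 0 r" using p by simp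
  note T = taylor_ball[OF 1 2 3 p', unfolded G2, unfolded G1]
  show "grad_p (H t) (q, p) = grad_p (H t) (q, 0) + (\<Sum>i\<in>UNIV. (p $ i) *\<^sub>R A i t (q, p))"
    using T(1) by (simp add: vec_eq_iff grad_p_def A_def)
  show "H t (q, p) = H t (q, 0) + (\<Sum>i\<in>UNIV. p $ i * grad_p (H t) (q, 0) $ i) +
      (\<Sum>i\<in>UNIV. \<Sum>j\<in>UNIV. p $ i * p $ j * Mc i j t (q, p))"
    using T(2) by (simp add: grad_p_def Mc_def)
qed

lemma on_torus: "\<exists>c. \<forall>t\<ge>0. \<forall>q. H t (q, 0) = c + f0 t q \<and> grad_p (H t) (q, 0) = \<omega> + \<beta>0 t q"
proof -
  obtain c where c: "\<And>t q. 0 \<le> t \<Longrightarrow> h t (q, 0) = c" "\<And>t q. 0 \<le> t \<Longrightarrow> grad_p (h t) (q, 0) = \<omega>"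
    and hh: "hamiltonian r h" using h by (auto simp: kolmogorov_nf_def)
  have "H t (q, 0) = c + f0 t q \<and> grad_p (H t) (q, 0) = \<omega> + \<beta>0 t q" if t: "0 \<le> t" for t q
  proof -
    have V0: "(q, 0) \<in> V" using r by (simp add: phase_space_def)
    have "partial (0, axis i 1) (f t) (q, 0) = partial (0, axis i 1) (H t) (q, 0) - partial (0, axis i 1) (h t) (q, 0)" for i
    proof -
      have "partial (0, axis i 1) (f t) (q, 0) = partial (0, axis i 1) (\<lambda>x. H t x - h t x) (q, 0)"
        by (rule partial_cong(1)[OF open_phase_space V0]) (use H_eq t in simp)
      also have "\<dots> = partial (0, axis i 1) (H t) (q, 0) - partial (0, axis i 1) (h t) (q, 0)"
        using H(1) hh t V0 basis_vectors(1) unfolding hamiltonian_def by (intro partial_diff_of_has_partial(1)) blast+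
      finally show ?thesis .
    qed
    then have "\<beta>0 t q = grad_p (H t) (q, 0) - grad_p (h t) (q, 0)" by (simp add: vec_eq_iff \<beta>0_def grad_p_def)
    then show ?thesis using c[OF t, of q] H_eq t V0 by (simp add: f0_def)
  qed
  then show ?thesis by blast
qed

text \<open>The part of \<open>H\<close> that has to be removed to obtain a Hamiltonian in Kolmogorov normal form.\<close>

definition "R t x = f0 t (fst x) + (\<Sum>i\<in>UNIV. snd x $ i * \<beta>0 t (fst x) $ i)"
definition "S t x = (\<Sum>i\<in>UNIV. \<Sum>j\<in>UNIV. snd x $ i * snd x $ j * Mc i j t x)"

lemma momentum_derivative: "((\<lambda>x :: (real ^ 'n) \<times> (real ^ 'n). snd x $ i) has_derivative (\<lambda>v. snd v $ i)) (at x)"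
  by (rule bounded_linear.has_derivative[OF bounded_linear_vec_nth has_derivative_snd[OF has_derivative_ident]])

lemma R_derivative:
  assumes t: "0 \<le> t"
  shows "R t differentiable (at x)"
    and "partial (axis l 1, 0) (R t) x = - (\<alpha> t x + (\<Sum>i\<in>UNIV. (snd x $ i) *\<^sub>R B i t x)) $ l"
    and "partial (0, axis l 1) (R t) x = \<beta> t x $ l"
proof -
  obtain M where M: "hfam (Suc (Suc (Suc k))) \<mu> {t} UNIV (\<lambda>_. M) f0" using f0_static[OF t] by blast
  obtain Df where Df: "(f0 t has_derivative Df) (at (fst x))"
    using hfam_differentiable[OF M, of t "fst x"] by (auto simp: differentiable_def)
  obtain Db where Db: "(\<beta>0 t has_derivative Db) (at (fst x))"
    using hfam_differentiable[OF \<beta>0_static[OF t], of t "fst x"] by (auto simp: differentiable_def)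
  have 1: "((\<lambda>x. f0 t (fst x)) has_derivative (\<lambda>v. Df (fst v))) (at x)"
    by (rule has_derivative_compose[OF has_derivative_fst[OF has_derivative_ident] Df])
  have 2: "((\<lambda>x. \<beta>0 t (fst x) $ i) has_derivative (\<lambda>v. Db (fst v) $ i)) (at x)" for i
    by (rule bounded_linear.has_derivative[OF bounded_linear_vec_nth
          has_derivative_compose[OF has_derivative_fst[OF has_derivative_ident] Db]])
  have D: "(R t has_derivative (\<lambda>v. Df (fst v) + (\<Sum>i\<in>UNIV. snd x $ i * Db (fst v) $ i + snd v $ i * \<beta>0 t (fst x) $ i))) (at x)"
    unfolding R_def[abs_def] by (intro has_derivative_add has_derivative_sum has_derivative_mult 1 2 momentum_derivative)
  show "R t differentiable (at x)" by (rule differentiableI[OF D])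
  have zero: "Df 0 = 0" "Db 0 = 0"
    using linear_0[OF bounded_linear.linear[OF has_derivative_bounded_linear[OF Df]]]
      linear_0[OF bounded_linear.linear[OF has_derivative_bounded_linear[OF Db]]] by auto
  have e: "Df (axis l 1) = partial (axis l 1) (f0 t) (fst x)" "Db (axis l 1) = partial (axis l 1) (\<beta>0 t) (fst x)"
    by (simp_all only: has_partial_of_derivative(2)[OF Df] has_partial_of_derivative(2)[OF Db])
  show "partial (axis l 1, 0) (R t) x = - (\<alpha> t x + (\<Sum>i\<in>UNIV. (snd x $ i) *\<^sub>R B i t x)) $ l"
    unfolding has_partial_of_derivative(2)[OF D] by (simp add: e \<alpha>_def \<alpha>0_eq B_def sum_negf)
  have "(\<Sum>i\<in>UNIV. axis l 1 $ i * \<beta>0 t (fst x) $ i) = (\<Sum>i\<in>UNIV. if i = l then \<beta>0 t (fst x) $ i else 0)"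
    by (rule sum.cong) (auto simp: axis_def)
  then have "(\<Sum>i\<in>UNIV. axis l 1 $ i * \<beta>0 t (fst x) $ i) = \<beta>0 t (fst x) $ l" by simp
  then show "partial (0, axis l 1) (R t) x = \<beta> t x $ l"
    unfolding has_partial_of_derivative(2)[OF D] by (simp add: zero \<beta>_def)
qed

lemma S_derivative:
  assumes t: "0 \<le> t" and x: "x \<in> V"
  shows "S t differentiable (at x)"
    and "partial (axis l 1, 0) (S t) x = - (\<Sum>i\<in>UNIV. \<Sum>j\<in>UNIV. (snd x $ i * snd x $ j) *\<^sub>R C i j t x) $ l"
proof -
  obtain K where "hfam (Suc (Suc k)) \<mu> {0..} V (\<lambda>_. K) (\<lambda>t. hess_p (H t))" using hess_hfam by blast
  note M = Mc_hfam[OF this]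
  have dM: "(Mc i j t has_derivative dq (Mc i j) t x) (at x)" for i j
    by (rule dq_has_derivative[OF hfam_differentiable[OF M _ x]]) (use t in simp)
  have D: "(S t has_derivative (\<lambda>v. \<Sum>i\<in>UNIV. \<Sum>j\<in>UNIV. (snd x $ i * snd x $ j) * dq (Mc i j) t x v +
      (snd x $ i * snd v $ j + snd v $ i * snd x $ j) * Mc i j t x)) (at x)"
    unfolding S_def[abs_def] by (intro has_derivative_sum has_derivative_mult dM momentum_derivative)
  show "S t differentiable (at x)" by (rule differentiableI[OF D])
  have e: "dq (Mc i j) t x (axis l 1, 0) = partial (axis l 1, 0) (Mc i j t) x" for i j
    by (simp only: has_partial_of_derivative(2)[OF dM])
  show "partial (axis l 1, 0) (S t) x = - (\<Sum>i\<in>UNIV. \<Sum>j\<in>UNIV. (snd x $ i * snd x $ j) *\<^sub>R C i j t x) $ l"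
    unfolding has_partial_of_derivative(2)[OF D] by (simp add: e C_def sum_negf)
qed

lemma H_expansion: "\<exists>c. \<forall>t\<ge>0. \<forall>x\<in>V. H t x = c + (\<Sum>i\<in>UNIV. snd x $ i * \<omega> $ i) + (R t x + S t x)"
proof -
  obtain c where c: "\<And>t q. 0 \<le> t \<Longrightarrow> H t (q, 0) = c + f0 t q" "\<And>t q. 0 \<le> t \<Longrightarrow> grad_p (H t) (q, 0) = \<omega> + \<beta>0 t q"
    using on_torus by blast
  have "H t x = c + (\<Sum>i\<in>UNIV. snd x $ i * \<omega> $ i) + (R t x + S t x)" if t: "0 \<le> t" and x: "x \<in> V" for t x
  proof -
    have "norm (snd x) < r" using x by (auto simp: phase_space_def)
    from taylor_H(2)[OF t this, of "fst x"]
    show ?thesis using c[OF t, of "fst x"] by (simp add: R_def S_def sum.distrib algebra_simps)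
  qed
  then show ?thesis by blast
qed

lemma H_gradients:
  assumes t: "0 \<le> t" and x: "x \<in> V"
  shows "H t differentiable (at x)"
    and "grad_p (H t) x = \<omega> + (\<beta> t x + (\<Sum>i\<in>UNIV. (snd x $ i) *\<^sub>R A i t x))"
    and "- grad_q (H t) x = \<alpha> t x + (\<Sum>i\<in>UNIV. (snd x $ i) *\<^sub>R B i t x) + (\<Sum>i\<in>UNIV. \<Sum>j\<in>UNIV. (snd x $ i * snd x $ j) *\<^sub>R C i j t x)"
proof -
  obtain c where c: "\<And>y. y \<in> V \<Longrightarrow> H t y = c + (\<Sum>i\<in>UNIV. snd y $ i * \<omega> $ i) + (R t y + S t y)"
    using H_expansion t by blast
  let ?L = "\<lambda>y :: (real ^ 'n) \<times> (real ^ 'n). c + (\<Sum>i\<in>UNIV. snd y $ i * \<omega> $ i)"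
  have L: "(?L has_derivative (\<lambda>v. 0 + (\<Sum>i\<in>UNIV. snd v $ i * \<omega> $ i))) (at x)"
    by (intro has_derivative_add has_derivative_const has_derivative_sum has_derivative_mult_left momentum_derivative)
  note dR = R_derivative[OF t, where x=x] and dS = S_derivative[OF t x]
  note RS = differentiable_add[OF dR(1) dS(1)]
  have "(\<lambda>y. ?L y + (R t y + S t y)) differentiable (at x)" by (rule differentiable_add[OF differentiableI[OF L] RS])
  then show "H t differentiable (at x)"
    by (rule differentiable_cong[OF open_phase_space x, rotated]) (simp add: c)
  show "grad_p (H t) x = \<omega> + (\<beta> t x + (\<Sum>i\<in>UNIV. (snd x $ i) *\<^sub>R A i t x))"
  proof -
    have "norm (snd x) < r" using x by (auto simp: phase_space_def)
    from taylor_H(1)[OF t this, of "fst x"] show ?thesis using on_torus t by (auto simp: \<beta>_def)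
  qed
  have "partial (axis l 1, 0) (H t) x = partial (axis l 1, 0) (R t) x + partial (axis l 1, 0) (S t) x" for l
  proof -
    have "partial (axis l 1, 0) (H t) x = partial (axis l 1, 0) (\<lambda>y. ?L y + (R t y + S t y)) x"
      by (rule partial_cong(1)[OF open_phase_space x c])
    also have "\<dots> = partial (axis l 1, 0) ?L x + (partial (axis l 1, 0) (R t) x + partial (axis l 1, 0) (S t) x)"
      by (simp only: partial_add[OF differentiableI[OF L] RS] partial_add[OF dR(1) dS(1)])
    also have "partial (axis l 1, 0) ?L x = 0" unfolding has_partial_of_derivative(2)[OF L] by simp
    finally show ?thesis by simp
  qed
  then show "- grad_q (H t) x = \<alpha> t x + (\<Sum>i\<in>UNIV. (snd x $ i) *\<^sub>R B i t x) + (\<Sum>i\<in>UNIV. \<Sum>j\<in>UNIV. (snd x $ i * snd x $ j) *\<^sub>R C i j t x)"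
    unfolding vec_eq_iff grad_q_def dR(2) dS(2) by simp
qed

text \<open>
  \<open>R\<close> contains the terms of order 0 and 1 in \<open>p\<close> that are produced by \<open>f\<close>, so that \<open>h'\<close> keeps the constant value and the
  frequency \<open>\<omega>\<close> on \<open>p = 0\<close>, and its field differs from that of \<open>H\<close> by the field of \<open>R\<close>, which decays in time.
\<close>

definition "h' t x = H t x - R t x"

lemma h'_gradients:
  assumes t: "0 \<le> t" and x: "x \<in> V"
  shows "h' t differentiable (at x)"
    and "grad_p (h' t) x = grad_p (H t) x - \<beta> t x"
    and "- grad_q (h' t) x = - grad_q (H t) x - (\<alpha> t x + (\<Sum>i\<in>UNIV. (snd x $ i) *\<^sub>R B i t x))"
proof -
  note dR = R_derivative[OF t, where x=x] and dH = H_gradients(1)[OF t x]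
  show "h' t differentiable (at x)" unfolding h'_def[abs_def] by (rule differentiable_diff[OF dH dR(1)])
  have p: "partial e (h' t) x = partial e (H t) x - partial e (R t) x" for e
    unfolding h'_def[abs_def]
    by (rule partial_diff_of_has_partial(1)[OF differentiable_has_partial[OF dH] differentiable_has_partial[OF dR(1)]])
  show "grad_p (h' t) x = grad_p (H t) x - \<beta> t x" unfolding vec_eq_iff grad_p_def p dR(3) by simp
  show "- grad_q (h' t) x = - grad_q (H t) x - (\<alpha> t x + (\<Sum>i\<in>UNIV. (snd x $ i) *\<^sub>R B i t x))"
    unfolding vec_eq_iff grad_q_def p dR(2) by simp
qed

lemma h'_hamiltonian: "hamiltonian r h'"
  unfolding hamiltonian_def
proof (intro allI impI conjI ballI)
  fix t :: real assume t: "0 \<le> t"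
  show "has_partial b (h' t) x" if "x \<in> V" "b \<in> Basis" for x b
    by (rule differentiable_has_partial[OF h'_gradients(1)[OF t that(1)]])
  have per: "f0 t (q + m) = f0 t q" "\<beta>0 t (q + m) = \<beta>0 t q" if "m \<in> int_lattice" for q m
    using S_space_of_Sbar[OF f0_space] S_space_of_Sbar[OF fp0] t that
    by (simp_all add: S_space_def periodic_on_def f0_def \<beta>0_def)
  have "periodic_on phase_lattice V (H t)" using H(1) t by (simp add: hamiltonian_def)
  then show "periodic_on phase_lattice V (h' t)"
    by (auto simp: periodic_on_def h'_def R_def phase_lattice_def per)
qed

lemma h'_kolmogorov: "h' \<in> kolmogorov_nf r \<omega>"
proof -
  obtain c where c: "\<And>t q. 0 \<le> t \<Longrightarrow> H t (q, 0) = c + f0 t q" "\<And>t q. 0 \<le> t \<Longrightarrow> grad_p (H t) (q, 0) = \<omega> + \<beta>0 t q"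
    using on_torus by blast
  have "h' t (q, 0) = c \<and> grad_p (h' t) (q, 0) = \<omega>" if t: "0 \<le> t" for t q
  proof -
    have "(q, 0) \<in> V" using r by (simp add: phase_space_def)
    from h'_gradients(2)[OF t this] show ?thesis using c[OF t, of q] by (simp add: h'_def R_def \<beta>_def)
  qed
  then show ?thesis using h'_hamiltonian by (auto simp: kolmogorov_nf_def)
qed

lemma holder_on_of_family:
  assumes "hfam (Suc k) \<mu> {0..} V M X" "0 \<le> t"
  shows "holder_on \<sigma> V (X t)" and "holder_norm \<sigma> V (X t) \<le> ennreal (2 * M t)"
proof -
  have X: "hfam (nat \<lfloor>\<sigma>\<rfloor>) (frac \<sigma>) {0..} V M X" using assms(1) unfolding orders \<mu>_def .
  have "(0, 0) \<in> V" using r by (simp add: phase_space_def)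
  then have M: "0 \<le> M t" using hfam_nonneg[OF X] assms(2) by simp
  show "holder_on \<sigma> V (X t)" "holder_norm \<sigma> V (X t) \<le> ennreal (2 * M t)"
    using holder_on_of_hfam[OF X _ M] holder_norm_le_of_hfam[OF X _ M] assms(2) by simp_all
qed

lemma zero_section_embedding: "torus_embedding r \<sigma> (\<lambda>q :: real ^ 'n. (q, 0))"
  unfolding torus_embedding_def
proof (intro conjI allI ballI impI)
  show "range (\<lambda>q :: real ^ 'n. (q, 0)) \<subseteq> V" using r by (auto simp: phase_space_def)
  have L: "bounded_linear (\<lambda>q :: real ^ 'n. (q, 0 :: real ^ 'n))"
    by (intro bounded_linear_Pair bounded_linear_ident bounded_linear_zero)
  fix \<rho>
  have "\<exists>M\<ge>0. hfam (Suc k) \<mu> {0} (ball 0 \<rho>) (\<lambda>_. M) (\<lambda>_ q :: real ^ 'n. (q, 0 :: real ^ 'n))"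
    by (rule hfam_bounded_linear[OF open_ball \<mu> L, where R="max \<rho> 0"]) auto
  then show "holder_on \<sigma> (ball 0 \<rho>) (\<lambda>q :: real ^ 'n. (q, 0 :: real ^ 'n))"
    using holder_on_of_hfam[of \<sigma> "{0}" "ball 0 \<rho>" _ "\<lambda>_ q. (q, 0)" 0] unfolding orders \<mu>_def by auto
next
  fix q
  have "((\<lambda>q :: real ^ 'n. (q, 0 :: real ^ 'n)) has_derivative (\<lambda>v. (v, 0))) (at q)" by (auto intro!: derivative_eq_intros)
  moreover have "inj (\<lambda>v :: real ^ 'n. (v, 0 :: real ^ 'n))" by (auto simp: inj_def)
  ultimately show "\<exists>D. ((\<lambda>q :: real ^ 'n. (q, 0 :: real ^ 'n)) has_derivative D) (at q) \<and> inj D" by blast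
qed (auto simp: phase_lattice_def)

text \<open>
  The integral equation is solved for the weights \<open>Q a\<close> and \<open>Q b\<close>. The Lagrangian property uses the
  symmetry of the second derivative of \<open>H\<close>, which is the statement that the derivative of \<open>X\<^sub>H\<close> is a
  Hamiltonian matrix.
\<close>

theorem asymptotic_torus:
  assumes "\<exists>\<upsilon>\<ge>0. \<exists>\<Lambda>. \<forall>t\<ge>\<upsilon>. integral {t..} a \<le> \<Lambda> * b t \<and> integral {t..} a * b t \<le> \<Lambda> * (a t * integral {t..} b)"
  shows "\<exists>h'\<in>kolmogorov_nf r \<omega>. \<exists>\<phi>. lagrangian_asymptotic_kam_torus r \<omega> \<sigma> (ham_vf H) (ham_vf h') (\<lambda>q. (q, 0)) \<phi>"
proof -
  obtain \<upsilon> \<Lambda>0 where \<upsilon>: "0 \<le> \<upsilon>" and ab0: "\<And>t. \<upsilon> \<le> t \<Longrightarrow> integral {t..} a \<le> \<Lambda>0 * b t"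
    "\<And>t. \<upsilon> \<le> t \<Longrightarrow> integral {t..} a * b t \<le> \<Lambda>0 * (a t * integral {t..} b)"
    using assms by blast
  define \<Lambda> where "\<Lambda> = max 1 \<Lambda>0"
  have \<Lambda>: "1 \<le> \<Lambda>" "\<Lambda>0 \<le> \<Lambda>" by (auto simp: \<Lambda>_def)
  obtain K where "kam_field r \<mu> K k (\<lambda>t. Q * a t) (\<lambda>t. Q * b t) \<alpha> \<beta> A B C" using field_exists by blast
  then interpret F: kam_field \<omega> r \<mu> K k "\<lambda>t. Q * a t" "\<lambda>t. Q * b t" \<alpha> \<beta> A B C .
  have Q0: "0 < Q" using Q(2) by linarith
  have X: "ham_vf H t x = (\<omega> + F.GU t x, F.GV t x)" if "0 \<le> t" "x \<in> V" for t x
    using H_gradients(2,3)[OF that] by (simp add: ham_vf_def F.GU_def F.GV_def)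
  have X': "ham_vf h' t x = ham_vf H t x - (\<beta> t x, \<alpha> t x + (\<Sum>i\<in>UNIV. (snd x $ i) *\<^sub>R B i t x))" if "0 \<le> t" "x \<in> V" for t x
    using h'_gradients(2,3)[OF that] by (simp add: ham_vf_def)
  have ab: "F.aa t \<le> \<Lambda> * (Q * b t)" "F.aa t * (Q * b t) \<le> \<Lambda> * (Q * a t * F.bb t)" if t: "\<upsilon> \<le> t" for t
  proof -
    have t0: "0 \<le> t" using t \<upsilon> by linarith
    have pos: "0 < a t" "0 < b t" "0 \<le> integral {t..} b"
      using a(1) b(1) t0 tail_antimono(2)[OF b(3,1) t0 order_refl] by auto
    have "\<Lambda>0 * b t \<le> \<Lambda> * b t" "\<Lambda>0 * (a t * integral {t..} b) \<le> \<Lambda> * (a t * integral {t..} b)"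
      using \<Lambda>(2) pos by (intro mult_right_mono; simp)+
    with ab0[OF t] have 1: "integral {t..} a \<le> \<Lambda> * b t" "integral {t..} a * b t \<le> \<Lambda> * (a t * integral {t..} b)" by linarith+
    show "F.aa t \<le> \<Lambda> * (Q * b t)" using mult_left_mono[OF 1(1), of Q] Q0 by (simp add: mult.left_commute)
    show "F.aa t * (Q * b t) \<le> \<Lambda> * (Q * a t * F.bb t)"
      using mult_left_mono[OF 1(2), of "Q * Q"] Q0 by (simp add: mult_ac)
  qed
  have perX: "F.GU t (q + m, p) = F.GU t (q, p) \<and> F.GV t (q + m, p) = F.GV t (q, p)"
    if t: "0 \<le> t" and p: "norm p < r" and m: "m \<in> int_lattice" for t q p m
  proof -
    have "(q, p) \<in> V" "(q + m, p) \<in> V" using p by (auto simp: phase_space_def)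
    moreover have "(m, 0) \<in> phase_lattice" using m by (simp add: phase_lattice_def)
    ultimately have "ham_vf H t ((q, p) + (m, 0)) = ham_vf H t (q, p)"
      using ham_vf_periodic[OF H(1) t] unfolding periodic_on_def by blast
    then show ?thesis using X[OF t \<open>(q, p) \<in> V\<close>] X[OF t \<open>(q + m, p) \<in> V\<close>] by simp
  qed
  obtain T u v c1 c2 m1 m2 where T: "\<upsilon> \<le> T" and sol: "F.reg T (\<lambda>t. c1 * F.bb t) u" "F.reg T (\<lambda>t. c2 * F.aa t) v" "0 \<le> c1" "0 \<le> c2"
     "\<forall>t\<ge>T. c1 * F.bb t \<le> 1 / (2 * real CARD('n))" "\<forall>t\<ge>T. c2 * F.aa t \<le> 1" "\<forall>t\<ge>T. \<forall>q. norm (v t q) < r"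
     "F.reg T (\<lambda>t. m1 * (Q * b t)) (\<lambda>t q. F.GU t (F.psi u v t q))" "F.reg T (\<lambda>t. m2 * (Q * a t)) (\<lambda>t q. F.GV t (F.psi u v t q))"
     "\<forall>t\<ge>T. \<forall>q. u t q = F.TU u v t q \<and> v t q = F.TV u v t q"
     "\<forall>t\<ge>T. \<forall>q. \<forall>m\<in>int_lattice. u t (q + m) = u t q \<and> v t (q + m) = v t q"
    by (rule exE[OF F.asymptotic_solution[OF \<upsilon> \<Lambda>(1) ab conjunct1[OF perX] conjunct2[OF perX]]],
        assumption+, elim exE conjE, rule that, assumption+)
  have T0: "0 \<le> T" using T \<upsilon> by linarith
  interpret S: kam_solution \<omega> r \<mu> K k "\<lambda>t. Q * a t" "\<lambda>t. Q * b t" \<alpha> \<beta> A B C T c1 c2 m1 m2 u v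
    by unfold_locales (use T0 sol in auto)
  have phiV: "S.phi t q \<in> V" if "T \<le> t" for t q using S.ball[OF that] by (simp add: S.phi_def phase_space_def)
  obtain MU MV where MU: "hfam (Suc k) \<mu> {0..} V MU F.GU" and MV: "hfam (Suc k) \<mu> {0..} V MV F.GV" using F.field_hfam by blast
  have XH: "hfam (Suc k) \<mu> {0..} V (\<lambda>t. (norm \<omega> + MU t) + MV t) (ham_vf H)"
  proof (rule hfam_cong[OF open_phase_space])
    show "hfam (Suc k) \<mu> {0..} V (\<lambda>t. (norm \<omega> + MU t) + MV t) (\<lambda>t x. (\<omega> + F.GU t x, F.GV t x))"
      by (intro hfam_Pair hfam_add open_phase_space hfam_const order_refl MU MV)
  qed (use X in simp)
  obtain M where M: "(M \<longlongrightarrow> 0) at_top"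
    and pert: "hfam (Suc k) \<mu> {0..} V M (\<lambda>t x. (\<beta> t x, \<alpha> t x + (\<Sum>i\<in>UNIV. (snd x $ i) *\<^sub>R B i t x)))"
    using F.perturbation_hfam by blast
  have XH': "hfam (Suc k) \<mu> {0..} V (\<lambda>t. ((norm \<omega> + MU t) + MV t) + M t) (ham_vf h')"
    by (rule hfam_cong[OF open_phase_space hfam_diff[OF open_phase_space XH pert]]) (use X' in simp)
  have diffX: "hfam (Suc k) \<mu> {0..} V M (\<lambda>t x. ham_vf H t x - ham_vf h' t x)"
    by (rule hfam_cong[OF open_phase_space pert]) (use X' in simp)
  have sym: "\<exists>DU DV. (F.GU t has_derivative DU) (at z) \<and> (F.GV t has_derivative DV) (at z) \<and>
      (\<forall>x y. DU x \<bullet> snd y - DV x \<bullet> fst y = DU y \<bullet> snd x - DV y \<bullet> fst x)" if t: "0 \<le> t" and z: "z \<in> V" for t z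
  proof -
    have tI: "t \<in> {0..}" using t by simp
    obtain DU DV where D: "(F.GU t has_derivative DU) (at z)" "(F.GV t has_derivative DV) (at z)"
      using hfam_differentiable[OF MU tI z] hfam_differentiable[OF MV tI z] by (auto simp: differentiable_def)
    have "((\<lambda>x. (- F.GV t x, \<omega> + F.GU t x)) has_derivative (\<lambda>x. (- DV x, 0 + DU x))) (at z)"
      by (intro has_derivative_Pair has_derivative_minus has_derivative_add has_derivative_const D)
    then have g: "((\<lambda>x. (grad_q (H t) x, grad_p (H t) x)) has_derivative (\<lambda>x. (- DV x, 0 + DU x))) (at z)"
      by (rule has_derivative_transform_within_open[OF _ open_phase_space z]) (use X[OF t] in \<open>auto simp: ham_vf_def minus_equation_iff\<close>)
    have "(- DV x, 0 + DU x) \<bullet> y = (- DV y, 0 + DU y) \<bullet> x" for x y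
      by (rule second_derivative_symmetric[OF open_phase_space z has_derivative_gradient[OF H_gradients(1)[OF t]] g])
    then have "DU x \<bullet> snd y - DV x \<bullet> fst y = DU y \<bullet> snd x - DV y \<bullet> fst x" for x y
      by (simp add: inner_prod_def)
    with D show ?thesis by blast
  qed
  have \<sigma>: "nat \<lfloor>\<sigma>\<rfloor> = Suc k" "frac \<sigma> = \<mu>" using orders by (auto simp: \<mu>_def)
  have flat: "frechet_derivative (\<lambda>q :: real ^ 'n. (q, 0 :: real ^ 'n)) (at q) = (\<lambda>v. (v, 0))" for q
    by (rule frechet_derivative_at[symmetric]) (auto intro!: derivative_eq_intros)
  have "asymptotic_kam_torus_from T r \<omega> \<sigma> (ham_vf H) (ham_vf h') (\<lambda>q. (q, 0)) S.phi"
    unfolding asymptotic_kam_torus_from_def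
  proof (rule exI[of _ 0], rule exI[of _ "0 :: nat"], intro conjI allI impI)
    show "0 \<le> T" by (rule T0)
    show "torus_embedding r \<sigma> (\<lambda>q :: real ^ 'n. (q, 0))" by (rule zero_section_embedding)
    show "((\<lambda>t. holder_norm (\<sigma> + real 0) V (\<lambda>x. ham_vf H t x - ham_vf h' t x)) \<longlongrightarrow> 0) at_top"
    proof (rule tendsto_sandwich[OF _ _ tendsto_const])
      show "\<forall>\<^sub>F t in at_top. holder_norm (\<sigma> + real 0) V (\<lambda>x. ham_vf H t x - ham_vf h' t x) \<le> ennreal (2 * M t)"
        using eventually_ge_at_top[of 0] by eventually_elim (use holder_on_of_family(2)[OF diffX] in simp)
      have "((\<lambda>t. 2 * M t) \<longlongrightarrow> 2 * 0) at_top" by (intro tendsto_intros M)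
      then show "((\<lambda>t. ennreal (2 * M t)) \<longlongrightarrow> 0) at_top" using tendsto_ennrealI by fastforce
    qed simp
    show "((\<lambda>t. holder_norm \<sigma> UNIV (\<lambda>q. S.phi t q - (q, 0))) \<longlongrightarrow> 0) at_top" by (rule S.phi_tendsto[OF \<sigma>])
  next
    fix t :: real assume t: "0 \<le> t"
    show "periodic_on phase_lattice V (ham_vf H t)" by (rule ham_vf_periodic[OF H(1) t])
    show "periodic_on phase_lattice V (ham_vf h' t)" by (rule ham_vf_periodic[OF h'_hamiltonian t])
    show "holder_on (\<sigma> + real 0) V (ham_vf H t)" using holder_on_of_family(1)[OF XH t] by simp
    show "holder_on (\<sigma> + real 0) V (ham_vf h' t)" using holder_on_of_family(1)[OF XH' t] by simp
  next
    fix t :: real and q :: "real ^ 'n" assume t: "0 \<le> t"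
    have V0: "(q, 0) \<in> V" using r by (simp add: phase_space_def)
    have "grad_p (h' t) (q, 0) = \<omega>" using h'_gradients(2)[OF t V0] H_gradients(2)[OF t V0] by simp
    moreover have "- grad_q (h' t) (q, 0) = 0" using h'_gradients(3)[OF t V0] H_gradients(3)[OF t V0] by simp
    ultimately show "ham_vf h' t (q, 0) = frechet_derivative (\<lambda>q. (q, 0)) (at q) \<omega>"
      unfolding flat by (simp add: ham_vf_def)
  next
    fix t assume t: "T \<le> t"
    show "torus_embedding r \<sigma> (S.phi t)" by (rule S.phi_embedding[OF \<sigma> t])
  next
    fix t and q :: "real ^ 'n" assume t: "T \<le> t"
    have "ham_vf H t (S.phi t q) = (\<omega>, 0) + (F.GU t (S.phi t q), F.GV t (S.phi t q))"
      using X[OF _ phiV[OF t], of t q] t T0 by simp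
    then show "\<exists>d. ((\<lambda>s. S.phi s q) has_vector_derivative d) (at t within {T..}) \<and>
        ham_vf H t (S.phi t q) = frechet_derivative (S.phi t) (at q) \<omega> + d"
      using S.phi_evolution[OF t, of q] by simp
  qed simp
  moreover have "\<forall>t\<ge>T. lagrangian_torus (S.phi t)" using S.phi_lagrangian[OF sym] by blast
  ultimately have "lagrangian_asymptotic_kam_torus r \<omega> \<sigma> (ham_vf H) (ham_vf h') (\<lambda>q. (q, 0)) S.phi"
    unfolding lagrangian_asymptotic_kam_torus_def by blast
  then show ?thesis using h'_kolmogorov by blast
qed

end

theorem theoremA:
  fixes \<omega> :: "real ^ 'n" and \<sigma> r :: real
    and a b :: "real \<Rightarrow> real"
    and H h f :: "real \<Rightarrow> (real ^ 'n) \<times> (real ^ 'n) \<Rightarrow> real"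
  assumes r: "r > 0"
    and \<sigma>: "\<sigma> \<ge> 1"
    and a: "\<forall>t\<ge>0. a t > 0" "antimono_on {0..} a" "a absolutely_integrable_on {0..}"
    and b: "\<forall>t\<ge>0. b t > 0" "antimono_on {0..} b" "b absolutely_integrable_on {0..}"
    and ab: "\<exists>\<upsilon>\<ge>0. \<exists>\<Lambda>. \<forall>t\<ge>\<upsilon>.
               integral {t..} a \<le> \<Lambda> * b t \<and>
               integral {t..} a * b t \<le> \<Lambda> * (a t * integral {t..} b)"
    and H: "hamiltonian r H" "\<forall>t\<ge>0. \<forall>x\<in>phase_space r. has_hess_p (H t) x"
    and H_eq: "\<forall>t\<ge>0. \<forall>x\<in>phase_space r. H t x = h t x + f t x"
    and h: "h \<in> kolmogorov_nf r \<omega>"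
    and f0: "(\<lambda>t q. f t (q, 0)) \<in> Sbar_space 0 \<sigma> 2 int_lattice UNIV"
    and fp0: "(\<lambda>t q. grad_p (f t) (q, 0)) \<in> Sbar_space 0 \<sigma> 2 int_lattice UNIV"
    and Hpp: "(\<lambda>t. hess_p (H t)) \<in> Sbar_space 0 \<sigma> 2 phase_lattice (phase_space r)"
    and f0_bound: "(SUP t\<in>{0..}. holder_norm (\<sigma> + 2) UNIV (\<lambda>q. f t (q, 0))) < \<infinity>"
    and Hpp_bound: "(SUP t\<in>{0..}. holder_norm (\<sigma> + 2) (phase_space r) (hess_p (H t))) < \<infinity>"
    and fq0_bound: "\<forall>t\<ge>0. holder_norm (\<sigma> + 1) UNIV (\<lambda>q. grad_q (f t) (q, 0)) \<le> ennreal (a t)"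
    and fp0_bound: "\<forall>t\<ge>0. holder_norm (\<sigma> + 2) UNIV (\<lambda>q. grad_p (f t) (q, 0)) \<le> ennreal (b t)"
  shows "\<exists>h'\<in>kolmogorov_nf r \<omega>. \<exists>\<phi>.
           lagrangian_asymptotic_kam_torus r \<omega> \<sigma> (ham_vf H) (ham_vf h') (\<lambda>q. (q, 0)) \<phi>"
proof -
  interpret kam_hamiltonian \<omega> \<sigma> r a b H h f
    by unfold_locales (fact r \<sigma> a b H H_eq h f0 fp0 Hpp Hpp_bound fq0_bound fp0_bound)+
  show ?thesis by (rule asymptotic_torus[OF ab])
qed

end
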